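(* Let $\alpha\in(0,2)$ and let $f:\mathbb{R}\to\mathbb{R}$, $f\in L^\alpha(\mathbb{R})$, be compactly supported and not identically zero. Let $X(t)=\int_{\mathbb{R}}f(t-s)\,\Lambda(ds)$, $t\in\mathbb{R}$, be the associated $S\alpha S$ moving average. Let $\Delta_n>0$ with $\Delta_n\to0$ and $n\Delta_n\to\infty$; let $m_n$ be positive integers with $m_n\to\infty$, $m_n=o(n)$; let $\{W_n(m):|m|\le m_n\}$, $n\ge1$, be real weights and $\{a_n\}$ a deterministic sequence of positive numbers. Put $W_n^*=\max_{|m|\le m_n}W_n(m)$, $W_n^{(2)}=\sum_{|m|\le m_n}m^2W_n(m)$ and $\omega_f(\delta)=\sup_{|t-s|<\delta}|f(t)-f(s)|$. Assume that, as $n\to\infty$: (W1) $W_n(m)\ge0$; (W2) $\sum_{|m|\le m_n}W_n(m)=1$; (W3) $W_n^*\to0$; (W4) $W_n^{(2)}=o((n\Delta_n)^2)$; (A1) $a_n\to\infty$; (A2) $a_n^2W_n^*\to0$; (A3) $a_n^{3/4}=o((n\Delta_n)^{1/\alpha})$; (A4) $a_n^2\Delta_n\to0$; (A5) $a_n^2W_n^{(2)}=o((n\Delta_n)^2)$; (F2) $a_n\,\omega_f(\Delta_n)\to0$. Let $g=f/\|f\|_2$, and let $I^s_{n,X}$ and $\tilde g$ be the smoothed self-normalized periodogram and the estimator of $g$ defined in the context. Then: (i) $$a_n\int_{-a_n}^{a_n}\bigl(\Delta_nI^s_{n,X}(\lambda)-|\hat g(\lambda)|^2\bigr)^2\,d\lambda\to0\quad\text{in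 probability as }n\to\infty.$$ (ii) If in addition $f$ is positive semidefinite, then $\|\tilde g-g\|_2\to0$ in probability as $n\to\infty$, where $\|\cdot\|_2$ is the norm of $L^2(\mathbb{R})$.
   Context: $\Lambda$ is an independently scattered symmetric $\alpha$-stable ($S\alpha S$) random measure on $\mathbb{R}$ with Lebesgue control measure: values on disjoint bounded Borel sets are independent and $\mathsf{E}e^{iu\Lambda(B)}=e^{-|B||u|^\alpha}$. The observations are $X(t_{k,n})$, $k=1,\dots,n$, with $t_{k,n}=k\Delta_n$. The self-normalized periodogram is $$I_{n,X}(\lambda)=\frac{\bigl|\sum_{j=1}^nX(t_{j,n})e^{it_{j,n}\lambda}\bigr|^2}{\sum_{j=1}^nX(t_{j,n})^2},$$ and its smoothed version is $$I^s_{n,X}(\lambda)=\sum_{|m|\le m_n}W_n(m)\,I_{n,X}\Bigl(\lambda+\frac{m}{n\Delta_n}\Bigr).$$ The Fourier transform is $\hat g(\lambda)=\int_{\mathbb{R}}g(t)e^{-i\lambda t}dt$. The estimator of $g$ is $$\tilde g(t)=\frac1{2\pi}\int_{-a_n}^{a_n}\sqrt{\Delta_nI^s_{n,X}(\lambda)}\,e^{it\lambda}\,d\lambda,\quad t\in\mathbb{R}.$$ A function $f$ is positive semidefinite if $\sum_{i,j}f(t_i-t_j)z_i\overline{z_j}\ge0$ for all finite families $t_i\in\mathbb{R}$, $z_i\in\mathbb{C}$. *)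

theory Defs
  imports "HOL-Probability.Probability"
begin

text \<open>Convergence to zero in probability. The values are extended reals, so that a quantity which
  may be infinite on some event (such as the norm \<open>L2_norm\<close> below) is allowed. Measurability is part
  of the definition because \<^const>\<open>measure\<close> returns 0 on non-measurable sets.\<close>

definition tendsto_zero_in_prob :: "'a measure \<Rightarrow> (nat \<Rightarrow> 'a \<Rightarrow> ereal) \<Rightarrow> bool" where
  "tendsto_zero_in_prob M Y \<longleftrightarrow>
     (\<forall>n. Y n \<in> borel_measurable M) \<and>
     (\<forall>\<epsilon>>0::real. (\<lambda>n. measure M {\<omega> \<in> space M. \<bar>Y n \<omega>\<bar> > ereal \<epsilon>}) \<longlonglongrightarrow> 0)"

text \<open>Independence is stated for sequences of disjoint sets; finite families are covered, since a
  finite family may be continued by empty sets.\<close>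

locale sas_random_measure = prob_space M
  for M :: "'a measure" and \<alpha> :: real and \<Lambda> :: "real set \<Rightarrow> 'a \<Rightarrow> real" +
  assumes random_variable_values:
    "\<And>B. B \<in> sets borel \<Longrightarrow> bounded B \<Longrightarrow> random_variable borel (\<Lambda> B)"
  and char_values:
    "\<And>B u. B \<in> sets borel \<Longrightarrow> bounded B \<Longrightarrow>
       char (distr M borel (\<Lambda> B)) u =
         complex_of_real (exp (- (measure lborel B * \<bar>u\<bar> powr \<alpha>)))"
  and indep_values:
    "\<And>A :: nat \<Rightarrow> real set. (\<And>i. A i \<in> sets borel) \<Longrightarrow> (\<And>i. bounded (A i)) \<Longrightarrow>
       disjoint_family A \<Longrightarrow> indep_vars (\<lambda>_. borel) (\<lambda>i. \<Lambda> (A i)) UNIV"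
  and countably_additive:
    "\<And>A :: nat \<Rightarrow> real set. (\<And>i. A i \<in> sets borel) \<Longrightarrow> bounded (\<Union>i. A i) \<Longrightarrow>
       disjoint_family A \<Longrightarrow> AE \<omega> in M. (\<lambda>i. \<Lambda> (A i) \<omega>) sums \<Lambda> (\<Union>i. A i) \<omega>"

text \<open>\<open>Y\<close> is a version of the stochastic integral of \<open>h\<close> with respect to \<open>\<Lambda>\<close>: it is the limit in
  probability of the elementary integrals \<open>\<Sum>\<^sub>i c k i \<Lambda>(B k i)\<close> of simple functions that
  approximate \<open>h\<close> in \<open>L\<^sup>\<alpha>\<close>. The limit is almost surely independent of the approximating sequence.\<close>

definition is_stable_integral ::
  "'a measure \<Rightarrow> real \<Rightarrow> (real set \<Rightarrow> 'a \<Rightarrow> real) \<Rightarrow> (real \<Rightarrow> real) \<Rightarrow> ('a \<Rightarrow> real) \<Rightarrow> bool" where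
  "is_stable_integral M \<alpha> \<Lambda> h Y \<longleftrightarrow>
     Y \<in> borel_measurable M \<and>
     (\<exists>(N :: nat \<Rightarrow> nat) (c :: nat \<Rightarrow> nat \<Rightarrow> real) (B :: nat \<Rightarrow> nat \<Rightarrow> real set).
        (\<forall>k. \<forall>i<N k. B k i \<in> sets borel \<and> bounded (B k i)) \<and>
        (\<forall>k. disjoint_family_on (B k) {..<N k}) \<and>
        (\<lambda>k. \<integral>\<^sup>+s. ennreal (\<bar>(\<Sum>i<N k. c k i * indicator (B k i) s) - h s\<bar> powr \<alpha>) \<partial>lebesgue)
          \<longlonglongrightarrow> 0 \<and>
        tendsto_zero_in_prob M (\<lambda>k \<omega>. ereal ((\<Sum>i<N k. c k i * \<Lambda> (B k i) \<omega>) - Y \<omega>)))"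

definition moving_average ::
  "'a measure \<Rightarrow> real \<Rightarrow> (real set \<Rightarrow> 'a \<Rightarrow> real) \<Rightarrow> (real \<Rightarrow> real) \<Rightarrow> (real \<Rightarrow> 'a \<Rightarrow> real) \<Rightarrow> bool" where
  "moving_average M \<alpha> \<Lambda> f X \<longleftrightarrow> (\<forall>t. is_stable_integral M \<alpha> \<Lambda> (\<lambda>s. f (t - s)) (X t))"

text \<open>The norm of \<open>L\<^sup>2(\<real>)\<close>, with value \<open>\<infinity>\<close> outside \<open>L\<^sup>2(\<real>)\<close>.\<close>

definition L2_norm :: "(real \<Rightarrow> 'b::{banach, second_countable_topology}) \<Rightarrow> ereal" where
  "L2_norm h =
     (if h \<in> borel_measurable lebesgue \<and> integrable lebesgue (\<lambda>t. (norm (h t))\<^sup>2)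
      then ereal (sqrt (LINT t|lebesgue. (norm (h t))\<^sup>2)) else \<infinity>)"

definition L2_normalized :: "(real \<Rightarrow> real) \<Rightarrow> real \<Rightarrow> real" where
  "L2_normalized f t = f t / real_of_ereal (L2_norm f)"

definition fourier :: "(real \<Rightarrow> real) \<Rightarrow> real \<Rightarrow> complex" where
  "fourier g \<xi> = (LINT t|lebesgue. complex_of_real (g t) * exp (- (\<i> * of_real \<xi> * of_real t)))"

text \<open>The supremum is taken in the extended reals, since \<open>f\<close> is not assumed to be bounded.\<close>

definition modulus_of_continuity :: "(real \<Rightarrow> real) \<Rightarrow> real \<Rightarrow> ereal" where
  "modulus_of_continuity f \<delta> = (SUP (t, s) \<in> {(t, s). \<bar>t - s\<bar> < \<delta>}. ereal \<bar>f t - f s\<bar>)"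

definition positive_semidefinite :: "(real \<Rightarrow> real) \<Rightarrow> bool" where
  "positive_semidefinite f \<longleftrightarrow>
     (\<forall>(N :: nat) (t :: nat \<Rightarrow> real) (z :: nat \<Rightarrow> complex).
        (\<Sum>i<N. \<Sum>j<N. complex_of_real (f (t i - t j)) * z i * cnj (z j)) \<in> \<real>\<^sub>\<ge>\<^sub>0)"

text \<open>In the following, \<open>x\<close> is a sample path, \<open>\<delta>\<close> the mesh size, \<open>n\<close> the sample size, \<open>m\<close> the
  smoothing half-width and \<open>w\<close> the weights; \<open>a\<close> is the cut-off frequency.\<close>

definition periodogram :: "nat \<Rightarrow> real \<Rightarrow> (real \<Rightarrow> real) \<Rightarrow> real \<Rightarrow> real" where
  "periodogram n \<delta> x \<xi> =
     (cmod (\<Sum>j=1..n. complex_of_real (x (real j * \<delta>)) *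
                       exp (\<i> * of_real (real j * \<delta>) * of_real \<xi>)))\<^sup>2 /
     (\<Sum>j=1..n. (x (real j * \<delta>))\<^sup>2)"

definition smoothed_periodogram ::
  "nat \<Rightarrow> real \<Rightarrow> nat \<Rightarrow> (int \<Rightarrow> real) \<Rightarrow> (real \<Rightarrow> real) \<Rightarrow> real \<Rightarrow> real" where
  "smoothed_periodogram n \<delta> m w x \<xi> =
     (\<Sum>k \<in> {- int m..int m}. w k * periodogram n \<delta> x (\<xi> + of_int k / (real n * \<delta>)))"

text \<open>The weights are not assumed to be symmetric, so the estimator is complex-valued in general.\<close>

definition estimator ::
  "nat \<Rightarrow> real \<Rightarrow> nat \<Rightarrow> (int \<Rightarrow> real) \<Rightarrow> real \<Rightarrow> (real \<Rightarrow> real) \<Rightarrow> real \<Rightarrow> complex" where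
  "estimator n \<delta> m w a x t =
     complex_of_real (1 / (2 * pi)) *
     (LINT \<xi>:{-a..a}|lebesgue.
        complex_of_real (sqrt (\<delta> * smoothed_periodogram n \<delta> m w x \<xi>)) *
        exp (\<i> * of_real t * of_real \<xi>))"

definition max_weight :: "nat \<Rightarrow> (int \<Rightarrow> real) \<Rightarrow> real" where
  "max_weight m w = Max (w ` {- int m..int m})"

definition second_moment_weight :: "nat \<Rightarrow> (int \<Rightarrow> real) \<Rightarrow> real" where
  "second_moment_weight m w = (\<Sum>k \<in> {- int m..int m}. (of_int k)\<^sup>2 * w k)"

end

theory Submission
  imports Defs
begin

text \<open>Replace \<open>\<Lambda>\<close> by its increments \<open>\<epsilon>\<^sub>k\<close> over the cells of a mesh \<open>\<Delta>/q\<close>. Up to edge effects and the error of a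
  Riemann sum, the discrete Fourier transform of the sample is \<open>\<Delta>\<^sup>-\<^sup>1\<close> times the conjugate of the transform of \<open>f\<close> times
  that of the noise, and the sum of squares is \<open>\<Delta>\<^sup>-\<^sup>1 \<parallel>f\<parallel>\<^sup>2 \<Sum> \<epsilon>\<^sub>k\<^sup>2\<close>. So everything reduces to the quadratic forms
  \<open>\<Sum> A k l \<eta>\<^sub>k \<eta>\<^sub>l\<close> in the self-normalized noise \<open>\<eta>\<^sub>k = \<epsilon>\<^sub>k / (\<Sum> \<epsilon>\<^sub>j\<^sup>2)\<^sup>1\<^sup>/\<^sup>2\<close>. Its components are bounded, exchangeable and
  invariant under sign flips, which gives \<open>E \<eta>\<^sub>k\<^sup>2 = 1/N\<close>, \<open>E \<eta>\<^sub>k\<^sup>2 \<eta>\<^sub>l\<^sup>2 \<le> 1/(N (N - 1))\<close> and the vanishing of all odd mixed moments: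
  the heavy tails disappear. The smoothing weights make the off-diagonal part of the periodogram of the noise of order
  \<open>max W\<close> in mean square, since Fourier vectors at frequencies \<open>j/n\<close> and \<open>k/n\<close> have correlation at most of order
  \<open>1/\<bar>j - k\<bar>\<close>. The resulting bound does not depend on \<open>q\<close>, and \<open>q \<longlonglongrightarrow> \<infinity>\<close> yields it for the true moving average. For
  (ii), positive semidefiniteness makes the transform of \<open>f\<close> nonnegative, so it is the root of its squared modulus, and
  Plancherel's identity together with \<open>(x - y)\<^sup>2 \<le> \<bar>x\<^sup>2 - y\<^sup>2\<bar>\<close> reduces the claim to (i).\<close>

subsection \<open>Self-normalized families of symmetric random variables\<close>


text \<open>The denominator of the periodogram may come close to zero, so the moment bounds concern
  the loss truncated at 1. Where the normalized sum of squares misses \<open>energy\<close> by more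
  than half, its variance pays for the truncated loss; elsewhere the quotient depends on numerator
  and denominator in a Lipschitz way. Exchangeability of \<open>\<eta>\<close> is available for
  finitely many increments only, hence the discretization, and bounds free of \<open>q\<close> are
  what makes it removable. They hold because a noise index splits into an observation step, over
  which phases form a geometric sum, and a position within the step, which contributes a plain
  factor \<open>q\<close> that cancels against the number of increments. The passage to the true
  moving average needs its sum of squares to be nonzero almost surely, since the periodogram is a
  quotient of sample values; this comes from averaging the characteristic function over Gaussian
  frequencies, without densities. Continuity of \<open>f\<close> is no hypothesis: (A1) and (F2)
  force it.\<close>

lemma (in prob_space) joint_law_iid:
  assumes "K \<noteq> {}" and indep: "indep_vars (\<lambda>_. borel) X K"
    and law: "\<And>k. k \<in> K \<Longrightarrow> distr M borel (X k) = \<mu>"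
  shows "distr M (PiM K (\<lambda>_. borel)) (\<lambda>\<omega>. \<lambda>k\<in>K. X k \<omega>) = PiM K (\<lambda>_. \<mu>)"
proof -
  have rv: "\<And>k. k \<in> K \<Longrightarrow> random_variable borel (X k)"
    using indep by (auto simp: indep_vars_def)
  have "distr M (PiM K (\<lambda>_. borel)) (\<lambda>\<omega>. \<lambda>k\<in>K. X k \<omega>) = PiM K (\<lambda>k. distr M borel (X k))"
    using indep indep_vars_iff_distr_eq_PiM'[OF assms(1), where M'="\<lambda>_. borel" and X=X] rv by simp
  also have "\<dots> = PiM K (\<lambda>_. \<mu>)"
    by (rule PiM_cong) (auto simp: law)
  finally show ?thesis .
qed

text \<open>Both expectations are integrals against the same product measure. Exchangeability and
  invariance under sign flips are two instances of this.\<close>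

lemma (in prob_space) expectation_cong_iid:
  fixes F :: "('k \<Rightarrow> real) \<Rightarrow> real"
  assumes "K \<noteq> {}"
    and "indep_vars (\<lambda>_. borel) X K" "\<And>k. k \<in> K \<Longrightarrow> distr M borel (X k) = \<mu>"
    and "indep_vars (\<lambda>_. borel) Y K" "\<And>k. k \<in> K \<Longrightarrow> distr M borel (Y k) = \<mu>"
    and F: "F \<in> borel_measurable (PiM K (\<lambda>_. borel))"
  shows "expectation (\<lambda>\<omega>. F (\<lambda>k\<in>K. X k \<omega>)) = expectation (\<lambda>\<omega>. F (\<lambda>k\<in>K. Y k \<omega>))"
proof -
  have "\<And>k. k \<in> K \<Longrightarrow> random_variable borel (X k)" "\<And>k. k \<in> K \<Longrightarrow> random_variable borel (Y k)"
    using assms by (auto simp: indep_vars_def)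
  then have m: "(\<lambda>\<omega>. \<lambda>k\<in>K. X k \<omega>) \<in> measurable M (PiM K (\<lambda>_. borel))"
      "(\<lambda>\<omega>. \<lambda>k\<in>K. Y k \<omega>) \<in> measurable M (PiM K (\<lambda>_. borel))"
    by (auto intro!: measurable_restrict)
  show ?thesis
    using integral_distr[OF m(1) F] integral_distr[OF m(2) F]
      joint_law_iid[OF assms(1,2,3)] joint_law_iid[OF assms(1,4,5)] by simp
qed

text \<open>A power of one law is invariant under permutations of the coordinates, so the permuted
  family again has a product law, and that characterizes independence.\<close>

lemma (in prob_space) indep_vars_permute:
  assumes "K \<noteq> {}" and indep: "indep_vars (\<lambda>_. borel) X K"
    and law: "\<And>k. k \<in> K \<Longrightarrow> distr M borel (X k) = \<mu>" and bij: "bij_betw \<pi> K K"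
  shows "indep_vars (\<lambda>_. borel) (\<lambda>k. X (\<pi> k)) K"
proof -
  have inK: "\<And>k. k \<in> K \<Longrightarrow> \<pi> k \<in> K" using bij by (auto simp: bij_betw_def)
  have rv: "\<And>k. k \<in> K \<Longrightarrow> random_variable borel (X k)"
    using indep by (auto simp: indep_vars_def)
  obtain k0 where k0: "k0 \<in> K" using assms(1) by auto
  have mu: "prob_space \<mu>" "sets \<mu> = sets borel"
    using prob_space_distr[OF rv[OF k0]] law[OF k0] by auto
  have m: "(\<lambda>\<omega>. \<lambda>k\<in>K. X k \<omega>) \<in> measurable M (PiM K (\<lambda>_. borel))"
    using rv by (auto intro!: measurable_restrict)
  have s: "sets (PiM K (\<lambda>_. \<mu>)) = sets (PiM K (\<lambda>_. borel))"
    by (intro sets_PiM_cong) (auto simp: mu)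
  have m2: "(\<lambda>x. \<lambda>n\<in>K. x (\<pi> n)) \<in> measurable (PiM K (\<lambda>_. borel)) (PiM K (\<lambda>_. borel))"
    by (intro measurable_restrict measurable_component_singleton inK)
  have "distr M (PiM K (\<lambda>_. borel)) (\<lambda>\<omega>. \<lambda>k\<in>K. X (\<pi> k) \<omega>)
      = distr (distr M (PiM K (\<lambda>_. borel)) (\<lambda>\<omega>. \<lambda>k\<in>K. X k \<omega>)) (PiM K (\<lambda>_. borel)) (\<lambda>x. \<lambda>n\<in>K. x (\<pi> n))"
    by (subst distr_distr[OF m2 m]) (auto intro!: distr_cong simp: inK restrict_def fun_eq_iff)
  also have "\<dots> = distr (PiM K (\<lambda>_. \<mu>)) (PiM K (\<lambda>_. \<mu>)) (\<lambda>x. \<lambda>n\<in>K. x (\<pi> n))"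
    by (subst joint_law_iid[OF assms(1-3)]) (auto intro!: distr_cong simp: s)
  also have "\<dots> = PiM K (\<lambda>_. \<mu>)"
    using distr_PiM_reindex[of K "\<lambda>_. \<mu>" \<pi> K] bij mu inK by (auto simp: bij_betw_def)
  also have "\<dots> = PiM K (\<lambda>k. distr M borel (X (\<pi> k)))"
    by (rule PiM_cong) (auto simp: law inK)
  finally show ?thesis
    using indep_vars_iff_distr_eq_PiM'[OF assms(1), where M'="\<lambda>_. borel" and X="\<lambda>k. X (\<pi> k)"] rv inK by simp
qed

text \<open>No moments are assumed, so heavy tails are allowed: symmetry serves the sign flips, and
  the absence of an atom at zero makes the normalization meaningful almost surely.\<close>

locale iid_symmetric_family = prob_space M for M :: "'a measure" +
  fixes K :: "'k set" and \<epsilon> :: "'k \<Rightarrow> 'a \<Rightarrow> real" and \<mu> :: "real measure"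
  assumes finite_K: "finite K" and K_ne: "K \<noteq> {}"
    and indep: "indep_vars (\<lambda>_. borel) \<epsilon> K"
    and law: "\<And>k. k \<in> K \<Longrightarrow> distr M borel (\<epsilon> k) = \<mu>"
    and symmetric: "distr \<mu> borel uminus = \<mu>"
    and nonzero: "\<And>k. k \<in> K \<Longrightarrow> AE \<omega> in M. \<epsilon> k \<omega> \<noteq> 0"
begin

definition Q :: "'a \<Rightarrow> real" where "Q \<omega> = (\<Sum>k\<in>K. (\<epsilon> k \<omega>)\<^sup>2)"

definition \<eta> :: "'k \<Rightarrow> 'a \<Rightarrow> real" where "\<eta> k \<omega> = \<epsilon> k \<omega> / sqrt (Q \<omega>)"

lemma measurable_\<epsilon> [measurable]: "k \<in> K \<Longrightarrow> \<epsilon> k \<in> borel_measurable M"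
  using indep by (auto simp: indep_vars_def)

lemma measurable_Q [measurable]: "Q \<in> borel_measurable M"
  unfolding Q_def by measurable

lemma measurable_\<eta> [measurable]: "k \<in> K \<Longrightarrow> \<eta> k \<in> borel_measurable M"
  unfolding \<eta>_def by measurable

lemma Q_nonneg: "Q \<omega> \<ge> 0" by (simp add: Q_def sum_nonneg)

lemma AE_Q_pos: "AE \<omega> in M. Q \<omega> > 0"
proof -
  obtain k where k: "k \<in> K" using K_ne by auto
  show ?thesis
    using nonzero[OF k]
  proof eventually_elim
    case (elim \<omega>)
    then have "0 < (\<epsilon> k \<omega>)\<^sup>2" by simp
    also have "\<dots> \<le> Q \<omega>" unfolding Q_def using k finite_K by (intro member_le_sum) auto
    finally show ?case .
  qed
qed

text \<open>Division by zero returns zero, so the normalized vector vanishes where \<open>Q\<close>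
  does. The bounds by 1 that follow therefore hold at every point and not only almost
  everywhere.\<close>

lemma sum_\<eta>_sq: "(\<Sum>k\<in>K. (\<eta> k \<omega>)\<^sup>2) = (if Q \<omega> = 0 then 0 else 1)"
proof -
  have "(\<Sum>k\<in>K. (\<eta> k \<omega>)\<^sup>2) = Q \<omega> / Q \<omega>"
    by (simp add: \<eta>_def power_divide Q_nonneg sum_divide_distrib[symmetric] flip: Q_def)
  then show ?thesis by simp
qed

lemma \<eta>_sq_le: "k \<in> K \<Longrightarrow> (\<eta> k \<omega>)\<^sup>2 \<le> 1"
proof -
  assume "k \<in> K"
  then have "(\<eta> k \<omega>)\<^sup>2 \<le> (\<Sum>k\<in>K. (\<eta> k \<omega>)\<^sup>2)"
    using finite_K by (intro member_le_sum) auto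
  then show ?thesis by (simp add: sum_\<eta>_sq split: if_splits)
qed

lemma \<eta>_abs_le: "k \<in> K \<Longrightarrow> \<bar>\<eta> k \<omega>\<bar> \<le> 1"
  using \<eta>_sq_le[of k \<omega>] by (simp add: abs_square_le_1)

lemma expectation_permute:
  assumes bij: "bij_betw \<pi> K K" and G: "G \<in> borel_measurable (PiM K (\<lambda>_. borel))"
  shows "expectation (\<lambda>\<omega>. G (\<lambda>k\<in>K. \<epsilon> (\<pi> k) \<omega>)) = expectation (\<lambda>\<omega>. G (\<lambda>k\<in>K. \<epsilon> k \<omega>) :: real)"
proof (rule expectation_cong_iid[where \<mu>=\<mu>, OF K_ne _ _ indep law G])
  show "indep_vars (\<lambda>_. borel) (\<lambda>k. \<epsilon> (\<pi> k)) K"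
    by (rule indep_vars_permute[OF K_ne indep law bij])
qed (use bij in \<open>auto simp: bij_betw_def intro!: law\<close>)

lemma expectation_flip:
  assumes G: "G \<in> borel_measurable (PiM K (\<lambda>_. borel))"
  shows "expectation (\<lambda>\<omega>. G (\<lambda>k\<in>K. if k = x then - \<epsilon> k \<omega> else \<epsilon> k \<omega>))
      = expectation (\<lambda>\<omega>. G (\<lambda>k\<in>K. \<epsilon> k \<omega>) :: real)"
proof (intro expectation_cong_iid[where \<mu>=\<mu>] K_ne indep law G)
  have "indep_vars (\<lambda>_. borel) (\<lambda>k \<omega>. (if k = x then uminus else id) (\<epsilon> k \<omega>)) K"
    by (rule indep_vars_compose2[OF indep]) auto
  then show "indep_vars (\<lambda>_. borel) (\<lambda>k \<omega>. if k = x then - \<epsilon> k \<omega> else \<epsilon> k \<omega>) K"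
    by (rule indep_vars_cong[THEN iffD1, rotated -1]) auto
  fix k assume k: "k \<in> K"
  have "distr M borel (\<lambda>\<omega>. - \<epsilon> k \<omega>) = distr (distr M borel (\<epsilon> k)) borel uminus"
    using k by (subst distr_distr) (auto simp: o_def)
  then show "distr M borel (\<lambda>\<omega>. if k = x then - \<epsilon> k \<omega> else \<epsilon> k \<omega>) = \<mu>"
    using law[OF k] symmetric by (cases "k = x") auto
qed

text \<open>A fourth order monomial in \<open>\<eta>\<close>, encoded as a functional of the raw
  values, because the invariance lemmas speak about functionals of the joint vector.\<close>

definition mixed4 :: "'k \<Rightarrow> 'k \<Rightarrow> 'k \<Rightarrow> 'k \<Rightarrow> ('k \<Rightarrow> real) \<Rightarrow> real" where
  "mixed4 k l k' l' v = v k * v l * v k' * v l' / (sqrt (\<Sum>j\<in>K. (v j)\<^sup>2)) ^ 4"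

lemma mixed4_measurable:
  assumes "k \<in> K" "l \<in> K" "k' \<in> K" "l' \<in> K"
  shows "mixed4 k l k' l' \<in> borel_measurable (PiM K (\<lambda>_. borel))"
  unfolding mixed4_def using assms by measurable

lemma mixed4_eq:
  assumes "k \<in> K" "l \<in> K" "k' \<in> K" "l' \<in> K"
  shows "mixed4 k l k' l' (\<lambda>k\<in>K. \<epsilon> k \<omega>) = \<eta> k \<omega> * \<eta> l \<omega> * \<eta> k' \<omega> * \<eta> l' \<omega>"
  using assms by (simp add: mixed4_def \<eta>_def Q_def power4_eq_xxxx)

text \<open>The index \<open>k'\<close> occurs once. Flipping the sign of its variable reverses the
  monomial and leaves the normalization, a function of squares, unchanged.\<close>

lemma expectation_odd:
  assumes "k \<in> K" "l \<in> K" "k' \<in> K" "l' \<in> K" "k' \<noteq> k" "k' \<noteq> l" "k' \<noteq> l'"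
  shows "expectation (\<lambda>\<omega>. \<eta> k \<omega> * \<eta> l \<omega> * \<eta> k' \<omega> * \<eta> l' \<omega>) = 0"
proof -
  have sq: "(\<Sum>j\<in>K. ((\<lambda>k\<in>K. if k = k' then - \<epsilon> k \<omega> else \<epsilon> k \<omega>) j)\<^sup>2) = (\<Sum>j\<in>K. ((\<lambda>k\<in>K. \<epsilon> k \<omega>) j)\<^sup>2)" for \<omega>
    by (intro sum.cong) auto
  have "mixed4 k l k' l' (\<lambda>k\<in>K. if k = k' then - \<epsilon> k \<omega> else \<epsilon> k \<omega>) = - mixed4 k l k' l' (\<lambda>k\<in>K. \<epsilon> k \<omega>)" for \<omega>
    unfolding mixed4_def sq using assms by auto
  then have "expectation (\<lambda>\<omega>. - mixed4 k l k' l' (\<lambda>k\<in>K. \<epsilon> k \<omega>)) = expectation (\<lambda>\<omega>. mixed4 k l k' l' (\<lambda>k\<in>K. \<epsilon> k \<omega>))"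
    using expectation_flip[OF mixed4_measurable[OF assms(1-4)], of k'] by simp
  then show ?thesis using mixed4_eq[OF assms(1-4)] by simp
qed

lemma sum_permute:
  assumes "bij_betw \<pi> K K"
  shows "(\<Sum>j\<in>K. ((\<lambda>k\<in>K. \<epsilon> (\<pi> k) \<omega>) j)\<^sup>2) = (\<Sum>j\<in>K. ((\<lambda>k\<in>K. \<epsilon> k \<omega>) j)\<^sup>2)"
  using sum.reindex_bij_betw[OF assms, of "\<lambda>k. (\<epsilon> k \<omega>)\<^sup>2"] by simp

lemma expectation_sq_permute:
  assumes "k \<in> K" "l \<in> K" and bij: "bij_betw \<pi> K K"
  shows "expectation (\<lambda>\<omega>. (\<eta> (\<pi> k) \<omega>)\<^sup>2 * (\<eta> (\<pi> l) \<omega>)\<^sup>2) = expectation (\<lambda>\<omega>. (\<eta> k \<omega>)\<^sup>2 * (\<eta> l \<omega>)\<^sup>2)"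
proof -
  have inK: "\<pi> k \<in> K" "\<pi> l \<in> K" using bij assms by (auto simp: bij_betw_def)
  have "mixed4 k k l l (\<lambda>k\<in>K. \<epsilon> (\<pi> k) \<omega>) = mixed4 (\<pi> k) (\<pi> k) (\<pi> l) (\<pi> l) (\<lambda>k\<in>K. \<epsilon> k \<omega>)" for \<omega>
    unfolding mixed4_def sum_permute[OF bij] using assms inK by auto
  then have "mixed4 k k l l (\<lambda>k\<in>K. \<epsilon> (\<pi> k) \<omega>) = (\<eta> (\<pi> k) \<omega>)\<^sup>2 * (\<eta> (\<pi> l) \<omega>)\<^sup>2"
     "mixed4 k k l l (\<lambda>k\<in>K. \<epsilon> k \<omega>) = (\<eta> k \<omega>)\<^sup>2 * (\<eta> l \<omega>)\<^sup>2" for \<omega>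
    using mixed4_eq inK assms by (auto simp: power2_eq_square mult_ac)
  then show ?thesis using expectation_permute[OF bij mixed4_measurable[of k k l l]] assms by simp
qed

lemma bij_transpose: "a \<in> K \<Longrightarrow> b \<in> K \<Longrightarrow> bij_betw (Transposition.transpose a b) K K"
  by (metis permutes_imp_bij permutes_swap_id)

lemma expectation_sq_const:
  assumes "k \<in> K" "l \<in> K" "k \<noteq> l" "k' \<in> K" "l' \<in> K" "k' \<noteq> l'"
  shows "expectation (\<lambda>\<omega>. (\<eta> k \<omega>)\<^sup>2 * (\<eta> l \<omega>)\<^sup>2) = expectation (\<lambda>\<omega>. (\<eta> k' \<omega>)\<^sup>2 * (\<eta> l' \<omega>)\<^sup>2)"
proof -
  \<comment> \<open>Two transpositions suffice: the first carries \<open>k\<close> to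
    \<open>k'\<close> and \<open>l\<close> to \<open>l1\<close>; the second carries
    \<open>l1\<close> to \<open>l'\<close> and fixes \<open>k'\<close>, which differs from
    both.\<close>
  define l1 where "l1 = Transposition.transpose k k' l"
  have l1: "l1 \<in> K" "l1 \<noteq> k'" using assms by (auto simp: l1_def Transposition.transpose_def)
  have "expectation (\<lambda>\<omega>. (\<eta> k \<omega>)\<^sup>2 * (\<eta> l \<omega>)\<^sup>2) = expectation (\<lambda>\<omega>. (\<eta> k' \<omega>)\<^sup>2 * (\<eta> l1 \<omega>)\<^sup>2)"
    using expectation_sq_permute[OF assms(1,2) bij_transpose[OF assms(1,4)]] by (simp add: l1_def)
  also have "\<dots> = expectation (\<lambda>\<omega>. (\<eta> k' \<omega>)\<^sup>2 * (\<eta> l' \<omega>)\<^sup>2)"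
    using expectation_sq_permute[OF assms(4) l1(1) bij_transpose[OF l1(1) assms(5)]] l1 assms by simp
  finally show ?thesis .
qed

lemma integrable_bounded:
  assumes "g \<in> borel_measurable M" "\<And>\<omega>. \<bar>g \<omega>\<bar> \<le> (c::real)"
  shows "integrable M g"
  using assms by (intro integrable_const_bound[where B=c]) auto

lemma expectation_\<eta>_sq:
  assumes k: "k \<in> K"
  shows "expectation (\<lambda>\<omega>. (\<eta> k \<omega>)\<^sup>2) = 1 / card K"
proof -
  have int: "integrable M (\<lambda>\<omega>. (\<eta> j \<omega>)\<^sup>2)" if "j \<in> K" for j
    using that \<eta>_sq_le by (intro integrable_bounded[where c=1]) auto
  have eq: "expectation (\<lambda>\<omega>. (\<eta> j \<omega>)\<^sup>2) = expectation (\<lambda>\<omega>. (\<eta> k \<omega>)\<^sup>2)" if j: "j \<in> K" for j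
  proof -
    \<comment> \<open>Multiplying by the sum of all squares, which is 1 unless the left factor
      vanishes anyway, turns second moments into fourth moments, to which the permutation lemma
      applies.\<close>
    have "expectation (\<lambda>\<omega>. (\<eta> i \<omega>)\<^sup>2) = (\<Sum>l\<in>K. expectation (\<lambda>\<omega>. (\<eta> i \<omega>)\<^sup>2 * (\<eta> l \<omega>)\<^sup>2))" if "i \<in> K" for i
    proof -
      have "expectation (\<lambda>\<omega>. (\<eta> i \<omega>)\<^sup>2) = expectation (\<lambda>\<omega>. \<Sum>l\<in>K. (\<eta> i \<omega>)\<^sup>2 * (\<eta> l \<omega>)\<^sup>2)"
      proof (intro Bochner_Integration.integral_cong refl)
        fix \<omega>
        show "(\<eta> i \<omega>)\<^sup>2 = (\<Sum>l\<in>K. (\<eta> i \<omega>)\<^sup>2 * (\<eta> l \<omega>)\<^sup>2)"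
          unfolding sum_distrib_left[symmetric] sum_\<eta>_sq by (simp add: \<eta>_def)
      qed
      also have "\<dots> = (\<Sum>l\<in>K. expectation (\<lambda>\<omega>. (\<eta> i \<omega>)\<^sup>2 * (\<eta> l \<omega>)\<^sup>2))"
        using that \<eta>_sq_le
        by (intro Bochner_Integration.integral_sum integrable_bounded[where c=1])
          (auto simp: abs_mult intro!: mult_le_one)
      finally show ?thesis .
    qed
    note * = this
    have "(\<Sum>l\<in>K. expectation (\<lambda>\<omega>. (\<eta> j \<omega>)\<^sup>2 * (\<eta> l \<omega>)\<^sup>2))
        = (\<Sum>l\<in>K. expectation (\<lambda>\<omega>. (\<eta> (Transposition.transpose k j k) \<omega>)\<^sup>2 * (\<eta> (Transposition.transpose k j l) \<omega>)\<^sup>2))"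
      using sum.reindex_bij_betw[OF bij_transpose[OF k j], of "\<lambda>l. expectation (\<lambda>\<omega>. (\<eta> j \<omega>)\<^sup>2 * (\<eta> l \<omega>)\<^sup>2)"]
      by simp
    also have "\<dots> = (\<Sum>l\<in>K. expectation (\<lambda>\<omega>. (\<eta> k \<omega>)\<^sup>2 * (\<eta> l \<omega>)\<^sup>2))"
      using k j by (intro sum.cong refl expectation_sq_permute bij_transpose)
    finally show ?thesis using *[OF j] *[OF k] by simp
  qed
  have "1 = expectation (\<lambda>\<omega>. \<Sum>j\<in>K. (\<eta> j \<omega>)\<^sup>2)"
  proof -
    have "expectation (\<lambda>\<omega>. \<Sum>j\<in>K. (\<eta> j \<omega>)\<^sup>2) = expectation (\<lambda>\<omega>. 1)"
      by (rule integral_cong_AE) (use AE_Q_pos in \<open>auto simp: sum_\<eta>_sq\<close>)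
    then show ?thesis by (simp add: prob_space)
  qed
  also have "\<dots> = (\<Sum>j\<in>K. expectation (\<lambda>\<omega>. (\<eta> j \<omega>)\<^sup>2))"
    using int by (intro Bochner_Integration.integral_sum) auto
  also have "\<dots> = card K * expectation (\<lambda>\<omega>. (\<eta> k \<omega>)\<^sup>2)"
    using eq by simp
  finally show ?thesis using finite_K K_ne by (simp add: field_simps)
qed

text \<open>By exchangeability all ordered pairs of distinct indices have the same expectation, and
  their sum is at most the expected square of the total mass, hence at most 1.\<close>

lemma expectation_\<eta>_sq_sq_le:
  assumes "k \<in> K" "l \<in> K" "k \<noteq> l"
  shows "expectation (\<lambda>\<omega>. (\<eta> k \<omega>)\<^sup>2 * (\<eta> l \<omega>)\<^sup>2) \<le> 1 / (real (card K) * (real (card K) - 1))"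
proof -
  let ?P = "SIGMA i:K. K - {i}"
  have c2: "card K \<ge> 2"
    using assms finite_K by (metis card_2_iff card_mono empty_subsetI insert_subset)
  have card: "real (card ?P) = real (card K) * (real (card K) - 1)"
    using finite_K c2 by (simp add: card_SigmaI of_nat_diff)
  have int: "integrable M (\<lambda>\<omega>. (\<eta> i \<omega>)\<^sup>2 * (\<eta> j \<omega>)\<^sup>2)" if "i \<in> K" "j \<in> K" for i j
    using that \<eta>_sq_le by (intro integrable_bounded[where c=1]) (auto simp: abs_mult intro!: mult_le_one)
  have "real (card ?P) * expectation (\<lambda>\<omega>. (\<eta> k \<omega>)\<^sup>2 * (\<eta> l \<omega>)\<^sup>2)
      = (\<Sum>(i, j)\<in>?P. expectation (\<lambda>\<omega>. (\<eta> i \<omega>)\<^sup>2 * (\<eta> j \<omega>)\<^sup>2))"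
  proof -
    have "(\<Sum>(i, j)\<in>?P. expectation (\<lambda>\<omega>. (\<eta> i \<omega>)\<^sup>2 * (\<eta> j \<omega>)\<^sup>2))
        = (\<Sum>_\<in>?P. expectation (\<lambda>\<omega>. (\<eta> k \<omega>)\<^sup>2 * (\<eta> l \<omega>)\<^sup>2))"
    proof (rule sum.cong[OF refl])
      fix p assume "p \<in> ?P"
      then obtain i j where "p = (i, j)" "i \<in> K" "j \<in> K" "i \<noteq> j" by auto
      then show "(case p of (i, j) \<Rightarrow> expectation (\<lambda>\<omega>. (\<eta> i \<omega>)\<^sup>2 * (\<eta> j \<omega>)\<^sup>2))
          = expectation (\<lambda>\<omega>. (\<eta> k \<omega>)\<^sup>2 * (\<eta> l \<omega>)\<^sup>2)"
        using expectation_sq_const[of i j k l] assms by simp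
    qed
    then show ?thesis by simp
  qed
  also have "\<dots> = expectation (\<lambda>\<omega>. \<Sum>(i, j)\<in>?P. (\<eta> i \<omega>)\<^sup>2 * (\<eta> j \<omega>)\<^sup>2)"
    using int by (subst Bochner_Integration.integral_sum) (auto simp: case_prod_beta intro!: sum.cong)
  also have "\<dots> \<le> expectation (\<lambda>\<omega>. 1)"
  proof (rule integral_mono)
    show "integrable M (\<lambda>\<omega>. \<Sum>(i, j)\<in>?P. (\<eta> i \<omega>)\<^sup>2 * (\<eta> j \<omega>)\<^sup>2)"
      using int by (auto simp: case_prod_beta)
    fix \<omega>
    have "(\<Sum>(i, j)\<in>?P. (\<eta> i \<omega>)\<^sup>2 * (\<eta> j \<omega>)\<^sup>2) \<le> (\<Sum>(i, j)\<in>K\<times>K. (\<eta> i \<omega>)\<^sup>2 * (\<eta> j \<omega>)\<^sup>2)"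
      using finite_K by (intro sum_mono2) auto
    also have "\<dots> = (\<Sum>i\<in>K. (\<eta> i \<omega>)\<^sup>2) * (\<Sum>i\<in>K. (\<eta> i \<omega>)\<^sup>2)"
      by (simp add: sum_product sum.cartesian_product)
    also have "\<dots> \<le> 1" by (simp add: sum_\<eta>_sq)
    finally show "(\<Sum>(i, j)\<in>?P. (\<eta> i \<omega>)\<^sup>2 * (\<eta> j \<omega>)\<^sup>2) \<le> 1" .
  qed auto
  finally have "real (card K) * (real (card K) - 1) * expectation (\<lambda>\<omega>. (\<eta> k \<omega>)\<^sup>2 * (\<eta> l \<omega>)\<^sup>2) \<le> 1"
    using card by (simp add: prob_space)
  moreover have "real (card K) * (real (card K) - 1) > 0" using c2 by simp
  ultimately show ?thesis by (simp add: field_simps)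
qed

text \<open>By sign flips, the fourth order moments vanish unless the two pairs of indices agree up to order.\<close>

lemma chaos_second_moment:
  fixes A :: "'k \<Rightarrow> 'k \<Rightarrow> real"
  shows "expectation (\<lambda>\<omega>. (\<Sum>(k, l)\<in>(SIGMA k:K. K - {k}). A k l * (\<eta> k \<omega> * \<eta> l \<omega>))\<^sup>2)
    \<le> 2 / (real (card K) * (real (card K) - 1)) * (\<Sum>(k, l)\<in>(SIGMA k:K. K - {k}). (A k l)\<^sup>2)"
proof -
  let ?P = "SIGMA k:K. K - {k}"
  let ?N = "real (card K) * (real (card K) - 1)"
  let ?m = "\<lambda>p p' \<omega>. \<eta> (fst p) \<omega> * \<eta> (snd p) \<omega> * \<eta> (fst p') \<omega> * \<eta> (snd p') \<omega>"
  let ?A = "\<lambda>p. A (fst p) (snd p)"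
  have fin: "finite ?P" using finite_K by auto
  have int: "integrable M (?m p p')" if "p \<in> ?P" "p' \<in> ?P" for p p'
    using that \<eta>_abs_le
    by (intro integrable_bounded[where c=1]) (auto simp: abs_mult intro!: mult_le_one)
  \<comment> \<open>Only \<open>p' = p\<close> and \<open>p'\<close> equal to \<open>p\<close>
    swapped survive. \<open>A\<close> need not be symmetric, so the mixed product is split into
    squares; summed over \<open>p\<close>, the two survivors give the factor 2 of the
    statement.\<close>
  have bound: "(\<Sum>p'\<in>?P. ?A p * ?A p' * expectation (?m p p'))
      \<le> 1 / ?N * ((?A p)\<^sup>2 + ((?A p)\<^sup>2 + (?A (prod.swap p))\<^sup>2) / 2)" if p: "p \<in> ?P" for p
  proof -
    obtain k l where kl: "p = (k, l)" "k \<in> K" "l \<in> K" "k \<noteq> l" using p by auto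
    let ?e = "expectation (\<lambda>\<omega>. (\<eta> k \<omega>)\<^sup>2 * (\<eta> l \<omega>)\<^sup>2)"
    have zero: "expectation (?m p p') = 0" if p': "p' \<in> ?P" "p' \<noteq> (k, l)" "p' \<noteq> (l, k)" for p'
    proof -
      obtain k' l' where kl': "p' = (k', l')" "k' \<in> K" "l' \<in> K" "k' \<noteq> l'" using p' by auto
      consider "k' \<noteq> k" "k' \<noteq> l" | "l' \<noteq> k" "l' \<noteq> l" using p' kl' kl by auto
      then show ?thesis
      proof cases
        case 1
        then show ?thesis using expectation_odd[of k l k' l'] kl kl' by simp
      next
        case 2
        then show ?thesis using expectation_odd[of k l l' k'] kl kl' by (simp add: mult_ac)
      qed
    qed
    have "(\<Sum>p'\<in>?P. ?A p * ?A p' * expectation (?m p p'))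
       = (\<Sum>p'\<in>{(k, l), (l, k)}. ?A p * ?A p' * expectation (?m p p'))"
      using kl zero by (intro sum.mono_neutral_right fin) auto
    also have "\<dots> = ?e * (A k l * A k l + A k l * A l k)"
      using kl by (simp add: power2_eq_square mult_ac algebra_simps)
    also have "\<dots> \<le> ?e * ((A k l)\<^sup>2 + ((A k l)\<^sup>2 + (A l k)\<^sup>2) / 2)"
    proof (rule mult_left_mono)
      have "0 \<le> (A k l - A l k)\<^sup>2" by simp
      then show "A k l * A k l + A k l * A l k \<le> (A k l)\<^sup>2 + ((A k l)\<^sup>2 + (A l k)\<^sup>2) / 2"
        by (simp add: power2_eq_square algebra_simps)
    qed simp
    also have "\<dots> \<le> 1 / ?N * ((A k l)\<^sup>2 + ((A k l)\<^sup>2 + (A l k)\<^sup>2) / 2)"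
      by (intro mult_right_mono expectation_\<eta>_sq_sq_le kl) auto
    finally show ?thesis using kl by simp
  qed
  have "expectation (\<lambda>\<omega>. (\<Sum>(k, l)\<in>?P. A k l * (\<eta> k \<omega> * \<eta> l \<omega>))\<^sup>2)
      = expectation (\<lambda>\<omega>. \<Sum>p\<in>?P. \<Sum>p'\<in>?P. ?A p * ?A p' * ?m p p' \<omega>)"
    by (intro Bochner_Integration.integral_cong refl)
      (simp add: power2_eq_square sum_product case_prod_beta mult_ac)
  also have "\<dots> = (\<Sum>p\<in>?P. \<Sum>p'\<in>?P. ?A p * ?A p' * expectation (?m p p'))"
    using int by (simp add: Bochner_Integration.integral_sum)
  also have "\<dots> \<le> (\<Sum>p\<in>?P. 1 / ?N * ((?A p)\<^sup>2 + ((?A p)\<^sup>2 + (?A (prod.swap p))\<^sup>2) / 2))"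
    by (intro sum_mono bound)
  also have "\<dots> = 1 / ?N * ((\<Sum>p\<in>?P. (?A p)\<^sup>2) + ((\<Sum>p\<in>?P. (?A p)\<^sup>2) + (\<Sum>p\<in>?P. (?A (prod.swap p))\<^sup>2)) / 2)"
    by (simp only: sum_distrib_left[symmetric] sum.distrib sum_divide_distrib[symmetric])
  also have "(\<Sum>p\<in>?P. (?A (prod.swap p))\<^sup>2) = (\<Sum>p\<in>?P. (?A p)\<^sup>2)"
    by (rule sum.reindex_bij_witness[where i=prod.swap and j=prod.swap]) auto
  also have "1 / ?N * ((\<Sum>p\<in>?P. (?A p)\<^sup>2) + ((\<Sum>p\<in>?P. (?A p)\<^sup>2) + (\<Sum>p\<in>?P. (?A p)\<^sup>2)) / 2)
     = 2 / ?N * (\<Sum>p\<in>?P. (?A p)\<^sup>2)" by simp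
  finally show ?thesis by (simp add: case_prod_beta)
qed

end

subsection \<open>Riemann sums and trigonometric sums\<close>


lemma fourier_eq_lborel:
  assumes [measurable]: "u \<in> borel_measurable borel"
  shows "fourier u t = (LINT x|lborel. complex_of_real (u x) * iexp (- (t * x)))"
proof -
  have "fourier u t = (LINT x|lborel. complex_of_real (u x) * exp (- (\<i> * of_real t * of_real x)))"
    unfolding fourier_def by (intro integral_completion) measurable
  then show ?thesis by (simp add: mult.assoc)
qed

lemma borel_measurable_fourier:
  assumes [measurable]: "u \<in> borel_measurable borel"
  shows "fourier u \<in> borel_measurable borel"
proof -
  have "(\<lambda>t. LINT x|lborel. complex_of_real (u x) * iexp (- (t * x))) \<in> borel_measurable borel"
    by measurable
  moreover have "fourier u = (\<lambda>t. LINT x|lborel. complex_of_real (u x) * iexp (- (t * x)))"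
    by (intro ext fourier_eq_lborel) measurable
  ultimately show ?thesis by simp
qed

lemma sum_window:
  fixes h :: "int \<Rightarrow> 'b::real_normed_vector"
  assumes "\<And>d. \<bar>d\<bar> > int l \<Longrightarrow> h d = 0" and "int l + 1 \<le> i" "i \<le> int n - int l"
  shows "(\<Sum>j=1..n. h (int j - i)) = (\<Sum>d\<in>{- int l..int l}. h d)"
proof -
  have "(\<Sum>j=1..n. h (int j - i)) = (\<Sum>d\<in>{1 - i..int n - i}. h d)"
    by (rule sum.reindex_bij_witness[where i="\<lambda>d. nat (d + i)" and j="\<lambda>j. int j - i"]) auto
  also have "\<dots> = (\<Sum>d\<in>{- int l..int l}. h d)"
    using assms by (intro sum.mono_neutral_right) auto
  finally show ?thesis .
qed

lemma norm_sum_window_le: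
  fixes h :: "int \<Rightarrow> 'b::real_normed_vector"
  assumes "\<And>d. \<bar>d\<bar> > int l \<Longrightarrow> h d = 0" and "\<And>d. norm (h d) \<le> B"
  shows "norm (\<Sum>j=1..n. h (int j - i)) \<le> (2 * real l + 1) * B"
proof -
  have B: "B \<ge> 0" using norm_ge_zero assms(2) by (rule order_trans)
  have "(\<Sum>j=1..n. h (int j - i)) = (\<Sum>d\<in>{1 - i..int n - i}. h d)"
    by (rule sum.reindex_bij_witness[where i="\<lambda>d. nat (d + i)" and j="\<lambda>j. int j - i"]) auto
  also have "\<dots> = (\<Sum>d\<in>{1 - i..int n - i} \<inter> {- int l..int l}. h d)"
    using assms by (intro sum.mono_neutral_right) auto
  also have "norm \<dots> \<le> (\<Sum>d\<in>{1 - i..int n - i} \<inter> {- int l..int l}. B)"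
    by (intro sum_norm_le assms)
  also have "\<dots> \<le> (\<Sum>d\<in>{- int l..int l}. B)"
    using B by (intro sum_mono2) auto
  also have "\<dots> = (2 * real l + 1) * B" by simp
  finally show ?thesis .
qed

text \<open>The half-open cells of length \<open>\<Delta>\<close> starting at the nodes are disjoint
  and cover [-L, L], since \<open>L \<le> l \<Delta>\<close> and \<open>\<rho> < \<Delta>\<close>;
  on each cell \<open>h\<close> stays within \<open>e\<close> of its value at the left end. The
  shift \<open>\<rho>\<close> is the position of a noise cell relative to the observation
  times.\<close>

lemma riemann_sum_error:
  fixes h :: "real \<Rightarrow> 'b::{banach, second_countable_topology}"
  assumes int: "integrable lborel h" and supp: "\<And>t. \<bar>t\<bar> > L \<Longrightarrow> h t = 0"
    and mod: "\<And>s t. t \<le> s \<Longrightarrow> s < t + \<Delta> \<Longrightarrow> norm (h s - h t) \<le> e"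
    and \<Delta>: "\<Delta> > 0" and \<rho>: "0 \<le> \<rho>" "\<rho> < \<Delta>" and l: "L \<le> real l * \<Delta>"
  shows "norm (\<Delta> *\<^sub>R (\<Sum>d\<in>{- int l..int l}. h (of_int d * \<Delta> - \<rho>)) - (LINT t|lborel. h t))
    \<le> (2 * real l + 1) * \<Delta> * e"
proof -
  define J where "J d = {of_int d * \<Delta> - \<rho> ..< of_int d * \<Delta> - \<rho> + \<Delta>}" for d :: int
  have J: "J d \<in> sets lborel" "measure lborel (J d) = \<Delta>" "emeasure lborel (J d) < \<infinity>" for d
    using \<Delta> by (auto simp: J_def)
  have intJ: "integrable lborel (\<lambda>t. indicator (J d) t *\<^sub>R h t)" for d
    using int J by (intro integrable_mult_indicator) auto
  have intc: "integrable lborel (\<lambda>t. indicator (J d) t *\<^sub>R c)" for d and c :: 'b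
    using J by (intro integrable_scaleR_left) (auto simp: integrable_real_indicator)
  have decomp: "h t = (\<Sum>d\<in>{- int l..int l}. indicator (J d) t *\<^sub>R h t)" for t
  proof (cases "\<bar>t\<bar> > L")
    case True
    then show ?thesis using supp by simp
  next
    case False
    \<comment> \<open>The one cell that contains \<open>t\<close>; the bounds on
      \<open>\<rho>\<close> and \<open>l\<close> place its index in the range of summation.\<close>
    define d0 where "d0 = \<lfloor>(t + \<rho>) / \<Delta>\<rfloor>"
    have mem: "t \<in> J d \<longleftrightarrow> d = d0" for d
    proof -
      have "t \<in> J d \<longleftrightarrow> of_int d \<le> (t + \<rho>) / \<Delta> \<and> (t + \<rho>) / \<Delta> < of_int d + 1"
        using \<Delta> by (auto simp: J_def field_simps)
      also have "\<dots> \<longleftrightarrow> d = d0" unfolding d0_def using floor_eq_iff[of "(t + \<rho>) / \<Delta>" d] by auto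
      finally show ?thesis .
    qed
    have "- real l \<le> (t + \<rho>) / \<Delta>" "(t + \<rho>) / \<Delta> < real l + 1"
      using False l \<rho> \<Delta> by (auto simp: field_simps)
    then have "- int l \<le> d0" "d0 \<le> int l"
      unfolding d0_def by (simp_all add: le_floor_iff floor_le_iff)
    then have d0: "d0 \<in> {- int l..int l}" by simp
    have "(\<Sum>d\<in>{- int l..int l}. indicator (J d) t *\<^sub>R h t) = (\<Sum>d\<in>{- int l..int l}. if d = d0 then h t else 0)"
      by (intro sum.cong refl) (auto simp: indicator_def mem)
    also have "\<dots> = h t" using d0 by simp
    finally show ?thesis by simp
  qed
  have "(LINT t|lborel. h t) = (LINT t|lborel. (\<Sum>d\<in>{- int l..int l}. indicator (J d) t *\<^sub>R h t))"
    by (intro Bochner_Integration.integral_cong refl decomp)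
  also have "\<dots> = (\<Sum>d\<in>{- int l..int l}. LINT t|lborel. indicator (J d) t *\<^sub>R h t)"
    by (intro Bochner_Integration.integral_sum intJ)
  finally have eq: "\<Delta> *\<^sub>R (\<Sum>d\<in>{- int l..int l}. h (of_int d * \<Delta> - \<rho>)) - (LINT t|lborel. h t)
     = (\<Sum>d\<in>{- int l..int l}. \<Delta> *\<^sub>R h (of_int d * \<Delta> - \<rho>) - (LINT t|lborel. indicator (J d) t *\<^sub>R h t))"
    by (simp add: scaleR_sum_right sum_subtractf)
  have each: "norm (\<Delta> *\<^sub>R h (of_int d * \<Delta> - \<rho>) - (LINT t|lborel. indicator (J d) t *\<^sub>R h t)) \<le> \<Delta> * e" for d :: int
  proof -
    let ?x = "of_int d * \<Delta> - \<rho>"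
    have "\<Delta> *\<^sub>R h ?x = (LINT t|lborel. indicator (J d) t *\<^sub>R h ?x)"
      using J by (subst integral_scaleR_left) (auto simp: integrable_real_indicator)
    then have "\<Delta> *\<^sub>R h ?x - (LINT t|lborel. indicator (J d) t *\<^sub>R h t)
      = (LINT t|lborel. indicator (J d) t *\<^sub>R (h ?x - h t))"
      by (simp add: Bochner_Integration.integral_diff[OF intc intJ, symmetric] scaleR_diff_right)
    also have "norm \<dots> \<le> (LINT t|lborel. indicator (J d) t *\<^sub>R e)"
    proof (rule Bochner_Integration.integral_norm_bound_integral)
      show "integrable lborel (\<lambda>t. indicator (J d) t *\<^sub>R (h ?x - h t))"
        using Bochner_Integration.integrable_diff[OF intc intJ] by (simp add: scaleR_diff_right)
      show "integrable lborel (\<lambda>t. indicator (J d) t *\<^sub>R e)"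
        using J by (intro integrable_scaleR_left) (auto simp: integrable_real_indicator)
      show "norm (indicator (J d) t *\<^sub>R (h ?x - h t)) \<le> indicator (J d) t *\<^sub>R e" for t
        using mod[of ?x t] by (auto simp: indicator_def J_def norm_minus_commute)
    qed
    also have "\<dots> = \<Delta> * e" using J by (simp add: integrable_real_indicator)
    finally show ?thesis .
  qed
  have "norm (\<Delta> *\<^sub>R (\<Sum>d\<in>{- int l..int l}. h (of_int d * \<Delta> - \<rho>)) - (LINT t|lborel. h t))
      \<le> (\<Sum>d\<in>{- int l..int l}. \<Delta> * e)"
    unfolding eq by (intro sum_norm_le each)
  then show ?thesis by simp
qed

lemma norm_iexp_diff_le: "cmod (iexp x - iexp y) \<le> \<bar>x - y\<bar>"
proof -
  have "iexp x - iexp y = iexp y * (iexp (x - y) - 1)"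
    by (simp add: algebra_simps exp_add[symmetric])
  then have "cmod (iexp x - iexp y) = cmod (iexp (x - y) - 1)" by (simp add: norm_mult)
  also have "\<dots> \<le> \<bar>x - y\<bar>" using iexp_approx1[of "x - y" 0] by simp
  finally show ?thesis .
qed

text \<open>For |\<open>\<theta>\<close>| at most 1 the Taylor remainder of second order consumes at
  most half of the linear term.\<close>

lemma norm_one_minus_iexp_ge:
  assumes "\<bar>\<theta>\<bar> \<le> 1"
  shows "\<bar>\<theta>\<bar> / 2 \<le> cmod (1 - iexp \<theta>)"
proof -
  have "cmod (iexp \<theta> - (1 + \<i> * \<theta>)) \<le> \<bar>\<theta>\<bar>\<^sup>2 / 2"
    using iexp_approx1[of \<theta> 1] by (simp add: numeral_2_eq_2)
  also have "\<bar>\<theta>\<bar>\<^sup>2 / 2 \<le> \<bar>\<theta>\<bar> / 2"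
    using assms mult_left_mono[of "\<bar>\<theta>\<bar>" 1 "\<bar>\<theta>\<bar>"] by (simp add: power2_eq_square)
  finally have "cmod (iexp \<theta> - (1 + \<i> * \<theta>)) \<le> \<bar>\<theta>\<bar> / 2" .
  moreover have "cmod (\<i> * \<theta>) \<le> cmod (iexp \<theta> - (1 + \<i> * \<theta>)) + cmod (1 - iexp \<theta>)"
    using norm_triangle_ineq[of "iexp \<theta> - (1 + \<i> * \<theta>)" "1 - iexp \<theta>"] by simp
  ultimately show ?thesis by (simp add: norm_mult)
qed

text \<open>Multiplication by \<open>1 - iexp \<theta>\<close> telescopes the sum to a difference of
  modulus at most 2, and dividing by the chord bound |\<open>\<theta>\<close>|/2 gives the constant
  4.\<close>

lemma norm_sum_iexp_le:
  assumes "\<bar>\<theta>\<bar> \<le> 1" "\<theta> \<noteq> 0"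
  shows "cmod (\<Sum>j\<in>{a..b::int}. iexp (\<theta> * of_int j)) \<le> 4 / \<bar>\<theta>\<bar>"
proof (cases "a \<le> b")
  case True
  have tel: "(1 - iexp \<theta>) * (\<Sum>j\<in>{a..a + int k}. iexp (\<theta> * of_int j)) = iexp (\<theta> * of_int a) - iexp (\<theta> * of_int (a + int k + 1))" for k
  proof (induction k)
    case 0
    show ?case by (simp add: algebra_simps exp_add[symmetric])
  next
    case (Suc k)
    let ?x = "a + int k + 1"
    have set: "{a..a + int (Suc k)} = insert ?x {a..a + int k}" by auto
    have "(1 - iexp \<theta>) * iexp (\<theta> * of_int ?x) = iexp (\<theta> * of_int ?x) - iexp (\<theta> * of_int (?x + 1))"
      by (simp add: algebra_simps exp_add[symmetric])
    then show ?case
      unfolding set using Suc by (subst sum.insert) (auto simp: distrib_left)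
  qed
  have "cmod (1 - iexp \<theta>) * cmod (\<Sum>j\<in>{a..b}. iexp (\<theta> * of_int j))
      = cmod (iexp (\<theta> * of_int a) - iexp (\<theta> * of_int (b + 1)))"
    using tel[of "nat (b - a)"] True by (simp add: norm_mult[symmetric])
  also have "\<dots> \<le> 2"
    using norm_triangle_ineq4[of "iexp (\<theta> * of_int a)" "iexp (\<theta> * of_int (b + 1))"] by simp
  finally have "\<bar>\<theta>\<bar> / 2 * cmod (\<Sum>j\<in>{a..b}. iexp (\<theta> * of_int j)) \<le> 2"
    using mult_right_mono[OF norm_one_minus_iexp_ge[OF assms(1)], of "cmod (\<Sum>j\<in>{a..b}. iexp (\<theta> * of_int j))"] by simp
  then show ?thesis using assms by (simp add: field_simps)
qed auto

text \<open>The term \<open>- 1 / N\<close> is what the induction needs, by 1/(N+1)^2 \<le> 1/N -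
  1/(N+1). It reads as 0 at N = 0, so the first step is checked separately.\<close>

lemma sum_inverse_squares_le: "(\<Sum>j=1..N. 1 / (real j)\<^sup>2) \<le> 2 - 1 / real N"
proof (induction N)
  case (Suc N)
  show ?case
  proof (cases "N = 0")
    case False
    have "1 / (real (Suc N))\<^sup>2 \<le> 1 / (real N * real (Suc N))"
      using False by (intro divide_left_mono) (auto simp: power2_eq_square)
    also have "\<dots> = 1 / real N - 1 / real (Suc N)" using False by (simp add: field_simps)
    finally show ?thesis using Suc by simp
  qed simp
qed simp

subsection \<open>Sampling a compactly supported kernel\<close>


text \<open>\<open>L\<close> and \<open>F\<close> are explicit parameters because the later
  constants are built from them and from \<open>energy\<close>, and so are free of the sample size
  and of the mesh.\<close>

locale compact_kernel =
  fixes f :: "real \<Rightarrow> real" and L F :: real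
  assumes uniformly_continuous: "uniformly_continuous_on UNIV f"
    and support: "\<And>t. \<bar>t\<bar> > L \<Longrightarrow> f t = 0"
    and bounded: "\<And>t. \<bar>f t\<bar> \<le> F"
    and L_pos: "L > 0"
begin

lemma continuous: "continuous_on UNIV f"
  by (rule uniformly_continuous_imp_continuous[OF uniformly_continuous])

lemma F_nonneg: "F \<ge> 0" using bounded[of 0] by simp

lemma measurable_f [measurable]: "f \<in> borel_measurable borel"
  using continuous by (intro borel_measurable_continuous_onI)

lemma integrable_compact:
  fixes h :: "real \<Rightarrow> 'b::{banach, second_countable_topology}"
  assumes [measurable]: "h \<in> borel_measurable borel"
    and "\<And>t. \<bar>t\<bar> > L \<Longrightarrow> h t = 0" "\<And>t. \<bar>t\<bar> \<le> L \<Longrightarrow> norm (h t) \<le> c"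
  shows "integrable lborel h" "norm (LINT t|lborel. h t) \<le> 2 * L * c"
proof -
  have c: "integrable lborel (\<lambda>t. c * indicator {-L..L} t)"
    by (intro integrable_mult_right integrable_real_indicator) (auto simp: emeasure_lborel_Icc_eq)
  have le: "norm (h t) \<le> c * indicator {-L..L} t" for t
    using assms(2,3)[of t] by (auto simp: indicator_def)
  show int: "integrable lborel h"
    using le by (intro Bochner_Integration.integrable_bound[OF c]) (auto intro: order_trans[OF le abs_ge_self])
  have "norm (LINT t|lborel. h t) \<le> (LINT t|lborel. c * indicator {-L..L} t)"
    by (rule Bochner_Integration.integral_norm_bound_integral[OF int c le])
  also have "\<dots> = 2 * L * c" using L_pos by simp
  finally show "norm (LINT t|lborel. h t) \<le> 2 * L * c" .
qed

lemma fourier_lborel: "fourier f \<xi> = (LINT t|lborel. complex_of_real (f t) * iexp (- (\<xi> * t)))"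
  by (rule fourier_eq_lborel) measurable

lemma fourier_uminus: "fourier f (- \<xi>) = cnj (fourier f \<xi>)"
proof -
  have "cnj (fourier f \<xi>) = (LINT t|lborel. cnj (complex_of_real (f t) * iexp (- (\<xi> * t))))"
    unfolding fourier_lborel by (rule Bochner_Integration.integral_cnj[symmetric])
  then show ?thesis by (simp add: fourier_lborel exp_cnj)
qed

definition energy :: real where "energy = (LINT t|lborel. (f t)\<^sup>2)"

lemma integrable_f: "integrable lborel f"
  by (rule integrable_compact(1)[where c=F]) (auto simp: support bounded)

lemma f_sq_le: "(f t)\<^sup>2 \<le> F\<^sup>2"
  using bounded[of t] F_nonneg by (simp add: abs_le_square_iff[symmetric])

lemma integrable_f_sq: "integrable lborel (\<lambda>t. (f t)\<^sup>2)"
  by (rule integrable_compact(1)[where c="F\<^sup>2"]) (auto simp: support f_sq_le)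

lemma energy_nonneg: "energy \<ge> 0" unfolding energy_def by simp

lemma energy_le: "energy \<le> 2 * L * F\<^sup>2"
proof -
  have "norm (LINT t|lborel. (f t)\<^sup>2) \<le> 2 * L * F\<^sup>2"
    by (rule integrable_compact(2)) (auto simp: support f_sq_le)
  then show ?thesis using energy_nonneg by (simp add: energy_def)
qed

lemma cmod_fourier_le: "cmod (fourier f \<xi>) \<le> 2 * L * F"
  unfolding fourier_lborel
  by (rule integrable_compact(2)) (auto simp: support bounded norm_mult)

text \<open>Bounds the time span (2 l + 1) \<Delta> of the observations reached by one unit of
  noise: l \<Delta> is at most L + 2 \<Delta>, and \<Delta> is at most 1.\<close>

definition width :: real where "width = 2 * L + 5"
definition B :: real where "B = width * F"

lemma width_pos: "width > 0" using L_pos by (simp add: width_def)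

lemma B_nonneg: "B \<ge> 0" unfolding B_def using width_pos F_nonneg by simp

lemma cmod_fourier_le_B: "cmod (fourier f \<xi>) \<le> B"
  using cmod_fourier_le[of \<xi>] F_nonneg by (simp add: B_def width_def algebra_simps)

lemma energy_le_width: "energy \<le> width * F\<^sup>2"
  using energy_le unfolding width_def by (simp add: algebra_simps add_increasing)

text \<open>On the support the two phases differ by at most L times the difference of the
  frequencies, and the support has length 2 L.\<close>

lemma fourier_lipschitz: "cmod (fourier f \<xi> - fourier f \<xi>') \<le> 2 * L\<^sup>2 * F * \<bar>\<xi> - \<xi>'\<bar>"
proof -
  have int: "integrable lborel (\<lambda>t. complex_of_real (f t) * iexp (- (x * t)))" for x
    by (rule integrable_compact(1)[where c=F]) (auto simp: support bounded norm_mult)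
  have "fourier f \<xi> - fourier f \<xi>' = (LINT t|lborel. complex_of_real (f t) * (iexp (- (\<xi> * t)) - iexp (- (\<xi>' * t))))"
    unfolding fourier_lborel by (subst Bochner_Integration.integral_diff[OF int int, symmetric]) (simp add: right_diff_distrib)
  also have "cmod \<dots> \<le> 2 * L * (F * (L * \<bar>\<xi> - \<xi>'\<bar>))"
  proof (rule integrable_compact(2))
    fix t assume t: "\<bar>t\<bar> \<le> L"
    have "cmod (iexp (- (\<xi> * t)) - iexp (- (\<xi>' * t))) \<le> \<bar>- (\<xi> * t) - - (\<xi>' * t)\<bar>"
      by (rule norm_iexp_diff_le)
    also have "\<dots> = \<bar>t\<bar> * \<bar>\<xi> - \<xi>'\<bar>" by (simp add: abs_mult[symmetric] algebra_simps abs_minus_commute)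
    also have "\<dots> \<le> L * \<bar>\<xi> - \<xi>'\<bar>" using t by (intro mult_right_mono) auto
    finally show "cmod (complex_of_real (f t) * (iexp (- (\<xi> * t)) - iexp (- (\<xi>' * t)))) \<le> F * (L * \<bar>\<xi> - \<xi>'\<bar>)"
      using bounded[of t] F_nonneg unfolding norm_mult by (intro mult_mono) auto
  qed (auto simp: support)
  also have "\<dots> = 2 * L\<^sup>2 * F * \<bar>\<xi> - \<xi>'\<bar>" by (simp add: power2_eq_square)
  finally show ?thesis .
qed

end

text \<open>\<open>\<kappa>\<close> bounds the oscillation of the kernel over one sampling step, and
  \<open>q\<close> is the number of noise cells per step. The moment bounds drawn from this locale
  are free of \<open>q\<close>.\<close>

locale sampling_grid = compact_kernel +
  fixes \<Delta> \<kappa> :: real and q n :: nat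
  assumes \<Delta>_pos: "\<Delta> > 0" and \<Delta>_le: "\<Delta> \<le> 1" and q_pos: "q > 0" and n_pos: "n > 0"
    and modulus: "\<And>s t. \<bar>s - t\<bar> < \<Delta> \<Longrightarrow> \<bar>f s - f t\<bar> \<le> \<kappa>"
begin

text \<open>The index \<open>(i, r)\<close> stands for the time \<open>i \<Delta> + r \<Delta> / q\<close>. A unit of noise there affects the \<open>2 l + 1\<close>
  observations with indices in \<open>{i - l..i + l}\<close>; \<open>edge\<close> collects the times for which some of these are
  missing from the sample.\<close>

definition l :: nat where "l = nat \<lceil>L / \<Delta>\<rceil> + 1"
definition K :: "(int \<times> nat) set" where "K = {- int l..int n + int l} \<times> {..<q}"
definition edge :: "(int \<times> nat) set" where "edge = {k \<in> K. fst k \<notin> {int l + 1..int n - int l}}"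
definition s :: "int \<times> nat \<Rightarrow> real" where "s k = of_int (fst k) * \<Delta> + real (snd k) * (\<Delta> / real q)"
definition c :: "int \<times> nat \<Rightarrow> real \<Rightarrow> complex" where
  "c k \<xi> = (\<Sum>j=1..n. complex_of_real (f (real j * \<Delta> - s k)) * exp (\<i> * of_real (real j * \<Delta>) * of_real \<xi>))"
definition gram :: "int \<times> nat \<Rightarrow> int \<times> nat \<Rightarrow> real" where
  "gram k k' = (\<Sum>j=1..n. f (real j * \<Delta> - s k) * f (real j * \<Delta> - s k'))"
definition \<rho> :: "int \<times> nat \<Rightarrow> real" where "\<rho> k = real (snd k) * (\<Delta> / real q)"

lemma l_ge: "real l * \<Delta> \<ge> L + \<Delta>" and l_le: "real l * \<Delta> \<le> L + 2 * \<Delta>"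
proof -
  have c0: "\<lceil>L / \<Delta>\<rceil> \<ge> 0" using L_pos \<Delta>_pos by (simp add: less_ceiling_iff order.strict_trans1[of _ 0])
  then have l: "real l = of_int \<lceil>L / \<Delta>\<rceil> + 1" by (simp add: l_def)
  have "L / \<Delta> + 1 \<le> real l" "real l \<le> L / \<Delta> + 2" unfolding l by linarith+
  then show "real l * \<Delta> \<ge> L + \<Delta>" "real l * \<Delta> \<le> L + 2 * \<Delta>" using \<Delta>_pos by (simp_all add: field_simps)
qed

lemma window_le: "(2 * real l + 1) * \<Delta> \<le> width" "(4 * real l + 1) * \<Delta> \<le> 2 * width"
  using l_le \<Delta>_le \<Delta>_pos by (auto simp: width_def algebra_simps)

lemma \<rho>_bounds: "k \<in> K \<Longrightarrow> 0 \<le> \<rho> k" "k \<in> K \<Longrightarrow> \<rho> k < \<Delta>"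
  using \<Delta>_pos q_pos by (auto simp: K_def \<rho>_def field_simps)

lemma s_eq: "s k = of_int (fst k) * \<Delta> + \<rho> k" by (simp add: s_def \<rho>_def)

lemma finite_K: "finite K" by (simp add: K_def)

lemma card_K: "card K = (n + 2 * l + 1) * q"
proof -
  have "nat (int n + int l - - int l + 1) = n + 2 * l + 1" by simp
  show ?thesis unfolding K_def card_cartesian_product card_atLeastAtMost_int card_lessThan
    by (simp only: \<open>nat (int n + int l - - int l + 1) = n + 2 * l + 1\<close>)
qed

text \<open>Out of n + 2 l + 1 steps, n - 2 l are interior, which leaves 4 l + 1. If n < 2 l there
  is no interior, but then the whole grid is no larger than that.\<close>

lemma card_edge_le: "card edge \<le> (4 * l + 1) * q"
proof -
  have eq: "edge = ({- int l..int n + int l} - {int l + 1..int n - int l}) \<times> {..<q}"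
    by (auto simp: edge_def K_def)
  have "card ({- int l..int n + int l} - {int l + 1..int n - int l}) \<le> 4 * l + 1"
  proof (cases "2 * l \<le> n")
    case True
    then show ?thesis by (subst card_Diff_subset) auto
  next
    case False
    have "card ({- int l..int n + int l} - {int l + 1..int n - int l}) \<le> card {- int l..int n + int l}"
      by (rule card_mono) auto
    then show ?thesis using False by simp
  qed
  then show ?thesis unfolding eq card_cartesian_product card_lessThan by (rule mult_right_mono) simp
qed

text \<open>The node is at least (l + 1) \<Delta> away from the origin, and an offset below \<Delta>
  cannot bring it back into the support.\<close>

lemma f_window: "k \<in> K \<Longrightarrow> \<bar>d\<bar> > int l \<Longrightarrow> f (of_int d * \<Delta> - \<rho> k) = 0"
proof (rule support)
  assume k: "k \<in> K" and d: "\<bar>d\<bar> > int l"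
  have "(real l + 1) * \<Delta> \<le> \<bar>of_int d\<bar> * \<Delta>"
    using d \<Delta>_pos by (intro mult_right_mono) linarith+
  also have "\<dots> = \<bar>of_int d * \<Delta>\<bar>" using \<Delta>_pos by (simp add: abs_mult)
  finally show "L < \<bar>of_int d * \<Delta> - \<rho> k\<bar>"
    using l_ge \<rho>_bounds[OF k] \<Delta>_pos by (auto simp: algebra_simps)
qed

lemma shift: "real j * \<Delta> - s k = of_int (int j - fst k) * \<Delta> - \<rho> k"
  by (simp add: s_eq algebra_simps)

text \<open>The transfer function of the sampled kernel. It depends on \<open>k\<close> through the
  position inside the step only, so an interior \<open>c k\<close> is a phase in the first component
  times a function of the second.\<close>

definition b :: "int \<times> nat \<Rightarrow> real \<Rightarrow> complex" where
  "b k \<xi> = (\<Sum>d\<in>{- int l..int l}. complex_of_real (f (of_int d * \<Delta> - \<rho> k)) * iexp (\<xi> * (of_int d * \<Delta>)))"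

lemma c_term: "complex_of_real (f (real j * \<Delta> - s k)) * exp (\<i> * of_real (real j * \<Delta>) * of_real \<xi>)
  = iexp (\<xi> * of_int (fst k) * \<Delta>) *
    (complex_of_real (f (of_int (int j - fst k) * \<Delta> - \<rho> k)) * iexp (\<xi> * (of_int (int j - fst k) * \<Delta>)))"
proof -
  have "exp (\<i> * of_real (real j * \<Delta>) * of_real \<xi>) = iexp (\<xi> * of_int (fst k) * \<Delta>) * iexp (\<xi> * (of_int (int j - fst k) * \<Delta>))"
    by (simp add: exp_add[symmetric] algebra_simps)
  then show ?thesis by (simp add: shift)
qed

lemma c_interior:
  assumes "k \<in> K - edge"
  shows "c k \<xi> = iexp (\<xi> * of_int (fst k) * \<Delta>) * b k \<xi>"
  unfolding c_def c_term sum_distrib_left[symmetric] b_def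
  by (subst sum_window[where h="\<lambda>d. complex_of_real (f (of_int d * \<Delta> - \<rho> k)) * iexp (\<xi> * (of_int d * \<Delta>))" and l=l])
    (use assms f_window[of k] in \<open>auto simp: edge_def\<close>)

lemma cmod_c_le: assumes "k \<in> K" shows "\<Delta> * cmod (c k \<xi>) \<le> B"
proof -
  have "cmod (c k \<xi>) \<le> (2 * real l + 1) * F"
    unfolding c_def c_term sum_distrib_left[symmetric] norm_mult[of "iexp _"] 
    using norm_sum_window_le[where h="\<lambda>d. complex_of_real (f (of_int d * \<Delta> - \<rho> k)) * iexp (\<xi> * (of_int d * \<Delta>))" and l=l and B=F and n=n and i="fst k"]
      f_window[OF assms] bounded by (simp add: norm_mult)
  then have "\<Delta> * cmod (c k \<xi>) \<le> \<Delta> * ((2 * real l + 1) * F)" using \<Delta>_pos by (intro mult_left_mono) auto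
  also have "\<dots> \<le> width * F" using mult_right_mono[OF window_le(1) F_nonneg] by (simp add: mult_ac)
  finally show ?thesis by (simp add: B_def)
qed

text \<open>The factor \<open>iexp (- (\<xi> * \<rho> k))\<close> moves the phase to the points
  where the kernel is evaluated, which yields a Riemann sum of f(t) exp(i \<xi> t), hence of the
  conjugate transform. Over one step \<open>f\<close> varies by \<open>\<kappa>\<close> and the
  phase by |\<open>\<xi>\<close>| \<Delta>.\<close>

lemma b_approx:
  assumes kK: "k \<in> K"
  shows "cmod (of_real \<Delta> * (iexp (- (\<xi> * \<rho> k)) * b k \<xi>) - cnj (fourier f \<xi>)) \<le> width * (\<kappa> + F * \<bar>\<xi>\<bar> * \<Delta>)"
proof -
  let ?h = "\<lambda>t. complex_of_real (f t) * iexp (\<xi> * t)"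
  have \<kappa>: "\<kappa> \<ge> 0" using modulus[of 0 0] \<Delta>_pos by simp
  have "norm (\<Delta> *\<^sub>R (\<Sum>d\<in>{- int l..int l}. ?h (of_int d * \<Delta> - \<rho> k)) - (LINT t|lborel. ?h t))
    \<le> (2 * real l + 1) * \<Delta> * (\<kappa> + F * \<bar>\<xi>\<bar> * \<Delta>)"
  proof (rule riemann_sum_error[where L=L])
    show "integrable lborel ?h"
      by (rule integrable_compact(1)[where c=F]) (auto simp: support bounded norm_mult)
    fix x t assume xt: "t \<le> x" "x < t + \<Delta>"
    have "?h x - ?h t = complex_of_real (f x - f t) * iexp (\<xi> * x) + complex_of_real (f t) * (iexp (\<xi> * x) - iexp (\<xi> * t))"
      by (simp add: algebra_simps)
    also have "cmod \<dots> \<le> \<bar>f x - f t\<bar> + \<bar>f t\<bar> * cmod (iexp (\<xi> * x) - iexp (\<xi> * t))"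
      by (rule order_trans[OF norm_triangle_ineq]) (simp add: norm_mult)
    also have "\<dots> \<le> \<kappa> + F * \<bar>\<xi> * x - \<xi> * t\<bar>"
      using modulus[of x t] xt bounded[of t] norm_iexp_diff_le[of "\<xi> * x" "\<xi> * t"] F_nonneg
      by (intro add_mono mult_mono) auto
    also have "\<bar>\<xi> * x - \<xi> * t\<bar> = \<bar>\<xi>\<bar> * (x - t)" using xt by (simp add: abs_mult right_diff_distrib[symmetric])
    also have "\<kappa> + F * (\<bar>\<xi>\<bar> * (x - t)) \<le> \<kappa> + F * (\<bar>\<xi>\<bar> * \<Delta>)"
      using xt F_nonneg by (intro add_left_mono mult_left_mono) auto
    finally show "cmod (?h x - ?h t) \<le> \<kappa> + F * \<bar>\<xi>\<bar> * \<Delta>" by (simp add: mult_ac)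
  qed (use support \<Delta>_pos \<rho>_bounds[OF kK] l_ge in auto)
  also have "\<dots> \<le> width * (\<kappa> + F * \<bar>\<xi>\<bar> * \<Delta>)"
    using window_le \<kappa> F_nonneg \<Delta>_pos by (intro mult_right_mono) auto
  finally have 1: "cmod (\<Delta> *\<^sub>R (\<Sum>d\<in>{- int l..int l}. ?h (of_int d * \<Delta> - \<rho> k)) - (LINT t|lborel. ?h t))
    \<le> width * (\<kappa> + F * \<bar>\<xi>\<bar> * \<Delta>)" .
  have 2: "(LINT t|lborel. ?h t) = cnj (fourier f \<xi>)"
    using fourier_uminus[of \<xi>] fourier_lborel[of "- \<xi>"] by simp
  have 3: "(\<Sum>d\<in>{- int l..int l}. ?h (of_int d * \<Delta> - \<rho> k)) = iexp (- (\<xi> * \<rho> k)) * b k \<xi>"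
    unfolding b_def sum_distrib_left
    by (intro sum.cong refl) (simp add: algebra_simps exp_add[symmetric] exp_diff exp_minus divide_inverse)
  show ?thesis using 1 unfolding 2 3 by (simp add: scaleR_conv_of_real)
qed

lemma c_interior_approx:
  assumes k: "k \<in> K - edge"
  shows "\<bar>\<Delta> * cmod (c k \<xi>) - cmod (fourier f \<xi>)\<bar> \<le> width * (\<kappa> + F * \<bar>\<xi>\<bar> * \<Delta>)"
proof -
  have "\<bar>cmod (of_real \<Delta> * (iexp (- (\<xi> * \<rho> k)) * b k \<xi>)) - cmod (cnj (fourier f \<xi>))\<bar> \<le> width * (\<kappa> + F * \<bar>\<xi>\<bar> * \<Delta>)"
    using k by (intro order_trans[OF norm_triangle_ineq3] b_approx) auto
  moreover have "cmod (of_real \<Delta> * (iexp (- (\<xi> * \<rho> k)) * b k \<xi>)) = \<Delta> * cmod (c k \<xi>)"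
    using \<Delta>_pos by (simp add: c_interior[OF k] norm_mult)
  ultimately show ?thesis by simp
qed

lemma gram_le: assumes "k \<in> K" "k' \<in> K" shows "\<bar>\<Delta> * gram k k'\<bar> \<le> width * F\<^sup>2"
proof -
  have "norm (gram k k') \<le> (2 * real l + 1) * F\<^sup>2"
  proof -
    let ?h = "\<lambda>d. f (of_int d * \<Delta> - \<rho> k) * f (of_int d * \<Delta> + (of_int (fst k) * \<Delta> - s k'))"
    have "gram k k' = (\<Sum>j=1..n. ?h (int j - fst k))"
      unfolding gram_def by (intro sum.cong refl) (simp add: s_eq algebra_simps)
    also have "norm \<dots> \<le> (2 * real l + 1) * F\<^sup>2"
      using f_window[OF assms(1)] bounded F_nonneg
      by (intro norm_sum_window_le) (auto simp: abs_mult power2_eq_square intro!: mult_mono)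
    finally show ?thesis .
  qed
  then have "\<bar>\<Delta> * gram k k'\<bar> \<le> \<Delta> * ((2 * real l + 1) * F\<^sup>2)" using \<Delta>_pos by (auto simp: abs_mult intro!: mult_left_mono)
  also have "\<dots> \<le> width * F\<^sup>2" using mult_right_mono[OF window_le(1), of "F\<^sup>2"] by (simp add: mult_ac)
  finally show ?thesis .
qed

text \<open>No observation lies within \<open>l\<close> steps of both noise indices.\<close>

lemma gram_far: assumes "k \<in> K" "k' \<in> K" "\<bar>fst k - fst k'\<bar> > 2 * int l" shows "gram k k' = 0"
  unfolding gram_def shift
proof (intro sum.neutral ballI)
  fix j :: nat
  have "\<bar>int j - fst k\<bar> > int l \<or> \<bar>int j - fst k'\<bar> > int l" using assms by linarith
  then show "f (of_int (int j - fst k) * \<Delta> - \<rho> k) * f (of_int (int j - fst k') * \<Delta> - \<rho> k') = 0"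
    using f_window[OF assms(1), of "int j - fst k"] f_window[OF assms(2), of "int j - fst k'"] by fastforce
qed

lemma gram_diag_approx: assumes k: "k \<in> K - edge" shows "\<bar>\<Delta> * gram k k - energy\<bar> \<le> width * (2 * F * \<kappa>)"
proof -
  have kK: "k \<in> K" using k by auto
  have \<kappa>: "\<kappa> \<ge> 0" using modulus[of 0 0] \<Delta>_pos by simp
  have g: "gram k k = (\<Sum>d\<in>{- int l..int l}. (f (of_int d * \<Delta> - \<rho> k))\<^sup>2)"
    unfolding gram_def shift using sum_window[where h="\<lambda>d. (f (of_int d * \<Delta> - \<rho> k))\<^sup>2" and l=l and i="fst k"] f_window[OF kK] k
    by (auto simp: edge_def power2_eq_square)
  have "norm (\<Delta> *\<^sub>R (\<Sum>d\<in>{- int l..int l}. (f (of_int d * \<Delta> - \<rho> k))\<^sup>2) - (LINT t|lborel. (f t)\<^sup>2))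
    \<le> (2 * real l + 1) * \<Delta> * (2 * F * \<kappa>)"
  proof (rule riemann_sum_error[where L=L])
    fix x t assume xt: "t \<le> x" "x < t + \<Delta>"
    have "norm ((f x)\<^sup>2 - (f t)\<^sup>2) = \<bar>f x + f t\<bar> * \<bar>f x - f t\<bar>"
      by (simp add: abs_mult[symmetric] power2_eq_square algebra_simps)
    also have "\<dots> \<le> (2 * F) * \<kappa>"
      using modulus[of x t] xt bounded[of t] bounded[of x] F_nonneg by (intro mult_mono) auto
    finally show "norm ((f x)\<^sup>2 - (f t)\<^sup>2) \<le> 2 * F * \<kappa>" .
  qed (use support \<Delta>_pos \<rho>_bounds[OF kK] l_ge integrable_f_sq in auto)
  also have "\<dots> \<le> width * (2 * F * \<kappa>)"
    using window_le \<kappa> F_nonneg \<Delta>_pos by (intro mult_right_mono) auto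
  finally show ?thesis by (simp add: g energy_def)
qed

lemma card_near_le:
  "card {(k, k') \<in> K \<times> K. \<bar>fst k - fst k'\<bar> \<le> 2 * int l} \<le> card K * ((4 * l + 1) * q)"
proof -
  have "{(k, k') \<in> K \<times> K. \<bar>fst k - fst k'\<bar> \<le> 2 * int l} \<subseteq> (SIGMA k:K. {fst k - 2 * int l..fst k + 2 * int l} \<times> {..<q})"
    by (auto simp: K_def)
  then have "card {(k, k') \<in> K \<times> K. \<bar>fst k - fst k'\<bar> \<le> 2 * int l} \<le> card (SIGMA k:K. {fst k - 2 * int l..fst k + 2 * int l} \<times> {..<q})"
    by (intro card_mono) (auto simp: finite_K)
  also have "\<dots> = card K * ((4 * l + 1) * q)"
    by (subst card_SigmaI) (auto simp: finite_K card_cartesian_product nat_add_distrib)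
  finally show ?thesis .
qed

end

text \<open>\<open>\<phi>\<close> squares the bound 4/|d| on geometric sums at frequency distance
  d/n. The constant is 1 + 2 * 16 * 2: the term d = 0, and two signs with a sum of inverse squares
  of at most 2 each.\<close>

lemma sum_kernel_weight_le:
  fixes x :: int
  defines "\<phi> \<equiv> \<lambda>d::int. if d = 0 then 1 else 16 / (of_int d)\<^sup>2 :: real"
  assumes "\<bar>x\<bar> \<le> int m"
  shows "(\<Sum>y\<in>{- int m..int m}. \<phi> (x - y)) \<le> 65"
proof -
  have nn: "\<phi> d \<ge> 0" for d by (simp add: \<phi>_def)
  have "(\<Sum>y\<in>{- int m..int m}. \<phi> (x - y)) = (\<Sum>d\<in>{x - int m..x + int m}. \<phi> d)"
    by (rule sum.reindex_bij_witness[where i="\<lambda>d. x - d" and j="\<lambda>y. x - y"]) auto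
  also have "\<dots> \<le> (\<Sum>d\<in>{- int (2 * m)..int (2 * m)}. \<phi> d)"
    using assms(2) by (intro sum_mono2 nn) auto
  also have "{- int (2 * m)..int (2 * m)} = insert 0 (int ` {1..2 * m} \<union> (\<lambda>j. - int j) ` {1..2 * m})"
  proof (rule set_eqI)
    fix d
    show "d \<in> {- int (2 * m)..int (2 * m)} \<longleftrightarrow> d \<in> insert 0 (int ` {1..2 * m} \<union> (\<lambda>j. - int j) ` {1..2 * m})"
      by (cases d rule: int_cases2) (auto simp: image_iff)
  qed
  also have "(\<Sum>d\<in>\<dots>. \<phi> d) = \<phi> 0 + ((\<Sum>d\<in>int ` {1..2 * m}. \<phi> d) + (\<Sum>d\<in>(\<lambda>j. - int j) ` {1..2 * m}. \<phi> d))"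
    by (subst sum.insert) (auto intro!: sum.union_disjoint)
  also have "(\<Sum>d\<in>int ` {1..2 * m}. \<phi> d) = 16 * (\<Sum>j=1..2 * m. 1 / (real j)\<^sup>2)"
    by (subst sum.reindex) (auto simp: \<phi>_def sum_distrib_left intro!: sum.cong)
  also have "(\<Sum>d\<in>(\<lambda>j. - int j) ` {1..2 * m}. \<phi> d) = 16 * (\<Sum>j=1..2 * m. 1 / (real j)\<^sup>2)"
    by (subst sum.reindex) (auto simp: \<phi>_def sum_distrib_left inj_on_def intro!: sum.cong)
  finally have "(\<Sum>y\<in>{- int m..int m}. \<phi> (x - y)) \<le> \<phi> 0 + 32 * (\<Sum>j=1..2 * m. 1 / (real j)\<^sup>2)"
    by simp
  also have "\<dots> \<le> 1 + 32 * 2"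
  proof -
    have "(\<Sum>j=1..2 * m. 1 / (real j)\<^sup>2) \<le> 2" 
      by (rule order_trans[OF sum_inverse_squares_le]) simp
    then show ?thesis by (simp add: \<phi>_def)
  qed
  finally show ?thesis by simp
qed

text \<open>The squared Frobenius norm of U W U* is tr(W U*U W U*U). This trades pairs of noise
  indices for pairs of frequencies, where near-orthogonality can be used.\<close>

lemma sum_cmod_sq_gram:
  fixes u :: "'k \<Rightarrow> 'm \<Rightarrow> complex" and w :: "'m \<Rightarrow> real"
  assumes "finite K" "finite I"
  shows "(\<Sum>k\<in>K. \<Sum>k'\<in>K. (cmod (\<Sum>x\<in>I. of_real (w x) * (u k x * cnj (u k' x))))\<^sup>2)
    = (\<Sum>x\<in>I. \<Sum>y\<in>I. w x * w y * (cmod (\<Sum>k\<in>K. u k x * cnj (u k y)))\<^sup>2)"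
proof -
  have sq: "complex_of_real ((cmod z)\<^sup>2) = z * cnj z" for z by (rule complex_norm_square)
  let ?t = "\<lambda>k k' x y. of_real (w x * w y) * (u k x * cnj (u k' x) * (cnj (u k y) * u k' y))"
  have "complex_of_real (\<Sum>k\<in>K. \<Sum>k'\<in>K. (cmod (\<Sum>x\<in>I. of_real (w x) * (u k x * cnj (u k' x))))\<^sup>2)
     = (\<Sum>k\<in>K. \<Sum>k'\<in>K. \<Sum>x\<in>I. \<Sum>y\<in>I. ?t k k' x y)"
    by (simp only: of_real_sum sq cnj_sum sum_product) (simp add: mult_ac)
  also have "\<dots> = (\<Sum>k\<in>K. \<Sum>x\<in>I. \<Sum>k'\<in>K. \<Sum>y\<in>I. ?t k k' x y)"
    by (intro sum.cong refl sum.swap)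
  also have "\<dots> = (\<Sum>x\<in>I. \<Sum>k\<in>K. \<Sum>k'\<in>K. \<Sum>y\<in>I. ?t k k' x y)"
    by (rule sum.swap)
  also have "\<dots> = (\<Sum>x\<in>I. \<Sum>k\<in>K. \<Sum>y\<in>I. \<Sum>k'\<in>K. ?t k k' x y)"
    by (intro sum.cong refl sum.swap)
  also have "\<dots> = (\<Sum>x\<in>I. \<Sum>y\<in>I. \<Sum>k\<in>K. \<Sum>k'\<in>K. ?t k k' x y)"
    by (intro sum.cong refl sum.swap)
  also have "\<dots> = complex_of_real (\<Sum>x\<in>I. \<Sum>y\<in>I. w x * w y * (cmod (\<Sum>k\<in>K. u k x * cnj (u k y)))\<^sup>2)"
  proof -
    have "complex_of_real ((cmod (\<Sum>k\<in>K. u k x * cnj (u k y)))\<^sup>2)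
        = (\<Sum>k\<in>K. \<Sum>k'\<in>K. u k x * cnj (u k' x) * (cnj (u k y) * u k' y))" for x y
      by (simp only: sq cnj_sum sum_product) (simp add: mult_ac)
    then show ?thesis by (simp only: of_real_sum of_real_mult sum_distrib_left)
  qed
  finally show ?thesis by (simp only: of_real_eq_iff)
qed

section \<open>Correlations of the Fourier vectors at neighbouring frequencies\<close>

context sampling_grid
begin

lemma cmod_b_le: "\<Delta> * cmod (b k \<xi>) \<le> B"
proof -
  have "cmod (b k \<xi>) \<le> (\<Sum>d\<in>{- int l..int l}. F)"
    unfolding b_def by (rule sum_norm_le) (simp add: norm_mult bounded)
  then have "\<Delta> * cmod (b k \<xi>) \<le> \<Delta> * ((2 * real l + 1) * F)" using \<Delta>_pos by (intro mult_left_mono) auto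
  also have "\<dots> \<le> width * F" using mult_right_mono[OF window_le(1) F_nonneg] by (simp add: mult_ac)
  finally show ?thesis by (simp add: B_def)
qed

text \<open>On interior indices the product of the two vectors is a factor in the second component
  times \<open>iexp (\<theta> * i)\<close>, so the sum factorizes into at most \<open>q\<close>
  bounded terms times a geometric sum, with |\<open>\<theta>\<close>| at most 1 by
  \<open>xy\<close>. Edge indices are few and are bounded one by one.\<close>

lemma cmod_cross_sum_le:
  fixes x y :: int and \<xi> :: real
  assumes xy: "\<bar>x - y\<bar> \<le> int n"
  defines "u \<equiv> \<lambda>k z. of_real \<Delta> * c k (\<xi> + of_int z / (real n * \<Delta>))"
  shows "cmod (\<Sum>k\<in>K. u k x * cnj (u k y))
    \<le> real q * B\<^sup>2 * (real n * (if x = y then 1 else 4 / \<bar>of_int (x - y)\<bar>) + (4 * real l + 1))"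
proof -
  define \<phi> where "\<phi> = (if x = y then 1 else 4 / \<bar>real_of_int (x - y)\<bar>)"
  define \<theta> where "\<theta> = real_of_int (x - y) / real n"
  define \<xi>' where "\<xi>' z = \<xi> + of_int z / (real n * \<Delta>)" for z :: int
  have n: "real n > 0" using n_pos by simp
  have geo: "cmod (\<Sum>i\<in>{int l + 1..int n - int l}. iexp (\<theta> * of_int i)) \<le> real n * \<phi>"
  proof (cases "x = y")
    case True
    have "cmod (\<Sum>i\<in>{int l + 1..int n - int l}. iexp (\<theta> * of_int i)) \<le> (\<Sum>i\<in>{int l + 1..int n - int l}. 1)"
      by (rule sum_norm_le) simp
    also have "\<dots> \<le> real n" by simp
    finally show ?thesis using True by (simp add: \<phi>_def)
  next
    case False
    have "\<bar>real_of_int (x - y)\<bar> \<le> real n" using xy by linarith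
    then have "\<bar>\<theta>\<bar> \<le> 1" using n by (simp add: \<theta>_def)
    then have "cmod (\<Sum>i\<in>{int l + 1..int n - int l}. iexp (\<theta> * of_int i)) \<le> 4 / \<bar>\<theta>\<bar>"
      using False n by (intro norm_sum_iexp_le) (auto simp: \<theta>_def)
    also have "\<dots> = real n * \<phi>" using False n by (simp add: \<phi>_def \<theta>_def)
    finally show ?thesis .
  qed
  have ub: "cmod (u k z) \<le> B" if "k \<in> K" for k z
    using cmod_c_le[OF that] \<Delta>_pos by (simp add: u_def norm_mult)
  have edge: "cmod (\<Sum>k\<in>edge. u k x * cnj (u k y)) \<le> real q * B\<^sup>2 * (4 * real l + 1)"
  proof -
    have "cmod (\<Sum>k\<in>edge. u k x * cnj (u k y)) \<le> (\<Sum>k\<in>edge. B * B)"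
      by (rule sum_norm_le) (use ub B_nonneg in \<open>auto simp: norm_mult edge_def intro!: mult_mono\<close>)
    also have "\<dots> = real (card edge) * B\<^sup>2" by (simp add: power2_eq_square)
    also have "\<dots> \<le> real ((4 * l + 1) * q) * B\<^sup>2"
      using card_edge_le by (intro mult_right_mono of_nat_mono) auto
    finally show ?thesis by (simp add: algebra_simps)
  qed
  have int_eq: "K - edge = {int l + 1..int n - int l} \<times> {..<q}"
    by (auto simp: edge_def K_def)
  have ui: "u k x * cnj (u k y) = of_real \<Delta> * b (0, snd k) (\<xi>' x) * cnj (of_real \<Delta> * b (0, snd k) (\<xi>' y)) * iexp (\<theta> * of_int (fst k))"
    if k: "k \<in> K - edge" for k
  proof -
    have b0: "b k z = b (0, snd k) z" for z by (simp add: b_def \<rho>_def)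
    have "iexp (\<xi>' x * of_int (fst k) * \<Delta>) * cnj (iexp (\<xi>' y * of_int (fst k) * \<Delta>))
        = iexp (\<xi>' x * of_int (fst k) * \<Delta>) * iexp (- (\<xi>' y * of_int (fst k) * \<Delta>))"
      by (simp add: exp_cnj)
    also have "\<dots> = iexp ((\<xi>' x - \<xi>' y) * \<Delta> * of_int (fst k))"
      by (simp only: exp_add[symmetric]) (simp add: algebra_simps)
    \<comment> \<open>The spacing 1/(n \<Delta>) of the smoothing frequencies cancels the sampling
      step: neighbouring frequencies differ by a phase 1/n per observation.\<close>
    also have "(\<xi>' x - \<xi>' y) * \<Delta> = \<theta>"
      using n \<Delta>_pos by (simp add: \<xi>'_def \<theta>_def field_simps)
    finally have e: "iexp (\<xi>' x * of_int (fst k) * \<Delta>) * cnj (iexp (\<xi>' y * of_int (fst k) * \<Delta>)) = iexp (\<theta> * of_int (fst k))" .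
    have "u k x * cnj (u k y) = of_real \<Delta> * b k (\<xi>' x) * cnj (of_real \<Delta> * b k (\<xi>' y)) *
       (iexp (\<xi>' x * of_int (fst k) * \<Delta>) * cnj (iexp (\<xi>' y * of_int (fst k) * \<Delta>)))"
      unfolding u_def \<xi>'_def[symmetric] c_interior[OF k] complex_cnj_mult by (simp only: mult_ac)
    then show ?thesis by (simp only: e b0)
  qed
  define v where "v r z = of_real \<Delta> * b (0, r) (\<xi>' z)" for r z
  have bb: "cmod (v r z) \<le> B" for r z
    using cmod_b_le \<Delta>_pos by (simp add: v_def norm_mult)
  define S where "S = (\<Sum>i\<in>{int l + 1..int n - int l}. iexp (\<theta> * of_int i))"
  have "(\<Sum>k\<in>K - edge. u k x * cnj (u k y)) = (\<Sum>k\<in>K - edge. v (snd k) x * cnj (v (snd k) y) * iexp (\<theta> * of_int (fst k)))"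
    unfolding v_def by (rule sum.cong[OF refl ui])
  also have "\<dots> = (\<Sum>r<q. v r x * cnj (v r y) * S)"
    unfolding int_eq sum_distrib_left S_def
    by (subst sum.swap, subst sum.cartesian_product) (simp add: case_prod_beta)
  finally have eq: "(\<Sum>k\<in>K - edge. u k x * cnj (u k y)) = (\<Sum>r<q. v r x * cnj (v r y) * S)" .
  have "cmod (\<Sum>r<q. v r x * cnj (v r y) * S) \<le> (\<Sum>r<q. B * B * (real n * \<phi>))"
  proof (rule sum_norm_le)
    fix r
    show "cmod (v r x * cnj (v r y) * S) \<le> B * B * (real n * \<phi>)"
      unfolding norm_mult complex_mod_cnj
      by (intro mult_mono bb geo[folded S_def] mult_nonneg_nonneg norm_ge_zero B_nonneg)
  qed
  then have interior: "cmod (\<Sum>k\<in>K - edge. u k x * cnj (u k y)) \<le> real q * B\<^sup>2 * (real n * \<phi>)"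
    unfolding eq by (simp add: power2_eq_square)
  have "(\<Sum>k\<in>K. u k x * cnj (u k y)) = (\<Sum>k\<in>K - edge. u k x * cnj (u k y)) + (\<Sum>k\<in>edge. u k x * cnj (u k y))"
    by (rule sum.subset_diff) (auto simp: edge_def finite_K)
  then have "cmod (\<Sum>k\<in>K. u k x * cnj (u k y)) \<le> real q * B\<^sup>2 * (real n * \<phi>) + real q * B\<^sup>2 * (4 * real l + 1)"
    using order_trans[OF norm_triangle_ineq add_mono[OF interior edge]] by simp
  then show ?thesis by (simp add: \<phi>_def[symmetric] distrib_left)
qed

text \<open>The smoothing gain: without weights the main term would be of order (n q)^2, here it
  carries the extra factor \<open>wm\<close>. The assumption 2 m \<le> n keeps all frequency
  differences within the range of \<open>cmod_cross_sum_le\<close>.\<close>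

lemma sum_cross_sq_le:
  fixes w :: "int \<Rightarrow> real" and m :: nat and \<xi> :: real
  assumes w: "\<And>x. \<bar>x\<bar> \<le> int m \<Longrightarrow> 0 \<le> w x" "\<And>x. \<bar>x\<bar> \<le> int m \<Longrightarrow> w x \<le> wm"
    and sum: "(\<Sum>x\<in>{- int m..int m}. w x) = 1" and m: "2 * m \<le> n"
  defines "u \<equiv> \<lambda>k z. of_real \<Delta> * c k (\<xi> + of_int z / (real n * \<Delta>))"
  shows "(\<Sum>k\<in>K. \<Sum>k'\<in>K. (cmod (\<Sum>x\<in>{- int m..int m}. of_real (w x) * (u k x * cnj (u k' x))))\<^sup>2)
    \<le> (real q)\<^sup>2 * B ^ 4 * (130 * (real n)\<^sup>2 * wm + 2 * (4 * real l + 1)\<^sup>2)"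
proof -
  let ?I = "{- int m..int m}"
  define \<phi> where "\<phi> d = (if d = 0 then 1 else 16 / (real_of_int d)\<^sup>2)" for d :: int
  have wm: "wm \<ge> 0" using w[of 0] by simp
  have H: "(cmod (\<Sum>k\<in>K. u k x * cnj (u k y)))\<^sup>2 \<le> (real q)\<^sup>2 * B ^ 4 * (2 * (real n)\<^sup>2 * \<phi> (x - y) + 2 * (4 * real l + 1)\<^sup>2)"
    if "x \<in> ?I" "y \<in> ?I" for x y
  proof -
    let ?p = "if x = y then 1 else 4 / \<bar>real_of_int (x - y)\<bar>"
    have "cmod (\<Sum>k\<in>K. u k x * cnj (u k y)) \<le> real q * B\<^sup>2 * (real n * ?p + (4 * real l + 1))"
      unfolding u_def by (rule cmod_cross_sum_le) (use that m in auto)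
    then have "(cmod (\<Sum>k\<in>K. u k x * cnj (u k y)))\<^sup>2 \<le> (real q * B\<^sup>2 * (real n * ?p + (4 * real l + 1)))\<^sup>2"
      by (intro power_mono) auto
    also have "\<dots> = (real q)\<^sup>2 * B ^ 4 * (real n * ?p + (4 * real l + 1))\<^sup>2"
      by (simp only: power_mult_distrib power_mult[symmetric]) simp
    also have "(real n * ?p + (4 * real l + 1))\<^sup>2 \<le> 2 * (real n * ?p)\<^sup>2 + 2 * (4 * real l + 1)\<^sup>2"
    proof -
      have "(a + b)\<^sup>2 \<le> 2 * a\<^sup>2 + 2 * b\<^sup>2" for a b :: real
        using zero_le_power2[of "a - b"] by (simp add: power2_eq_square algebra_simps)
      then show ?thesis .
    qed
    also have "(real n * ?p)\<^sup>2 = (real n)\<^sup>2 * \<phi> (x - y)"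
      by (simp add: \<phi>_def power_mult_distrib power_divide)
    finally show ?thesis by (simp add: mult_left_mono mult.assoc)
  qed
  have "(\<Sum>k\<in>K. \<Sum>k'\<in>K. (cmod (\<Sum>x\<in>?I. of_real (w x) * (u k x * cnj (u k' x))))\<^sup>2)
     = (\<Sum>x\<in>?I. \<Sum>y\<in>?I. w x * w y * (cmod (\<Sum>k\<in>K. u k x * cnj (u k y)))\<^sup>2)"
    by (rule sum_cmod_sq_gram) (auto simp: finite_K)
  also have "\<dots> \<le> (\<Sum>x\<in>?I. \<Sum>y\<in>?I. w x * w y * ((real q)\<^sup>2 * B ^ 4 * (2 * (real n)\<^sup>2 * \<phi> (x - y) + 2 * (4 * real l + 1)\<^sup>2)))"
    by (intro sum_mono mult_left_mono H mult_nonneg_nonneg w) auto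
  also have "\<dots> = (real q)\<^sup>2 * B ^ 4 * (2 * (real n)\<^sup>2 * (\<Sum>x\<in>?I. \<Sum>y\<in>?I. w x * w y * \<phi> (x - y))
       + 2 * (4 * real l + 1)\<^sup>2 * ((\<Sum>x\<in>?I. w x) * (\<Sum>y\<in>?I. w y)))"
  proof -
    have "(\<Sum>x\<in>?I. \<Sum>y\<in>?I. w x * w y * (Z * (a * \<phi> (x - y) + c)))
      = Z * (a * (\<Sum>x\<in>?I. \<Sum>y\<in>?I. w x * w y * \<phi> (x - y)) + c * (\<Sum>x\<in>?I. \<Sum>y\<in>?I. w x * w y))" for Z a c
      by (simp only: sum_distrib_left distrib_left sum.distrib) (simp only: mult_ac)
    then show ?thesis by (simp only: sum_product)
  qed
  also have "\<dots> \<le> (real q)\<^sup>2 * B ^ 4 * (2 * (real n)\<^sup>2 * (65 * wm) + 2 * (4 * real l + 1)\<^sup>2 * 1)"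
  proof -
    \<comment> \<open>Only the inner weight is replaced by its maximum; the decay of
      \<open>\<phi>\<close> sums over \<open>y\<close>, and the outer weights still sum to
      1.\<close>
    have "(\<Sum>x\<in>?I. \<Sum>y\<in>?I. w x * w y * \<phi> (x - y)) \<le> (\<Sum>x\<in>?I. \<Sum>y\<in>?I. w x * wm * \<phi> (x - y))"
      by (intro sum_mono mult_right_mono mult_left_mono w) (auto simp: \<phi>_def)
    also have "\<dots> = (\<Sum>x\<in>?I. w x * wm * (\<Sum>y\<in>?I. \<phi> (x - y)))"
      by (simp add: sum_distrib_left)
    also have "\<dots> \<le> (\<Sum>x\<in>?I. w x * wm * 65)"
      unfolding \<phi>_def using w wm by (intro sum_mono mult_left_mono sum_kernel_weight_le) auto
    also have "\<dots> = 65 * wm" unfolding sum_distrib_right[symmetric] sum by simp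
    finally show ?thesis unfolding sum mult_1_left by (intro mult_left_mono add_right_mono) auto
  qed
  finally show ?thesis by (simp add: mult.assoc)
qed

end

subsection \<open>The periodogram of a discretized moving average\<close>


text \<open>Fubini's theorem passes a bound at each single frequency to the integral. The uniform
  bound \<open>b\<close> provides joint integrability and does not enter the result.\<close>

lemma (in prob_space) expectation_set_integral_le:
  fixes g :: "'a \<Rightarrow> real \<Rightarrow> real"
  assumes meas [measurable]: "(\<lambda>(x, \<xi>). g x \<xi>) \<in> borel_measurable (M \<Otimes>\<^sub>M lborel)"
    and bound: "\<And>x \<xi>. 0 \<le> g x \<xi>" "\<And>x \<xi>. g x \<xi> \<le> b"
    and E: "\<And>\<xi>. \<bar>\<xi>\<bar> \<le> a \<Longrightarrow> expectation (\<lambda>x. g x \<xi>) \<le> r" and a: "a \<ge> 0"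
  shows "integrable M (\<lambda>x. LINT \<xi>:{-a..a}|lborel. g x \<xi>)"
    and "expectation (\<lambda>x. LINT \<xi>:{-a..a}|lborel. g x \<xi>) \<le> 2 * a * r"
proof -
  interpret P: pair_sigma_finite M lborel ..
  have em: "emeasure (M \<Otimes>\<^sub>M lborel) (space M \<times> {-a..a}) < \<infinity>"
    using a by (subst lborel.emeasure_pair_measure_Times) (auto simp: emeasure_space_1)
  have int: "integrable (M \<Otimes>\<^sub>M lborel) (\<lambda>(x, \<xi>). indicator {-a..a} \<xi> * g x \<xi>)"
  proof (rule Bochner_Integration.integrable_bound)
    show "integrable (M \<Otimes>\<^sub>M lborel) (\<lambda>p. b * indicator (space M \<times> {-a..a}) p)"
      using em by (intro integrable_mult_right integrable_real_indicator) auto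
    show "AE p in M \<Otimes>\<^sub>M lborel. norm (case p of (x, \<xi>) \<Rightarrow> indicator {-a..a} \<xi> * g x \<xi>) \<le> norm (b * indicator (space M \<times> {-a..a}) p)"
      using bound by (intro AE_I2) (auto simp: indicator_def space_pair_measure abs_mult intro: order_trans[OF bound(2) abs_ge_self])
  qed auto
  show 1: "integrable M (\<lambda>x. LINT \<xi>:{-a..a}|lborel. g x \<xi>)"
    using P.integrable_fst'[OF int] by (simp add: set_lebesgue_integral_def)
  have "expectation (\<lambda>x. LINT \<xi>:{-a..a}|lborel. g x \<xi>) = (LINT \<xi>|lborel. (LINT x|M. indicator {-a..a} \<xi> * g x \<xi>))"
    using P.Fubini_integral[OF int] by (simp add: set_lebesgue_integral_def)
  also have "\<dots> \<le> (LINT \<xi>|lborel. r * indicator {-a..a} \<xi>)"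
  proof (rule integral_mono)
    show "integrable lborel (\<lambda>\<xi>. LINT x|M. indicator {-a..a} \<xi> * g x \<xi>)"
      using P.integrable_snd[OF int] by simp
    show "integrable lborel (\<lambda>\<xi>. r * indicator {-a..a} \<xi>)"
      by (intro integrable_mult_right integrable_real_indicator) (auto simp: emeasure_lborel_Icc_eq)
    show "(LINT x|M. indicator {-a..a} \<xi> * g x \<xi>) \<le> r * indicator {-a..a} \<xi>" for \<xi>
      using E[of \<xi>] by (auto simp: indicator_def)
  qed
  also have "\<dots> = 2 * a * r" using a by simp
  finally show "expectation (\<lambda>x. LINT \<xi>:{-a..a}|lborel. g x \<xi>) \<le> 2 * a * r" .
qed

lemma sq_sum3_le: "(x + y + z)\<^sup>2 \<le> 3 * (x\<^sup>2 + y\<^sup>2 + z\<^sup>2)" for x y z :: real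
proof -
  have "0 \<le> (x - y)\<^sup>2 + (y - z)\<^sup>2 + (x - z)\<^sup>2" by simp
  then show ?thesis by (simp add: power2_eq_square algebra_simps)
qed

text \<open>The increments are abstracted to an i.i.d. symmetric family; stability of their law
  enters later, when the cells of the random measure are shown to supply such a family.\<close>

locale noisy_grid = sampling_grid f L F \<Delta> \<kappa> q n +
  noise: iid_symmetric_family M "sampling_grid.K L \<Delta> q n" \<epsilon> \<mu>
  for f L F \<Delta> \<kappa> q n and M :: "'a measure" and \<epsilon> \<mu>
begin

definition path :: "'a \<Rightarrow> real \<Rightarrow> real" where "path x t = (\<Sum>k\<in>K. f (t - s k) * \<epsilon> k x)"

text \<open>On \<open>Q > 0\<close> this is \<Delta> times the sum of the squared observations,
  divided by the noise energy \<open>Q\<close>.\<close>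

definition ratio :: "'a \<Rightarrow> real" where
  "ratio x = (\<Sum>(k, k')\<in>K \<times> K. (\<Delta> * gram k k') * (noise.\<eta> k x * noise.\<eta> k' x))"

definition edge_mass :: "'a \<Rightarrow> real" where "edge_mass x = (\<Sum>k\<in>edge. (noise.\<eta> k x)\<^sup>2)"

abbreviation "off \<equiv> (SIGMA k:K. K - {k})"

lemma sum_square_split:
  "(\<Sum>(k, k')\<in>K \<times> K. A k k') = (\<Sum>k\<in>K. A k k) + (\<Sum>(k, k')\<in>off. A k k')" for A :: "_ \<Rightarrow> _ \<Rightarrow> real"
proof -
  have "K \<times> K = (\<lambda>k. (k, k)) ` K \<union> off" by auto
  moreover have "(\<Sum>(k, k')\<in>(\<lambda>k. (k, k)) ` K. A k k') = (\<Sum>k\<in>K. A k k)"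
    by (subst sum.reindex) (auto simp: inj_on_def)
  moreover have "finite off" using finite_K by auto
  ultimately show ?thesis using finite_K by (subst \<open>K \<times> K = _\<close>) (subst sum.union_disjoint; auto)
qed

text \<open>The \<open>+ 1\<close> makes both factors of N (N - 1) at least n q.\<close>

lemma card_K_bound: "real n * real q + 1 \<le> real (card K)"
proof -
  have "n * q + 1 \<le> card K" using q_pos by (simp add: card_K add_mult_distrib)
  then show ?thesis by (metis of_nat_1 of_nat_add of_nat_le_iff of_nat_mult)
qed

lemma card_prod_bound: "(real n * real q)\<^sup>2 \<le> real (card K) * (real (card K) - 1)"
  using card_K_bound n_pos q_pos unfolding power2_eq_square by (intro mult_mono) auto

lemma nq_pos: "real n * real q > 0" using n_pos q_pos by simp

lemma mesh_edge: "(4 * real l + 1) / real n \<le> 2 * width / (real n * \<Delta>)"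
proof -
  have "(4 * real l + 1) / real n = (4 * real l + 1) * \<Delta> / (real n * \<Delta>)" using \<Delta>_pos by simp
  also have "\<dots> \<le> 2 * width / (real n * \<Delta>)"
    using window_le(2) \<Delta>_pos by (intro divide_right_mono) auto
  finally show ?thesis .
qed

lemma edge_mass_bounds: "0 \<le> edge_mass x" "edge_mass x \<le> 1"
proof -
  show "0 \<le> edge_mass x" by (simp add: edge_mass_def sum_nonneg)
  have "edge_mass x \<le> (\<Sum>k\<in>K. (noise.\<eta> k x)\<^sup>2)"
    unfolding edge_mass_def by (intro sum_mono2) (auto simp: finite_K edge_def)
  also have "\<dots> \<le> 1" by (simp add: noise.sum_\<eta>_sq)
  finally show "edge_mass x \<le> 1" .
qed

lemma measurable_edge_mass [measurable]: "edge_mass \<in> borel_measurable M"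
  unfolding edge_mass_def by (intro borel_measurable_sum borel_measurable_power noise.measurable_\<eta>) (auto simp: edge_def)

text \<open>The edge mass lies in [0, 1], so its square is below it, and by exchangeability its mean
  is the proportion of edge indices.\<close>

lemma expectation_edge_mass_sq: "noise.expectation (\<lambda>x. (edge_mass x)\<^sup>2) \<le> 2 * width / (real n * \<Delta>)"
proof -
  have "noise.expectation (\<lambda>x. (edge_mass x)\<^sup>2) \<le> noise.expectation edge_mass"
  proof (rule integral_mono)
    show "integrable M (\<lambda>x. (edge_mass x)\<^sup>2)"
      using edge_mass_bounds by (intro noise.integrable_bounded[where c=1]) (auto simp: power_le_one)
    show "integrable M edge_mass"
      using edge_mass_bounds by (intro noise.integrable_bounded[where c=1]) auto
    show "(edge_mass x)\<^sup>2 \<le> edge_mass x" for x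
      using edge_mass_bounds[of x] mult_left_mono[of "edge_mass x" 1 "edge_mass x"] by (simp add: power2_eq_square)
  qed
  also have "\<dots> = (\<Sum>k\<in>edge. noise.expectation (\<lambda>x. (noise.\<eta> k x)\<^sup>2))"
    unfolding edge_mass_def
    by (intro Bochner_Integration.integral_sum noise.integrable_bounded[where c=1]) (auto simp: edge_def noise.\<eta>_sq_le)
  also have "\<dots> = (\<Sum>k\<in>edge. 1 / real (card K))"
    by (intro sum.cong refl noise.expectation_\<eta>_sq) (auto simp: edge_def)
  also have "\<dots> = real (card edge) / real (card K)" by simp
  also have "\<dots> \<le> real ((4 * l + 1) * q) / (real n * real q)"
    using card_edge_le card_K_bound nq_pos by (intro frac_le of_nat_mono) auto
  also have "real ((4 * l + 1) * q) = (4 * real l + 1) * real q" by (simp add: algebra_simps)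
  also have "(4 * real l + 1) * real q / (real n * real q) = (4 * real l + 1) / real n" using q_pos by simp
  also have "\<dots> \<le> 2 * width / (real n * \<Delta>)" by (rule mesh_edge)
  finally show ?thesis .
qed

text \<open>The squares of \<open>\<eta>\<close> have total mass at most 1, so a quantity that is
  small on the interior and merely bounded on the edge averages to \<open>e\<close> plus
  \<open>C\<close> times the edge mass.\<close>

lemma weighted_edge_bound:
  assumes int: "\<And>k. k \<in> K - edge \<Longrightarrow> \<bar>D k\<bar> \<le> e" and all: "\<And>k. k \<in> K \<Longrightarrow> \<bar>D k\<bar> \<le> C" and e: "e \<ge> 0"
  shows "\<bar>\<Sum>k\<in>K. D k * (noise.\<eta> k x)\<^sup>2\<bar> \<le> e + C * edge_mass x"
proof -
  have "\<bar>\<Sum>k\<in>K. D k * (noise.\<eta> k x)\<^sup>2\<bar> \<le> (\<Sum>k\<in>K. \<bar>D k\<bar> * (noise.\<eta> k x)\<^sup>2)"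
    by (rule order_trans[OF sum_abs]) (simp add: abs_mult)
  also have "\<dots> = (\<Sum>k\<in>K - edge. \<bar>D k\<bar> * (noise.\<eta> k x)\<^sup>2) + (\<Sum>k\<in>edge. \<bar>D k\<bar> * (noise.\<eta> k x)\<^sup>2)"
    by (rule sum.subset_diff) (auto simp: edge_def finite_K)
  also have "\<dots> \<le> (\<Sum>k\<in>K - edge. e * (noise.\<eta> k x)\<^sup>2) + (\<Sum>k\<in>edge. C * (noise.\<eta> k x)\<^sup>2)"
    by (intro add_mono sum_mono mult_right_mono int all) (auto simp: edge_def)
  also have "(\<Sum>k\<in>K - edge. e * (noise.\<eta> k x)\<^sup>2) \<le> (\<Sum>k\<in>K. e * (noise.\<eta> k x)\<^sup>2)"
    using e by (intro sum_mono2) (auto simp: finite_K)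
  also have "\<dots> \<le> e" using e by (simp add: sum_distrib_left[symmetric] noise.sum_\<eta>_sq)
  finally show ?thesis by (simp add: edge_mass_def sum_distrib_left)
qed

lemma integrable_off_sq:
  "integrable M (\<lambda>x. (\<Sum>(k, k')\<in>off. A k k' * (noise.\<eta> k x * noise.\<eta> k' x))\<^sup>2)" for A :: "_ \<Rightarrow> _ \<Rightarrow> real"
proof (rule noise.integrable_bounded[where c="(\<Sum>(k, k')\<in>off. \<bar>A k k'\<bar>)\<^sup>2"])
  show "(\<lambda>x. (\<Sum>(k, k')\<in>off. A k k' * (noise.\<eta> k x * noise.\<eta> k' x))\<^sup>2) \<in> borel_measurable M"
    unfolding case_prod_beta
    by (intro borel_measurable_power borel_measurable_sum borel_measurable_times borel_measurable_const noise.measurable_\<eta>) auto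
  fix x
  have "\<bar>\<Sum>(k, k')\<in>off. A k k' * (noise.\<eta> k x * noise.\<eta> k' x)\<bar> \<le> (\<Sum>(k, k')\<in>off. \<bar>A k k'\<bar> * 1)"
    unfolding case_prod_beta
  proof (rule order_trans[OF sum_abs], rule sum_mono)
    fix p assume "p \<in> off"
    then have "\<bar>noise.\<eta> (fst p) x\<bar> * \<bar>noise.\<eta> (snd p) x\<bar> \<le> 1"
      by (intro mult_le_one noise.\<eta>_abs_le) auto
    then show "\<bar>A (fst p) (snd p) * (noise.\<eta> (fst p) x * noise.\<eta> (snd p) x)\<bar> \<le> \<bar>A (fst p) (snd p)\<bar> * 1"
      unfolding abs_mult by (intro mult_left_mono) auto
  qed
  then have "(\<bar>\<Sum>(k, k')\<in>off. A k k' * (noise.\<eta> k x * noise.\<eta> k' x)\<bar>)\<^sup>2 \<le> (\<Sum>(k, k')\<in>off. \<bar>A k k'\<bar>)\<^sup>2"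
    by (intro power_mono) auto
  then show "\<bar>(\<Sum>(k, k')\<in>off. A k k' * (noise.\<eta> k x * noise.\<eta> k' x))\<^sup>2\<bar> \<le> (\<Sum>(k, k')\<in>off. \<bar>A k k'\<bar>)\<^sup>2"
    by simp
qed

text \<open>The diagonal of the Gram matrix is a Riemann sum of f^2, up to the edge. The
  off-diagonal part is a chaos with a banded matrix: about N (4 l + 1) q nonzero entries against N
  (N - 1) leave a proportion of order 1/(n \<Delta>). The constant 6 is 2 from the edge plus 4 from
  the chaos.\<close>

lemma second_moment_ratio:
  "integrable M (\<lambda>x. (ratio x - energy)\<^sup>2)"
  "noise.expectation (\<lambda>x. (ratio x - energy)\<^sup>2)
    \<le> 3 * ((2 * width * F * \<kappa>)\<^sup>2 + (width * F\<^sup>2)\<^sup>2 * (6 * width / (real n * \<Delta>)))"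
proof -
  have \<kappa>: "\<kappa> \<ge> 0" using modulus[of 0 0] \<Delta>_pos by simp
  let ?o = "\<lambda>x. \<Sum>(k, k')\<in>off. (\<Delta> * gram k k') * (noise.\<eta> k x * noise.\<eta> k' x)"
  let ?r = "\<lambda>x. 3 * ((2 * width * F * \<kappa>)\<^sup>2 + (width * F\<^sup>2)\<^sup>2 * (edge_mass x)\<^sup>2 + (?o x)\<^sup>2)"
  have AE: "AE x in M. (ratio x - energy)\<^sup>2 \<le> ?r x"
    using noise.AE_Q_pos
  proof eventually_elim
    case (elim x)
    have "ratio x - energy = (\<Sum>k\<in>K. (\<Delta> * gram k k - energy) * (noise.\<eta> k x)\<^sup>2) + ?o x"
    proof -
      have "(\<Sum>k\<in>K. energy * (noise.\<eta> k x)\<^sup>2) = energy"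
        using elim by (simp add: sum_distrib_left[symmetric] noise.sum_\<eta>_sq)
      then show ?thesis
        by (simp add: ratio_def sum_square_split left_diff_distrib sum_subtractf power2_eq_square)
    qed
    moreover have "\<bar>\<Sum>k\<in>K. (\<Delta> * gram k k - energy) * (noise.\<eta> k x)\<^sup>2\<bar> \<le> width * (2 * F * \<kappa>) + width * F\<^sup>2 * edge_mass x"
    proof (rule weighted_edge_bound[OF gram_diag_approx])
      fix k assume k: "k \<in> K"
      have "gram k k \<ge> 0" by (simp add: gram_def sum_nonneg)
      then have "\<Delta> * gram k k \<ge> 0" using \<Delta>_pos by simp
      then show "\<bar>\<Delta> * gram k k - energy\<bar> \<le> width * F\<^sup>2"
        using gram_le[OF k k] energy_nonneg energy_le_width by linarith
    qed (use width_pos F_nonneg \<kappa> in auto)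
    ultimately have "\<bar>ratio x - energy\<bar> \<le> \<bar>2 * width * F * \<kappa> + width * F\<^sup>2 * edge_mass x + \<bar>?o x\<bar>\<bar>"
      by (simp add: mult_ac)
    then have "(ratio x - energy)\<^sup>2 \<le> (2 * width * F * \<kappa> + width * F\<^sup>2 * edge_mass x + \<bar>?o x\<bar>)\<^sup>2"
      by (simp add: abs_le_square_iff)
    also have "\<dots> \<le> 3 * ((2 * width * F * \<kappa>)\<^sup>2 + (width * F\<^sup>2 * edge_mass x)\<^sup>2 + \<bar>?o x\<bar>\<^sup>2)" by (rule sq_sum3_le)
    finally show ?case by (simp add: power_mult_distrib)
  qed
  have im: "integrable M (\<lambda>x. (edge_mass x)\<^sup>2)"
    using edge_mass_bounds by (intro noise.integrable_bounded[where c=1]) (auto simp: power_le_one)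
  have io: "integrable M (\<lambda>x. (?o x)\<^sup>2)" by (rule integrable_off_sq)
  have ir: "integrable M ?r" using im io by auto
  have meas: "ratio \<in> borel_measurable M"
    unfolding ratio_def case_prod_beta
    by (intro borel_measurable_sum borel_measurable_times borel_measurable_const noise.measurable_\<eta>) auto
  show int: "integrable M (\<lambda>x. (ratio x - energy)\<^sup>2)"
    using meas AE by (intro Bochner_Integration.integrable_bound[OF ir]) (auto elim!: eventually_mono)
  have off: "noise.expectation (\<lambda>x. (?o x)\<^sup>2) \<le> (width * F\<^sup>2)\<^sup>2 * (4 * width / (real n * \<Delta>))"
  proof -
    let ?N = "real (card K) * (real (card K) - 1)"
    let ?near = "{(k, k') \<in> K \<times> K. \<bar>fst k - fst k'\<bar> \<le> 2 * int l}"
    have N: "real (card K) > 0" "real (card K) - 1 > 0" using card_K_bound nq_pos by linarith+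
    have fin: "finite ?near" by (rule finite_subset[of _ "K \<times> K"]) (auto simp: finite_K)
    have "(\<Sum>(k, k')\<in>off. (\<Delta> * gram k k')\<^sup>2) \<le> (\<Sum>(k, k')\<in>off. if \<bar>fst k - fst k'\<bar> \<le> 2 * int l then (width * F\<^sup>2)\<^sup>2 else 0)"
    proof (rule sum_mono)
      fix p assume "p \<in> off"
      then obtain k k' where p: "p = (k, k')" "k \<in> K" "k' \<in> K" by auto
      have "(\<Delta> * gram k k')\<^sup>2 \<le> (width * F\<^sup>2)\<^sup>2"
        using gram_le[OF p(2,3)] width_pos by (subst abs_le_square_iff[symmetric]) (auto simp: abs_mult)
      then show "(case p of (k, k') \<Rightarrow> (\<Delta> * gram k k')\<^sup>2) \<le> (case p of (k, k') \<Rightarrow> if \<bar>fst k - fst k'\<bar> \<le> 2 * int l then (width * F\<^sup>2)\<^sup>2 else 0)"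
        using p gram_far[OF p(2,3)] by auto
    qed
    also have "\<dots> \<le> (\<Sum>(k, k')\<in>K \<times> K. if \<bar>fst k - fst k'\<bar> \<le> 2 * int l then (width * F\<^sup>2)\<^sup>2 else 0)"
      by (intro sum_mono2) (auto simp: finite_K)
    also have "\<dots> = (\<Sum>p\<in>?near. (width * F\<^sup>2)\<^sup>2)"
      by (rule sum.mono_neutral_cong_right) (auto simp: finite_K split: if_splits)
    also have "\<dots> = real (card ?near) * (width * F\<^sup>2)\<^sup>2" by simp
    also have "\<dots> \<le> real (card K * ((4 * l + 1) * q)) * (width * F\<^sup>2)\<^sup>2"
      by (intro mult_right_mono of_nat_mono card_near_le) auto
    finally have S: "(\<Sum>(k, k')\<in>off. (\<Delta> * gram k k')\<^sup>2) \<le> real (card K) * ((4 * real l + 1) * real q) * (width * F\<^sup>2)\<^sup>2"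
      by (simp add: algebra_simps)
    have "noise.expectation (\<lambda>x. (?o x)\<^sup>2) \<le> 2 / ?N * (\<Sum>(k, k')\<in>off. (\<Delta> * gram k k')\<^sup>2)"
      by (rule noise.chaos_second_moment)
    also have "\<dots> \<le> 2 / ?N * (real (card K) * ((4 * real l + 1) * real q) * (width * F\<^sup>2)\<^sup>2)"
      using N S by (intro mult_left_mono) auto
    also have "\<dots> = 2 * (((4 * real l + 1) * real q) / (real (card K) - 1)) * (width * F\<^sup>2)\<^sup>2"
      using N by (simp add: field_simps)
    also have "\<dots> \<le> 2 * (((4 * real l + 1) * real q) / (real n * real q)) * (width * F\<^sup>2)\<^sup>2"
      using N card_K_bound nq_pos by (intro mult_right_mono mult_left_mono divide_left_mono) auto
    also have "\<dots> = 2 * ((4 * real l + 1) / real n) * (width * F\<^sup>2)\<^sup>2" using q_pos by simp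
    also have "\<dots> \<le> 2 * (2 * width / (real n * \<Delta>)) * (width * F\<^sup>2)\<^sup>2"
      by (intro mult_right_mono mult_left_mono mesh_edge) auto
    finally show ?thesis by (simp add: mult_ac)
  qed
  have "noise.expectation (\<lambda>x. (ratio x - energy)\<^sup>2) \<le> noise.expectation ?r"
    by (rule integral_mono_AE[OF int ir AE])
  also have "\<dots> = 3 * ((2 * width * F * \<kappa>)\<^sup>2 + (width * F\<^sup>2)\<^sup>2 * noise.expectation (\<lambda>x. (edge_mass x)\<^sup>2) + noise.expectation (\<lambda>x. (?o x)\<^sup>2))"
    using im io by (simp add: noise.prob_space)
  also have "\<dots> \<le> 3 * ((2 * width * F * \<kappa>)\<^sup>2 + (width * F\<^sup>2)\<^sup>2 * (2 * width / (real n * \<Delta>)) + (width * F\<^sup>2)\<^sup>2 * (4 * width / (real n * \<Delta>)))"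
    by (intro mult_left_mono add_mono add_left_mono expectation_edge_mass_sq off) auto
  also have "\<dots> = 3 * ((2 * width * F * \<kappa>)\<^sup>2 + (width * F\<^sup>2)\<^sup>2 * (6 * width / (real n * \<Delta>)))"
    by (simp add: field_simps)
  finally show "noise.expectation (\<lambda>x. (ratio x - energy)\<^sup>2)
    \<le> 3 * ((2 * width * F * \<kappa>)\<^sup>2 + (width * F\<^sup>2)\<^sup>2 * (6 * width / (real n * \<Delta>)))" .
qed

end

text \<open>Cauchy-Schwarz for the vectors sqrt(w) and sqrt(w) x. It converts the Lipschitz error of
  shifting the frequency into the second moment controlled by (A5).\<close>

lemma first_moment_weight_le:
  fixes w :: "int \<Rightarrow> real"
  assumes "\<And>x. \<bar>x\<bar> \<le> int m \<Longrightarrow> 0 \<le> w x" and "(\<Sum>x\<in>{- int m..int m}. w x) = 1"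
  shows "(\<Sum>x\<in>{- int m..int m}. w x * \<bar>of_int x\<bar>) \<le> sqrt (second_moment_weight m w)"
proof -
  let ?I = "{- int m..int m}"
  have "(\<Sum>x\<in>?I. w x * \<bar>of_int x\<bar>) = (\<Sum>x\<in>?I. \<bar>sqrt (w x)\<bar> * \<bar>sqrt (w x) * of_int x\<bar>)"
    using assms(1) by (intro sum.cong refl) (auto simp: abs_mult)
  also have "\<dots> \<le> L2_set (\<lambda>x. sqrt (w x)) ?I * L2_set (\<lambda>x. sqrt (w x) * of_int x) ?I"
    by (rule L2_set_mult_ineq)
  also have "L2_set (\<lambda>x. sqrt (w x)) ?I = 1"
  proof -
    have "(\<Sum>x\<in>?I. (sqrt (w x))\<^sup>2) = (\<Sum>x\<in>?I. w x)"
      using assms(1) by (intro sum.cong refl) auto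
    then show ?thesis by (simp add: L2_set_def assms(2))
  qed
  also have "L2_set (\<lambda>x. sqrt (w x) * of_int x) ?I = sqrt (second_moment_weight m w)"
    unfolding L2_set_def second_moment_weight_def using assms(1)
    by (intro arg_cong[where f=sqrt] sum.cong refl) (auto simp: power_mult_distrib)
  finally show ?thesis by simp
qed

section \<open>The numerator: mean square error of the smoothed spectrum\<close>

context compact_kernel
begin

definition C_diag :: real where "C_diag = 2 * B * (width + width * F + 2 * L\<^sup>2 * F)"

text \<open>The 3 comes from \<open>sq_sum3_le\<close>; in the bracket, 2 \<open>width\<close>
  belongs to the edge mass, 260 = 2 * 130 to the geometric sums, and 16 \<open>width\<close>^2 to
  the edge part of the chaos.\<close>

definition C_spec :: real where "C_spec = 3 * C_diag\<^sup>2 + 3 * B ^ 4 * (2 * width + 260 + 16 * width\<^sup>2)"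

lemma C_diag_nonneg: "C_diag \<ge> 0"
  using B_nonneg width_pos F_nonneg by (simp add: C_diag_def)

lemma C_spec_nonneg: "C_spec \<ge> 0"
  using B_nonneg width_pos by (simp add: C_spec_def)

end

locale smoothed_grid = noisy_grid f L F \<Delta> \<kappa> q n M \<epsilon> \<mu>
  for f L F \<Delta> \<kappa> q n and M :: "'a measure" and \<epsilon> \<mu> +
  fixes w :: "int \<Rightarrow> real" and m :: nat and wm a :: real
  assumes w_nonneg: "\<And>x. \<bar>x\<bar> \<le> int m \<Longrightarrow> 0 \<le> w x" and w_le: "\<And>x. \<bar>x\<bar> \<le> int m \<Longrightarrow> w x \<le> wm"
    and w_sum: "(\<Sum>x\<in>{- int m..int m}. w x) = 1" and m_le: "2 * m \<le> n"
    and T_ge: "real n * \<Delta> \<ge> 1" and a_nonneg: "a \<ge> 0"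
begin

abbreviation "I \<equiv> {- int m..int m}"
abbreviation "T \<equiv> real n * \<Delta>"

definition u :: "int \<times> nat \<Rightarrow> real \<Rightarrow> int \<Rightarrow> complex" where
  "u k \<xi> x = of_real \<Delta> * c k (\<xi> + of_int x / T)"

text \<open>The numerator of the smoothed periodogram after division by the noise energy, with
  \<Delta> absorbed into the vectors \<open>u\<close>; \<open>spec / ratio\<close> is \<Delta> times
  the smoothed periodogram.\<close>

definition spec :: "'a \<Rightarrow> real \<Rightarrow> real" where
  "spec y \<xi> = (\<Sum>x\<in>I. w x * (cmod (\<Sum>k\<in>K. of_real (noise.\<eta> k y) * u k \<xi> x))\<^sup>2)"

text \<open>The three sources of bias: oscillation of the kernel over a step, rotation of the phase
  over a step at frequencies up to \<open>a\<close>, and smoothing over neighbouring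
  frequencies.\<close>

definition rate :: real where "rate = \<kappa> + a * \<Delta> + sqrt (second_moment_weight m w) / T"

lemma T_pos: "T > 0" using T_ge by linarith

lemma \<kappa>_nonneg: "\<kappa> \<ge> 0" using modulus[of 0 0] \<Delta>_pos by simp

lemma second_moment_nonneg: "second_moment_weight m w \<ge> 0"
  unfolding second_moment_weight_def using w_nonneg by (intro sum_nonneg) auto

lemma rate_nonneg: "rate \<ge> 0"
  using \<kappa>_nonneg a_nonneg \<Delta>_pos second_moment_nonneg T_pos by (simp add: rate_def)

lemma u_le: "k \<in> K \<Longrightarrow> cmod (u k \<xi> x) \<le> B"
  using cmod_c_le[of k] \<Delta>_pos by (simp add: u_def norm_mult)

text \<open>The diagonal carries the deterministic limit, the rest is a chaos for
  \<open>chaos_second_moment\<close>. Real parts suffice because the quadratic form is real.\<close>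

lemma spec_split:
  "spec y \<xi> = (\<Sum>k\<in>K. (\<Sum>x\<in>I. w x * (cmod (u k \<xi> x))\<^sup>2) * (noise.\<eta> k y)\<^sup>2)
    + (\<Sum>(k, k')\<in>off. Re (\<Sum>x\<in>I. of_real (w x) * (u k \<xi> x * cnj (u k' \<xi> x))) * (noise.\<eta> k y * noise.\<eta> k' y))"
proof -
  have sq: "(cmod (\<Sum>k\<in>K. of_real (h k) * v k))\<^sup>2 = (\<Sum>(k, k')\<in>K \<times> K. Re (v k * cnj (v k')) * (h k * h k'))"
    for h :: "int \<times> nat \<Rightarrow> real" and v
  proof -
    have "complex_of_real ((cmod (\<Sum>k\<in>K. of_real (h k) * v k))\<^sup>2) = (\<Sum>(k, k')\<in>K \<times> K. of_real (h k * h k') * (v k * cnj (v k')))"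
      by (simp only: complex_norm_square cnj_sum sum_product sum.cartesian_product) (simp add: case_prod_beta mult_ac)
    then have "Re (complex_of_real ((cmod (\<Sum>k\<in>K. of_real (h k) * v k))\<^sup>2)) = Re (\<Sum>(k, k')\<in>K \<times> K. of_real (h k * h k') * (v k * cnj (v k')))"
      by (rule arg_cong)
    then show ?thesis by (simp add: case_prod_beta Re_sum mult_ac distrib_left)
  qed
  have "spec y \<xi> = (\<Sum>x\<in>I. \<Sum>(k, k')\<in>K \<times> K. w x * (Re (u k \<xi> x * cnj (u k' \<xi> x)) * (noise.\<eta> k y * noise.\<eta> k' y)))"
    unfolding spec_def sq sum_distrib_left case_prod_beta ..
  also have "\<dots> = (\<Sum>(k, k')\<in>K \<times> K. Re (\<Sum>x\<in>I. of_real (w x) * (u k \<xi> x * cnj (u k' \<xi> x))) * (noise.\<eta> k y * noise.\<eta> k' y))"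
    unfolding case_prod_beta by (subst sum.swap) (simp add: Re_sum sum_distrib_right mult.assoc)
  also have "\<dots> = (\<Sum>k\<in>K. Re (\<Sum>x\<in>I. of_real (w x) * (u k \<xi> x * cnj (u k \<xi> x))) * (noise.\<eta> k y * noise.\<eta> k y))
    + (\<Sum>(k, k')\<in>off. Re (\<Sum>x\<in>I. of_real (w x) * (u k \<xi> x * cnj (u k' \<xi> x))) * (noise.\<eta> k y * noise.\<eta> k' y))"
    by (rule sum_square_split)
  also have "(\<Sum>k\<in>K. Re (\<Sum>x\<in>I. of_real (w x) * (u k \<xi> x * cnj (u k \<xi> x))) * (noise.\<eta> k y * noise.\<eta> k y))
     = (\<Sum>k\<in>K. (\<Sum>x\<in>I. w x * (cmod (u k \<xi> x))\<^sup>2) * (noise.\<eta> k y)\<^sup>2)"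
  proof (rule sum.cong[OF refl])
    fix k
    have "Re (\<Sum>x\<in>I. of_real (w x) * (u k \<xi> x * cnj (u k \<xi> x))) = (\<Sum>x\<in>I. w x * (cmod (u k \<xi> x))\<^sup>2)"
      unfolding complex_norm_square[symmetric] of_real_mult[symmetric] of_real_sum[symmetric] Re_complex_of_real ..
    then show "Re (\<Sum>x\<in>I. of_real (w x) * (u k \<xi> x * cnj (u k \<xi> x))) * (noise.\<eta> k y * noise.\<eta> k y)
      = (\<Sum>x\<in>I. w x * (cmod (u k \<xi> x))\<^sup>2) * (noise.\<eta> k y)\<^sup>2" by (simp add: power2_eq_square)
  qed
  finally show ?thesis .
qed

lemma weighted_average_le:
  assumes "\<And>x. x \<in> I \<Longrightarrow> \<bar>g x - v\<bar> \<le> h x"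
  shows "\<bar>(\<Sum>x\<in>I. w x * g x) - v\<bar> \<le> (\<Sum>x\<in>I. w x * h x)"
proof -
  have "(\<Sum>x\<in>I. w x * g x) - v = (\<Sum>x\<in>I. w x * (g x - v))"
    by (simp add: right_diff_distrib sum_subtractf sum_distrib_right[symmetric] w_sum)
  also have "\<bar>\<dots>\<bar> \<le> (\<Sum>x\<in>I. \<bar>w x * (g x - v)\<bar>)" by (rule sum_abs)
  also have "\<dots> \<le> (\<Sum>x\<in>I. w x * h x)"
    using assms w_nonneg by (intro sum_mono) (auto simp: abs_mult intro!: mult_left_mono)
  finally show ?thesis .
qed

text \<open>Two replacements: the discrete transform by the modulus of the transform of
  \<open>f\<close> at the shifted frequency (Riemann sum), then the shifted frequency by \<xi>
  (Lipschitz bound). Both errors grow linearly in the shift |x|/T, whose weighted mean is bounded by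
  Cauchy-Schwarz.\<close>

lemma diag_approx:
  assumes k: "k \<in> K - edge" and \<xi>: "\<bar>\<xi>\<bar> \<le> a"
  shows "\<bar>(\<Sum>x\<in>I. w x * (cmod (u k \<xi> x))\<^sup>2) - (cmod (fourier f \<xi>))\<^sup>2\<bar> \<le> C_diag * rate"
proof -
  have kK: "k \<in> K" using k by auto
  let ?D = "width * F + 2 * L\<^sup>2 * F"
  have "\<bar>(\<Sum>x\<in>I. w x * (cmod (u k \<xi> x))\<^sup>2) - (cmod (fourier f \<xi>))\<^sup>2\<bar>
    \<le> (\<Sum>x\<in>I. w x * (2 * B * (width * (\<kappa> + F * a * \<Delta>) + ?D / T * \<bar>of_int x\<bar>)))"
  proof (rule weighted_average_le)
    fix x assume "x \<in> I"
    let ?z = "\<xi> + of_int x / T"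
    have u: "cmod (u k \<xi> x) = \<Delta> * cmod (c k ?z)" using \<Delta>_pos by (simp add: u_def norm_mult)
    have xT: "\<bar>of_int x / T\<bar> = \<bar>of_int x\<bar> / T" using T_pos by simp
    have "\<bar>cmod (u k \<xi> x) - cmod (fourier f ?z)\<bar> \<le> width * (\<kappa> + F * \<bar>?z\<bar> * \<Delta>)"
      unfolding u by (rule c_interior_approx[OF k])
    also have "\<dots> \<le> width * (\<kappa> + F * (a + \<bar>of_int x\<bar> / T) * \<Delta>)"
      using \<xi> xT width_pos F_nonneg \<Delta>_pos abs_triangle_ineq[of \<xi> "of_int x / T"]
      by (intro mult_left_mono mult_right_mono add_left_mono) auto
    also have "\<dots> = width * (\<kappa> + F * a * \<Delta>) + width * (F * (\<bar>of_int x\<bar> / T)) * \<Delta>"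
      by (simp add: algebra_simps)
    \<comment> \<open>The factor \<Delta> \<le> 1 is dropped, so that this shift error merges with
      the Lipschitz error.\<close>
    also have "\<dots> \<le> width * (\<kappa> + F * a * \<Delta>) + width * (F * (\<bar>of_int x\<bar> / T)) * 1"
      using \<Delta>_le width_pos F_nonneg T_pos by (intro add_left_mono mult_left_mono) auto
    finally have 1: "\<bar>cmod (u k \<xi> x) - cmod (fourier f ?z)\<bar> \<le> width * (\<kappa> + F * a * \<Delta>) + width * F * (\<bar>of_int x\<bar> / T)"
      by simp
    have "\<bar>cmod (fourier f ?z) - cmod (fourier f \<xi>)\<bar> \<le> cmod (fourier f ?z - fourier f \<xi>)"
      by (rule norm_triangle_ineq3)
    also have "\<dots> \<le> 2 * L\<^sup>2 * F * \<bar>?z - \<xi>\<bar>" by (rule fourier_lipschitz)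
    also have "\<dots> = 2 * L\<^sup>2 * F * (\<bar>of_int x\<bar> / T)" using xT by simp
    finally have 2: "\<bar>cmod (fourier f ?z) - cmod (fourier f \<xi>)\<bar> \<le> 2 * L\<^sup>2 * F * (\<bar>of_int x\<bar> / T)" .
    have 3: "\<bar>cmod (u k \<xi> x) - cmod (fourier f \<xi>)\<bar> \<le> width * (\<kappa> + F * a * \<Delta>) + ?D / T * \<bar>of_int x\<bar>"
      using 1 2 by (simp add: add_divide_distrib distrib_right)
    have "\<bar>(cmod (u k \<xi> x))\<^sup>2 - (cmod (fourier f \<xi>))\<^sup>2\<bar> = (cmod (u k \<xi> x) + cmod (fourier f \<xi>)) * \<bar>cmod (u k \<xi> x) - cmod (fourier f \<xi>)\<bar>"
    proof -
      have "(cmod (u k \<xi> x))\<^sup>2 - (cmod (fourier f \<xi>))\<^sup>2 = (cmod (u k \<xi> x) + cmod (fourier f \<xi>)) * (cmod (u k \<xi> x) - cmod (fourier f \<xi>))"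
        by (simp add: power2_eq_square algebra_simps)
      then show ?thesis by (simp add: abs_mult)
    qed
    also have "\<dots> \<le> (2 * B) * (width * (\<kappa> + F * a * \<Delta>) + ?D / T * \<bar>of_int x\<bar>)"
      using u_le[OF kK, of \<xi> x] cmod_fourier_le_B[of \<xi>] B_nonneg by (intro mult_mono 3) auto
    finally show "\<bar>(cmod (u k \<xi> x))\<^sup>2 - (cmod (fourier f \<xi>))\<^sup>2\<bar> \<le> 2 * B * (width * (\<kappa> + F * a * \<Delta>) + ?D / T * \<bar>of_int x\<bar>)" .
  qed
  also have "\<dots> = 2 * B * (width * (\<kappa> + F * a * \<Delta>)) * (\<Sum>x\<in>I. w x) + 2 * B * (?D / T) * (\<Sum>x\<in>I. w x * \<bar>of_int x\<bar>)"
  proof -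
    have "(\<Sum>x\<in>I. w x * (b * (p + r * \<bar>of_int x\<bar>))) = b * p * (\<Sum>x\<in>I. w x) + b * r * (\<Sum>x\<in>I. w x * \<bar>of_int x\<bar>)" for b p r
      by (simp add: sum_distrib_left sum.distrib[symmetric] algebra_simps)
    then show ?thesis .
  qed
  also have "\<dots> \<le> 2 * B * (width * (\<kappa> + F * a * \<Delta>)) * 1 + 2 * B * (?D / T) * sqrt (second_moment_weight m w)"
    unfolding w_sum
    by (intro add_left_mono mult_left_mono first_moment_weight_le w_nonneg w_sum)
      (use B_nonneg width_pos F_nonneg T_pos in auto)
  also have "\<dots> = 2 * B * (width * \<kappa> + width * F * (a * \<Delta>) + ?D * (sqrt (second_moment_weight m w) / T))"
    by (simp add: algebra_simps add_divide_distrib)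
  also have "\<dots> \<le> 2 * B * ((width + ?D) * \<kappa> + (width + ?D) * (a * \<Delta>) + (width + ?D) * (sqrt (second_moment_weight m w) / T))"
  proof -
    have "width \<le> width + ?D" "width * F \<le> width + ?D" "?D \<le> width + ?D"
      using width_pos F_nonneg by auto
    note * = this[THEN mult_right_mono]
    show ?thesis
      using B_nonneg \<kappa>_nonneg a_nonneg \<Delta>_pos T_pos second_moment_nonneg
      by (intro mult_left_mono add_mono *) auto
  qed
  also have "\<dots> = C_diag * rate" by (simp add: C_diag_def rate_def algebra_simps)
  finally show ?thesis .
qed

text \<open>Bias, edge mass and chaos are estimated separately; only the chaos needs smoothing,
  which is where \<open>wm\<close> comes from.\<close>

lemma spec_second_moment:
  assumes \<xi>: "\<bar>\<xi>\<bar> \<le> a"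
  shows "noise.expectation (\<lambda>y. (spec y \<xi> - (cmod (fourier f \<xi>))\<^sup>2)\<^sup>2) \<le> C_spec * (rate\<^sup>2 + wm + 1 / T)"
proof -
  let ?G = "\<lambda>k k'. Re (\<Sum>x\<in>I. of_real (w x) * (u k \<xi> x * cnj (u k' \<xi> x)))"
  let ?o = "\<lambda>y. \<Sum>(k, k')\<in>off. ?G k k' * (noise.\<eta> k y * noise.\<eta> k' y)"
  let ?r = "\<lambda>y. 3 * ((C_diag * rate)\<^sup>2 + B ^ 4 * (edge_mass y)\<^sup>2 + (?o y)\<^sup>2)"
  let ?g = "\<lambda>y. (spec y \<xi> - (cmod (fourier f \<xi>))\<^sup>2)\<^sup>2"
  have wm: "wm \<ge> 0" using w_nonneg[of 0] w_le[of 0] by simp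
  have AE: "AE y in M. ?g y \<le> ?r y"
    using noise.AE_Q_pos
  proof eventually_elim
    case (elim y)
    let ?D = "\<lambda>k. (\<Sum>x\<in>I. w x * (cmod (u k \<xi> x))\<^sup>2) - (cmod (fourier f \<xi>))\<^sup>2"
    have "(\<Sum>k\<in>K. (cmod (fourier f \<xi>))\<^sup>2 * (noise.\<eta> k y)\<^sup>2) = (cmod (fourier f \<xi>))\<^sup>2"
      using elim by (simp add: sum_distrib_left[symmetric] noise.sum_\<eta>_sq)
    then have eq: "spec y \<xi> - (cmod (fourier f \<xi>))\<^sup>2 = (\<Sum>k\<in>K. ?D k * (noise.\<eta> k y)\<^sup>2) + ?o y"
      unfolding spec_split left_diff_distrib sum_subtractf by simp
    have "\<bar>\<Sum>k\<in>K. ?D k * (noise.\<eta> k y)\<^sup>2\<bar> \<le> C_diag * rate + B\<^sup>2 * edge_mass y"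
    proof (rule weighted_edge_bound)
      show "\<bar>?D k\<bar> \<le> C_diag * rate" if "k \<in> K - edge" for k by (rule diag_approx[OF that \<xi>])
      show "C_diag * rate \<ge> 0" using C_diag_nonneg rate_nonneg by simp
      fix k assume k: "k \<in> K"
      have 1: "0 \<le> (\<Sum>x\<in>I. w x * (cmod (u k \<xi> x))\<^sup>2)" using w_nonneg by (intro sum_nonneg) auto
      have "(\<Sum>x\<in>I. w x * (cmod (u k \<xi> x))\<^sup>2) \<le> (\<Sum>x\<in>I. w x * B\<^sup>2)"
        using w_nonneg by (intro sum_mono mult_left_mono power_mono u_le k) auto
      then have 2: "(\<Sum>x\<in>I. w x * (cmod (u k \<xi> x))\<^sup>2) \<le> B\<^sup>2" by (simp add: sum_distrib_right[symmetric] w_sum)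
      have 3: "(cmod (fourier f \<xi>))\<^sup>2 \<le> B\<^sup>2" by (intro power_mono cmod_fourier_le_B) auto
      show "\<bar>?D k\<bar> \<le> B\<^sup>2" using 1 2 3 zero_le_power2[of "cmod (fourier f \<xi>)"] by linarith
    qed
    then have "\<bar>spec y \<xi> - (cmod (fourier f \<xi>))\<^sup>2\<bar> \<le> \<bar>C_diag * rate + B\<^sup>2 * edge_mass y + \<bar>?o y\<bar>\<bar>"
      unfolding eq by linarith
    then have "?g y \<le> (C_diag * rate + B\<^sup>2 * edge_mass y + \<bar>?o y\<bar>)\<^sup>2" by (simp add: abs_le_square_iff)
    also have "\<dots> \<le> 3 * ((C_diag * rate)\<^sup>2 + (B\<^sup>2 * edge_mass y)\<^sup>2 + \<bar>?o y\<bar>\<^sup>2)" by (rule sq_sum3_le)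
    finally show ?case by (simp add: power_mult_distrib power_mult[symmetric])
  qed
  have im: "integrable M (\<lambda>y. (edge_mass y)\<^sup>2)"
    using edge_mass_bounds by (intro noise.integrable_bounded[where c=1]) (auto simp: power_le_one)
  have io: "integrable M (\<lambda>y. (?o y)\<^sup>2)" by (rule integrable_off_sq)
  have ir: "integrable M ?r" using im io by auto
  have meas: "(\<lambda>y. spec y \<xi>) \<in> borel_measurable M"
    unfolding spec_def by measurable
  have int: "integrable M ?g"
    using meas AE by (intro Bochner_Integration.integrable_bound[OF ir]) (auto elim!: eventually_mono)
  have nq2: "(real n * real q)\<^sup>2 > 0" using n_pos q_pos by simp
  have edgeT: "((4 * real l + 1) / real n)\<^sup>2 \<le> 4 * width\<^sup>2 * (1 / T)"
  proof -
    have "((4 * real l + 1) / real n)\<^sup>2 \<le> (2 * width / T)\<^sup>2" using mesh_edge by (intro power_mono) auto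
    also have "\<dots> = 4 * width\<^sup>2 * ((1 / T) * (1 / T))" by (simp add: power2_eq_square)
    \<comment> \<open>One power of 1/T is given up to match the order of the edge mass.\<close>
    also have "\<dots> \<le> 4 * width\<^sup>2 * ((1 / T) * 1)"
      using T_ge T_pos by (intro mult_left_mono) auto
    finally show ?thesis by simp
  qed
  have off: "noise.expectation (\<lambda>y. (?o y)\<^sup>2) \<le> B ^ 4 * (260 * wm + 16 * width\<^sup>2 * (1 / T))"
  proof -
    let ?N = "real (card K) * (real (card K) - 1)"
    have "noise.expectation (\<lambda>y. (?o y)\<^sup>2) \<le> 2 / ?N * (\<Sum>(k, k')\<in>off. (?G k k')\<^sup>2)"
      by (rule noise.chaos_second_moment)
    also have "\<dots> \<le> 2 / (real n * real q)\<^sup>2 * (\<Sum>(k, k')\<in>off. (?G k k')\<^sup>2)"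
      using card_prod_bound mult_pos_pos[OF order.strict_trans2[OF nq2 card_prod_bound] nq2]
      by (intro mult_right_mono divide_left_mono sum_nonneg) auto
    also have "(\<Sum>(k, k')\<in>off. (?G k k')\<^sup>2) \<le> (\<Sum>(k, k')\<in>K \<times> K. (?G k k')\<^sup>2)"
      by (intro sum_mono2) (auto simp: finite_K)
    also have "\<dots> \<le> (\<Sum>(k, k')\<in>K \<times> K. (cmod (\<Sum>x\<in>I. of_real (w x) * (u k \<xi> x * cnj (u k' \<xi> x))))\<^sup>2)"
    proof -
      have "(Re z)\<^sup>2 \<le> (cmod z)\<^sup>2" for z by (simp add: cmod_power2)
      then show ?thesis unfolding case_prod_beta by (intro sum_mono)
    qed
    also have "\<dots> = (\<Sum>k\<in>K. \<Sum>k'\<in>K. (cmod (\<Sum>x\<in>I. of_real (w x) * (u k \<xi> x * cnj (u k' \<xi> x))))\<^sup>2)"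
      by (simp add: sum.cartesian_product)
    also have "\<dots> \<le> (real q)\<^sup>2 * B ^ 4 * (130 * (real n)\<^sup>2 * wm + 2 * (4 * real l + 1)\<^sup>2)"
      unfolding u_def by (rule sum_cross_sq_le[OF w_nonneg w_le w_sum m_le])
    finally have "noise.expectation (\<lambda>y. (?o y)\<^sup>2) \<le> 2 / (real n * real q)\<^sup>2 * ((real q)\<^sup>2 * B ^ 4 * (130 * (real n)\<^sup>2 * wm + 2 * (4 * real l + 1)\<^sup>2))"
      by (simp add: mult_left_mono divide_right_mono)
    \<comment> \<open>Here \<open>q\<close> cancels: the bound does not see the mesh of the
      noise.\<close>
    also have "\<dots> = B ^ 4 * (260 * wm + 4 * ((4 * real l + 1) / real n)\<^sup>2)"
      using n_pos q_pos by (simp add: field_simps power_mult_distrib power_divide)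
    also have "\<dots> \<le> B ^ 4 * (260 * wm + 4 * (4 * width\<^sup>2 * (1 / T)))"
      using edgeT by (intro mult_left_mono add_left_mono) auto
    finally show ?thesis by simp
  qed
  have "noise.expectation ?g \<le> noise.expectation ?r"
    by (rule integral_mono_AE[OF int ir AE])
  also have "\<dots> = 3 * ((C_diag * rate)\<^sup>2 + B ^ 4 * noise.expectation (\<lambda>y. (edge_mass y)\<^sup>2) + noise.expectation (\<lambda>y. (?o y)\<^sup>2))"
    using im io by (simp add: noise.prob_space)
  also have "\<dots> \<le> 3 * ((C_diag * rate)\<^sup>2 + B ^ 4 * (2 * width / T) + B ^ 4 * (260 * wm + 16 * width\<^sup>2 * (1 / T)))"
    by (intro mult_left_mono add_mono add_left_mono expectation_edge_mass_sq off) auto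
  also have "\<dots> = 3 * C_diag\<^sup>2 * rate\<^sup>2 + 3 * B ^ 4 * 260 * wm + 3 * B ^ 4 * (2 * width + 16 * width\<^sup>2) * (1 / T)"
    by (simp add: power_mult_distrib algebra_simps add_divide_distrib)
  also have "\<dots> \<le> C_spec * rate\<^sup>2 + C_spec * wm + C_spec * (1 / T)"
    using wm T_pos width_pos by (intro add_mono mult_right_mono) (auto simp: C_spec_def algebra_simps)
  also have "\<dots> = C_spec * (rate\<^sup>2 + wm + 1 / T)" by (simp add: algebra_simps)
  finally show ?thesis .
qed

end

section \<open>From numerator and denominator to the truncated risk\<close>

context compact_kernel
begin

definition C_ratio :: real where
  "C_ratio = 3 * ((2 * width * F)\<^sup>2 + (width * F\<^sup>2)\<^sup>2 * (6 * width))"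

definition C_risk :: real where
  "C_risk = (4 / energy\<^sup>2 + 16 * B ^ 4 / energy ^ 4) * C_ratio + 16 / energy\<^sup>2 * C_spec"

lemma C_ratio_nonneg: "C_ratio \<ge> 0" using width_pos by (simp add: C_ratio_def)

lemma continuous_fourier: "continuous_on UNIV (fourier f)"
proof (rule continuous_onI)
  fix x e :: real assume e: "e > 0"
  let ?c = "2 * L\<^sup>2 * F + 1"
  have c: "?c > 0" using F_nonneg by (simp add: add_nonneg_pos)
  show "\<exists>d>0. \<forall>x'\<in>UNIV. dist x' x < d \<longrightarrow> dist (fourier f x') (fourier f x) \<le> e"
  proof (intro exI[of _ "e / ?c"] conjI ballI impI)
    fix y assume d: "dist y x < e / ?c"
    have "dist (fourier f y) (fourier f x) \<le> 2 * L\<^sup>2 * F * \<bar>y - x\<bar>" using fourier_lipschitz[of y x] by (simp add: dist_norm)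
    also have "\<dots> \<le> ?c * \<bar>y - x\<bar>" by (intro mult_right_mono) auto
    also have "\<dots> \<le> e" using d c by (simp add: dist_real_def pos_less_divide_eq mult.commute)
    finally show "dist (fourier f y) (fourier f x) \<le> e" .
  qed (use e c in auto)
qed

lemma measurable_fourier [measurable]: "fourier f \<in> borel_measurable borel"
  by (rule borel_measurable_fourier) measurable

end

lemma set_integral_nonneg:
  fixes h :: "'a \<Rightarrow> real"
  assumes "\<And>x. x \<in> A \<Longrightarrow> 0 \<le> h x"
  shows "0 \<le> (LINT x:A|M. h x)"
  unfolding set_lebesgue_integral_def
  using assms by (intro Bochner_Integration.integral_nonneg) (auto simp: indicator_def)

text \<open>Write s/r - g/e as (s - g)/r - g (r - e)/(e r) and use r \<ge> e/2; the constants 8 come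
  from squaring the resulting factors 2 and splitting the square of a sum.\<close>

lemma quotient_error_le:
  fixes s r e g b :: real
  assumes e: "e > 0" and r: "\<bar>r - e\<bar> \<le> e / 2" and g: "0 \<le> g" "g \<le> b"
  shows "(s / r - g / e)\<^sup>2 \<le> 8 / e\<^sup>2 * (s - g)\<^sup>2 + 8 * b\<^sup>2 / e ^ 4 * (r - e)\<^sup>2"
proof -
  have r_ge: "r \<ge> e / 2" and r0: "r > 0" using r e by linarith+
  have "s / r - g / e = (s - g) / r - g * (r - e) / (e * r)"
    using e r0 by (simp add: field_simps)
  also have "\<bar>\<dots>\<bar> \<le> \<bar>(s - g) / r\<bar> + \<bar>g * (r - e) / (e * r)\<bar>" by (rule abs_triangle_ineq4)
  also have "\<bar>(s - g) / r\<bar> \<le> \<bar>s - g\<bar> / (e / 2)"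
    unfolding abs_divide using r_ge e r0 by (intro frac_le) auto
  also have "\<bar>g * (r - e) / (e * r)\<bar> \<le> b * \<bar>r - e\<bar> / (e * (e / 2))"
    unfolding abs_mult abs_divide using r_ge e r0 g by (intro frac_le mult_mono) auto
  finally have "\<bar>s / r - g / e\<bar> \<le> 2 / e * \<bar>s - g\<bar> + 2 * b / e\<^sup>2 * \<bar>r - e\<bar>"
    by (simp add: power2_eq_square mult_ac)
  then have "(s / r - g / e)\<^sup>2 \<le> (2 / e * \<bar>s - g\<bar> + 2 * b / e\<^sup>2 * \<bar>r - e\<bar>)\<^sup>2"
    by (subst abs_le_square_iff[symmetric]) linarith
  also have "\<dots> \<le> 2 * (2 / e * \<bar>s - g\<bar>)\<^sup>2 + 2 * (2 * b / e\<^sup>2 * \<bar>r - e\<bar>)\<^sup>2"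
  proof -
    have "(x + y)\<^sup>2 \<le> 2 * x\<^sup>2 + 2 * y\<^sup>2" for x y :: real
      using zero_le_power2[of "x - y"] by (simp add: power2_eq_square algebra_simps)
    then show ?thesis .
  qed
  also have "\<dots> = 8 / e\<^sup>2 * (s - g)\<^sup>2 + 8 * b\<^sup>2 / e ^ 4 * (r - e)\<^sup>2"
    by (simp add: power_mult_distrib power_divide power_mult[symmetric])
  finally show ?thesis .
qed

context noisy_grid
begin

lemma sum_path: "(\<Sum>j=1..n. complex_of_real (path y (real j * \<Delta>)) * exp (\<i> * of_real (real j * \<Delta>) * of_real \<xi>))
  = (\<Sum>k\<in>K. of_real (\<epsilon> k y) * c k \<xi>)"
  unfolding path_def c_def of_real_sum sum_distrib_right sum_distrib_left
  by (subst sum.swap) (simp add: mult_ac)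

lemma sum_path_sq: "(\<Sum>j=1..n. (path y (real j * \<Delta>))\<^sup>2) = (\<Sum>(k, k')\<in>K \<times> K. gram k k' * (\<epsilon> k y * \<epsilon> k' y))"
proof -
  have "(\<Sum>j=1..n. (path y (real j * \<Delta>))\<^sup>2)
     = (\<Sum>j=1..n. \<Sum>(k, k')\<in>K \<times> K. f (real j * \<Delta> - s k) * f (real j * \<Delta> - s k') * (\<epsilon> k y * \<epsilon> k' y))"
    by (simp add: path_def power2_eq_square sum_product sum.cartesian_product mult_ac)
  also have "\<dots> = (\<Sum>(k, k')\<in>K \<times> K. gram k k' * (\<epsilon> k y * \<epsilon> k' y))"
    unfolding case_prod_beta gram_def sum_distrib_right by (rule sum.swap)
  finally show ?thesis .
qed

lemma \<epsilon>_eq: "noise.Q y > 0 \<Longrightarrow> \<epsilon> k y = sqrt (noise.Q y) * noise.\<eta> k y"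
  by (simp add: noise.\<eta>_def)

text \<open>The periodogram is invariant under scaling of the path, so the noise may be divided by
  the root of its energy; this is where the heavy tails leave the argument.\<close>

lemma periodogram_path:
  assumes Q: "noise.Q y > 0"
  shows "\<Delta> * periodogram n \<Delta> (path y) \<xi> = (cmod (\<Sum>k\<in>K. of_real (noise.\<eta> k y) * (of_real \<Delta> * c k \<xi>)))\<^sup>2 / ratio y"
proof -
  let ?S = "\<Sum>k\<in>K. of_real (noise.\<eta> k y) * c k \<xi>"
  let ?R = "\<Sum>(k, k')\<in>K \<times> K. gram k k' * (noise.\<eta> k y * noise.\<eta> k' y)"
  have "(\<Sum>k\<in>K. of_real (\<epsilon> k y) * c k \<xi>) = of_real (sqrt (noise.Q y)) * ?S"
    unfolding \<epsilon>_eq[OF Q] sum_distrib_left by (simp add: mult_ac)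
  then have 1: "(cmod (\<Sum>k\<in>K. of_real (\<epsilon> k y) * c k \<xi>))\<^sup>2 = noise.Q y * (cmod ?S)\<^sup>2"
    using Q by (simp add: norm_mult power_mult_distrib)
  have sq: "sqrt (noise.Q y) * (sqrt (noise.Q y) * z) = noise.Q y * z" for z
    using Q by (simp add: mult.assoc[symmetric])
  have 2: "(\<Sum>(k, k')\<in>K \<times> K. gram k k' * (\<epsilon> k y * \<epsilon> k' y)) = noise.Q y * ?R"
    unfolding \<epsilon>_eq[OF Q] sum_distrib_left case_prod_beta
    by (intro sum.cong refl) (simp add: mult_ac sq)
  have 3: "ratio y = \<Delta> * ?R" unfolding ratio_def sum_distrib_left case_prod_beta by (simp add: mult_ac)
  have 4: "(\<Sum>k\<in>K. of_real (noise.\<eta> k y) * (of_real \<Delta> * c k \<xi>)) = of_real \<Delta> * ?S"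
    unfolding sum_distrib_left by (simp add: mult_ac)
  have "\<Delta> * periodogram n \<Delta> (path y) \<xi> = \<Delta> * (noise.Q y * (cmod ?S)\<^sup>2 / (noise.Q y * ?R))"
    unfolding periodogram_def sum_path sum_path_sq 1 2 ..
  also have "\<dots> = \<Delta>\<^sup>2 * (cmod ?S)\<^sup>2 / ratio y"
    using Q \<Delta>_pos by (simp add: 3 power2_eq_square)
  also have "\<Delta>\<^sup>2 * (cmod ?S)\<^sup>2 = (cmod (of_real \<Delta> * ?S))\<^sup>2"
    using \<Delta>_pos by (simp add: norm_mult power_mult_distrib)
  finally show ?thesis unfolding 4 .
qed

lemma continuous_c: "continuous_on A (c k)"
  unfolding c_def by (intro continuous_intros)

lemma measurable_c [measurable]: "c k \<in> borel_measurable borel"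
  by (rule borel_measurable_continuous_onI[OF continuous_c])

end

context smoothed_grid
begin

lemma smoothed_periodogram_path:
  assumes Q: "noise.Q y > 0"
  shows "\<Delta> * smoothed_periodogram n \<Delta> m w (path y) \<xi> = spec y \<xi> / ratio y"
proof -
  have "\<Delta> * smoothed_periodogram n \<Delta> m w (path y) \<xi> = (\<Sum>x\<in>I. w x * (\<Delta> * periodogram n \<Delta> (path y) (\<xi> + of_int x / T)))"
    by (simp add: smoothed_periodogram_def sum_distrib_left mult_ac)
  also have "\<dots> = spec y \<xi> / ratio y"
    unfolding periodogram_path[OF Q] spec_def u_def by (simp add: sum_divide_distrib)
  finally show ?thesis .
qed

lemma continuous_spec: "continuous_on A (spec y)"
  unfolding spec_def u_def
  by (intro continuous_intros continuous_on_compose2[OF continuous_c[of UNIV]]) (use T_pos in auto)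

text \<open>The upper bound is crude and grows with the grid; it is there for integrability.\<close>

lemma spec_bounds: "0 \<le> spec y \<xi>" "spec y \<xi> \<le> (real (card K) * B)\<^sup>2"
proof -
  show "0 \<le> spec y \<xi>" unfolding spec_def using w_nonneg by (intro sum_nonneg mult_nonneg_nonneg) auto
  have "cmod (\<Sum>k\<in>K. of_real (noise.\<eta> k y) * u k \<xi> x) \<le> (\<Sum>k\<in>K. 1 * B)" for x
  proof (rule sum_norm_le)
    fix k assume k: "k \<in> K"
    show "cmod (of_real (noise.\<eta> k y) * u k \<xi> x) \<le> 1 * B"
      unfolding norm_mult norm_of_real by (intro mult_mono noise.\<eta>_abs_le u_le k) auto
  qed
  then have "(cmod (\<Sum>k\<in>K. of_real (noise.\<eta> k y) * u k \<xi> x))\<^sup>2 \<le> (real (card K) * B)\<^sup>2" for x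
    by (intro power_mono) auto
  then have "spec y \<xi> \<le> (\<Sum>x\<in>I. w x * (real (card K) * B)\<^sup>2)"
    unfolding spec_def using w_nonneg by (intro sum_mono mult_left_mono) auto
  then show "spec y \<xi> \<le> (real (card K) * B)\<^sup>2" by (simp add: sum_distrib_right[symmetric] w_sum)
qed

text \<open>If \<open>ratio\<close> is off by more than half of \<open>energy\<close>, its squared
  deviation alone, suitably scaled, exceeds the truncation level 1. Otherwise
  \<open>quotient_error_le\<close> holds at every frequency. The factor a^2 is the prefactor
  \<open>a\<close> times the length 2 a of the interval.\<close>

lemma risk_le:
  assumes energy: "energy > 0"
  shows "noise.expectation (\<lambda>y. min 1 (a * (LINT \<xi>:{-a..a}|lborel.
      (\<Delta> * smoothed_periodogram n \<Delta> m w (path y) \<xi> - (cmod (fourier f \<xi>))\<^sup>2 / energy)\<^sup>2)))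
    \<le> C_risk * (1 + a\<^sup>2) * (rate\<^sup>2 + wm + 1 / T)"
proof -
  let ?g = "\<lambda>y \<xi>. (spec y \<xi> - (cmod (fourier f \<xi>))\<^sup>2)\<^sup>2"
  let ?h = "\<lambda>y \<xi>. (\<Delta> * smoothed_periodogram n \<Delta> m w (path y) \<xi> - (cmod (fourier f \<xi>))\<^sup>2 / energy)\<^sup>2"
  let ?Y = "\<lambda>y. LINT \<xi>:{-a..a}|lborel. ?g y \<xi>"
  \<comment> \<open>\<open>P\<close> and \<open>R\<close> weigh the errors of the denominator and of
    the numerator. The first summand of \<open>P\<close> pays for the bad event; in the second, 16
    is 8 times the 2 from the length of the interval.\<close>
  define P where "P = 4 / energy\<^sup>2 + 16 * B ^ 4 * a\<^sup>2 / energy ^ 4"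
  define R where "R = 8 * a / energy\<^sup>2"
  have wm: "wm \<ge> 0" using w_nonneg[of 0] w_le[of 0] by simp
  have P: "P \<ge> 0" and R: "R \<ge> 0" using a_nonneg by (auto simp: P_def R_def)
  have F2: "0 \<le> (cmod (fourier f \<xi>))\<^sup>2" "(cmod (fourier f \<xi>))\<^sup>2 \<le> B\<^sup>2" for \<xi>
    by (auto intro: power_mono cmod_fourier_le_B)
  have gb: "?g y \<xi> \<le> ((real (card K) * B)\<^sup>2 + B\<^sup>2)\<^sup>2" for y \<xi>
    using spec_bounds[of y \<xi>] F2[of \<xi>] by (subst abs_le_square_iff[symmetric]) linarith
  have meas: "(\<lambda>(y, \<xi>). ?g y \<xi>) \<in> borel_measurable (M \<Otimes>\<^sub>M lborel)"
    unfolding spec_def u_def by measurable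
  note Y = noise.expectation_set_integral_le[OF meas zero_le_power2 gb spec_second_moment a_nonneg]
  have ptw: "AE y in M. min 1 (a * (LINT \<xi>:{-a..a}|lborel. ?h y \<xi>)) \<le> P * (ratio y - energy)\<^sup>2 + R * ?Y y"
    using noise.AE_Q_pos
  proof eventually_elim
    case (elim y)
    let ?d = "ratio y - energy"
    have Y0: "0 \<le> ?Y y" by (rule set_integral_nonneg) auto
    show ?case
    proof (cases "\<bar>?d\<bar> \<le> energy / 2")
      case False
      then have "(energy / 2)\<^sup>2 \<le> ?d\<^sup>2" using energy by (subst abs_le_square_iff[symmetric]) auto
      then have "1 \<le> 4 / energy\<^sup>2 * ?d\<^sup>2" using energy by (simp add: power_divide field_simps)
      also have "\<dots> \<le> P * ?d\<^sup>2" using energy by (intro mult_right_mono) (auto simp: P_def)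
      also have "\<dots> \<le> P * ?d\<^sup>2 + R * ?Y y" using R Y0 by simp
      finally show ?thesis by simp
    next
      case True
      have h: "?h y \<xi> = (spec y \<xi> / ratio y - (cmod (fourier f \<xi>))\<^sup>2 / energy)\<^sup>2" for \<xi>
        unfolding smoothed_periodogram_path[OF elim] ..
      have cont: "continuous_on {-a..a} (\<lambda>\<xi>. ?g y \<xi>)" "continuous_on {-a..a} (\<lambda>\<xi>. ?h y \<xi>)"
        unfolding h using energy True
        by (intro continuous_intros continuous_spec continuous_on_subset[OF continuous_fourier]; force)+
      have "(LINT \<xi>:{-a..a}|lborel. ?h y \<xi>) \<le> (LINT \<xi>:{-a..a}|lborel. 8 / energy\<^sup>2 * ?g y \<xi> + 8 * (B\<^sup>2)\<^sup>2 / energy ^ 4 * ?d\<^sup>2)"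
        by (intro set_integral_mono borel_integrable_atLeastAtMost' continuous_intros cont)
          (unfold h, rule quotient_error_le[OF energy True F2])
      also have "\<dots> = 8 / energy\<^sup>2 * ?Y y + 8 * (B\<^sup>2)\<^sup>2 / energy ^ 4 * ?d\<^sup>2 * (2 * a)"
      proof -
        have 1: "set_integrable lborel {-a..a} (\<lambda>\<xi>. 8 / energy\<^sup>2 * ?g y \<xi>)"
          by (intro borel_integrable_atLeastAtMost' continuous_intros cont)
        have 2: "set_integrable lborel {-a..a} (\<lambda>\<xi>. v)" "(LINT \<xi>:{-a..a}|lborel. v) = v * (2 * a)" for v :: real
          using a_nonneg by (auto intro!: borel_integrable_atLeastAtMost' simp: set_lebesgue_integral_def)
        show ?thesis by (subst set_integral_add(2)[OF 1 2(1)]) (simp add: 2(2))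
      qed
      finally have "a * (LINT \<xi>:{-a..a}|lborel. ?h y \<xi>) \<le> a * (8 / energy\<^sup>2 * ?Y y + 8 * (B\<^sup>2)\<^sup>2 / energy ^ 4 * ?d\<^sup>2 * (2 * a))"
        using a_nonneg by (rule mult_left_mono)
      also have "\<dots> = R * ?Y y + 16 * B ^ 4 * a\<^sup>2 / energy ^ 4 * ?d\<^sup>2"
        by (simp add: R_def power2_eq_square power4_eq_xxxx distrib_left mult_ac)
      also have "\<dots> \<le> R * ?Y y + P * ?d\<^sup>2"
        by (intro add_left_mono mult_right_mono) (auto simp: P_def)
      finally show ?thesis by simp
    qed
  qed
  have d_le: "noise.expectation (\<lambda>y. (ratio y - energy)\<^sup>2) \<le> C_ratio * (rate\<^sup>2 + wm + 1 / T)"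
  proof -
    have "\<kappa>\<^sup>2 \<le> rate\<^sup>2" unfolding rate_def
      using \<kappa>_nonneg a_nonneg \<Delta>_pos second_moment_nonneg T_pos by (intro power_mono) auto
    have "3 * ((2 * width * F * \<kappa>)\<^sup>2 + (width * F\<^sup>2)\<^sup>2 * (6 * width / T))
      = 3 * (2 * width * F)\<^sup>2 * \<kappa>\<^sup>2 + 3 * ((width * F\<^sup>2)\<^sup>2 * (6 * width)) * (1 / T)"
      by (simp add: power_mult_distrib algebra_simps)
    also have "\<dots> \<le> C_ratio * rate\<^sup>2 + C_ratio * (1 / T)"
      using \<open>\<kappa>\<^sup>2 \<le> rate\<^sup>2\<close> T_pos width_pos by (intro add_mono mult_mono) (auto simp: C_ratio_def)
    also have "\<dots> \<le> C_ratio * (rate\<^sup>2 + wm + 1 / T)"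
      using wm C_ratio_nonneg by (simp add: distrib_left)
    finally show ?thesis using second_moment_ratio(2) by linarith
  qed
  have int: "integrable M (\<lambda>y. P * (ratio y - energy)\<^sup>2 + R * ?Y y)"
    using second_moment_ratio(1) Y(1) by auto
  have "noise.expectation (\<lambda>y. min 1 (a * (LINT \<xi>:{-a..a}|lborel. ?h y \<xi>))) \<le> noise.expectation (\<lambda>y. P * (ratio y - energy)\<^sup>2 + R * ?Y y)"
  proof (rule integral_mono_AE'[OF int ptw])
    show "AE y in M. 0 \<le> P * (ratio y - energy)\<^sup>2 + R * ?Y y"
      using P R by (intro AE_I2 add_nonneg_nonneg mult_nonneg_nonneg set_integral_nonneg) auto
  qed
  also have "\<dots> = P * noise.expectation (\<lambda>y. (ratio y - energy)\<^sup>2) + R * noise.expectation ?Y"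
    using second_moment_ratio(1) Y(1) by auto
  also have "\<dots> \<le> P * (C_ratio * (rate\<^sup>2 + wm + 1 / T)) + R * (2 * a * (C_spec * (rate\<^sup>2 + wm + 1 / T)))"
    by (intro add_mono mult_left_mono d_le Y(2) P R)
  also have "\<dots> = (P * C_ratio + 16 * a\<^sup>2 / energy\<^sup>2 * C_spec) * (rate\<^sup>2 + wm + 1 / T)"
    by (simp add: R_def power2_eq_square algebra_simps)
  also have "\<dots> \<le> C_risk * (1 + a\<^sup>2) * (rate\<^sup>2 + wm + 1 / T)"
  proof (rule mult_right_mono)
    have "P * C_ratio + 16 * a\<^sup>2 / energy\<^sup>2 * C_spec + (4 * a\<^sup>2 / energy\<^sup>2 * C_ratio + 16 * B ^ 4 / energy ^ 4 * C_ratio + 16 / energy\<^sup>2 * C_spec) = C_risk * (1 + a\<^sup>2)"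
      by (simp add: P_def C_risk_def algebra_simps add_divide_distrib)
    moreover have "4 * a\<^sup>2 / energy\<^sup>2 * C_ratio + 16 * B ^ 4 / energy ^ 4 * C_ratio + 16 / energy\<^sup>2 * C_spec \<ge> 0"
      using C_ratio_nonneg C_spec_nonneg by simp
    ultimately show "P * C_ratio + 16 * a\<^sup>2 / energy\<^sup>2 * C_spec \<le> C_risk * (1 + a\<^sup>2)" by linarith
  qed (use wm T_pos in auto)
  finally show ?thesis .
qed

end

subsection \<open>Stable laws\<close>


abbreviation "std_normal \<equiv> density lborel std_normal_density"

interpretation std_normal: prob_space std_normal
  by (rule prob_space_normal_density) simp

text \<open>A stable characteristic function with scale \<open>v\<close>, averaged over a centred
  Gaussian frequency with standard deviation \<open>k\<close>. It yields tail and small ball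
  estimates without a density of the stable law.\<close>

definition stable_smoothing :: "real \<Rightarrow> real \<Rightarrow> real \<Rightarrow> real" where
  "stable_smoothing \<alpha> v k = (LINT z|std_normal. exp (- (v * \<bar>k * z\<bar> powr \<alpha>)))"

lemma stable_smoothing_integrable:
  assumes "v \<ge> 0" shows "integrable std_normal (\<lambda>z. exp (- (v * \<bar>k * z\<bar> powr \<alpha>)))"
  using assms by (intro std_normal.integrable_const_bound[where B=1]) auto

text \<open>The Gaussian average over the frequency turns a characteristic function into the
  expectation of a bump function.\<close>

lemma (in prob_space) expectation_gaussian_bump:
  assumes [measurable]: "Y \<in> borel_measurable M"
    and char: "\<And>u. char (distr M borel Y) u = complex_of_real (exp (- (v * \<bar>u\<bar> powr \<alpha>)))"
  shows "expectation (\<lambda>x. exp (- ((k * Y x)\<^sup>2 / 2))) = stable_smoothing \<alpha> v k"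
proof -
  interpret P: pair_sigma_finite M std_normal ..
  interpret PP: pair_prob_space M std_normal ..
  have int: "integrable (M \<Otimes>\<^sub>M std_normal) (\<lambda>(x, z). iexp (k * Y x * z))"
    by (intro PP.integrable_const_bound[where B=1]) (auto simp: case_prod_beta)
  have "complex_of_real (expectation (\<lambda>x. exp (- ((k * Y x)\<^sup>2 / 2)))) = (CLINT x|M. char std_normal (k * Y x))"
    unfolding char_std_normal_distribution by simp
  also have "\<dots> = (CLINT x|M. CLINT z|std_normal. iexp (k * Y x * z))"
    by (simp add: char_def)
  also have "\<dots> = (CLINT z|std_normal. CLINT x|M. iexp (k * Y x * z))"
    using P.Fubini_integral[OF int] by simp
  also have "\<dots> = (CLINT z|std_normal. char (distr M borel Y) (k * z))"
    unfolding char_def by (intro Bochner_Integration.integral_cong refl) (subst integral_distr; simp add: mult_ac)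
  also have "\<dots> = complex_of_real (stable_smoothing \<alpha> v k)"
    unfolding char stable_smoothing_def by simp
  finally show ?thesis by (simp only: of_real_eq_iff)
qed

lemma abs_powr_le: assumes "0 < \<alpha>" "\<alpha> < 2" shows "\<bar>z::real\<bar> powr \<alpha> \<le> 1 + z\<^sup>2"
proof (cases "\<bar>z\<bar> \<le> 1")
  case True
  then have "\<bar>z\<bar> powr \<alpha> \<le> 1" using assms powr_mono2[of \<alpha> "\<bar>z\<bar>" 1] by simp
  then show ?thesis by (simp add: add_increasing2)
next
  case False
  then have "\<bar>z\<bar> powr \<alpha> \<le> \<bar>z\<bar> powr 2" using assms by (intro powr_mono) auto
  then show ?thesis using False by (simp add: powr_numeral)
qed

text \<open>Combines 1 - exp(-x) \<le> x with \<open>abs_powr_le\<close>; the factor 2 is the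
  Gaussian mean of 1 + z^2.\<close>

lemma stable_smoothing_ge:
  assumes \<alpha>: "0 < \<alpha>" "\<alpha> < 2" and v: "v \<ge> 0" and k: "k \<ge> 0"
  shows "1 - stable_smoothing \<alpha> v k \<le> 2 * v * k powr \<alpha>"
proof -
  have m2: "integrable std_normal (\<lambda>z. z ^ 2)" "(LINT z|std_normal. z ^ 2) = 1"
    using std_normal_distribution_even_moments[of 1] by auto
  have "1 - stable_smoothing \<alpha> v k = (LINT z|std_normal. 1 - exp (- (v * \<bar>k * z\<bar> powr \<alpha>)))"
    unfolding stable_smoothing_def
    using std_normal.prob_space
    by (subst Bochner_Integration.integral_diff) (auto simp: stable_smoothing_integrable v)
  also have "\<dots> \<le> (LINT z|std_normal. v * k powr \<alpha> * (1 + z\<^sup>2))"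
  proof (rule integral_mono)
    show "integrable std_normal (\<lambda>z. 1 - exp (- (v * \<bar>k * z\<bar> powr \<alpha>)))"
      by (intro Bochner_Integration.integrable_diff stable_smoothing_integrable v) auto
    show "integrable std_normal (\<lambda>z. v * k powr \<alpha> * (1 + z\<^sup>2))"
      using m2 by auto
    fix z
    have "1 - exp (- (v * \<bar>k * z\<bar> powr \<alpha>)) \<le> v * \<bar>k * z\<bar> powr \<alpha>"
      using exp_ge_add_one_self[of "- (v * \<bar>k * z\<bar> powr \<alpha>)"] by linarith
    also have "\<dots> = v * k powr \<alpha> * \<bar>z\<bar> powr \<alpha>" using k by (simp add: abs_mult powr_mult)
    also have "\<dots> \<le> v * k powr \<alpha> * (1 + z\<^sup>2)"
      using v by (intro mult_left_mono abs_powr_le \<alpha>) auto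
    finally show "1 - exp (- (v * \<bar>k * z\<bar> powr \<alpha>)) \<le> v * k powr \<alpha> * (1 + z\<^sup>2)" .
  qed
  also have "\<dots> = 2 * v * k powr \<alpha>"
    using m2 std_normal.prob_space by simp
  finally show ?thesis .
qed

text \<open>With k = 2/e the bump is at most 1/2 outside [-e, e], so the indicator of the tail is
  below twice its deficit from 1.\<close>

lemma (in prob_space) stable_tail_le:
  assumes Y [measurable]: "Y \<in> borel_measurable M"
    and char: "\<And>u. char (distr M borel Y) u = complex_of_real (exp (- (v * \<bar>u\<bar> powr \<alpha>)))"
    and \<alpha>: "0 < \<alpha>" "\<alpha> < 2" and v: "v \<ge> 0" and e: "e > 0"
  shows "prob {x \<in> space M. \<bar>Y x\<bar> > e} \<le> 4 * v * (2 / e) powr \<alpha>"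
proof -
  let ?b = "\<lambda>x. exp (- ((2 / e * Y x)\<^sup>2 / 2))"
  have ib: "integrable M ?b" by (intro integrable_const_bound[where B=1]) auto
  have "prob {x \<in> space M. \<bar>Y x\<bar> > e} = expectation (indicator {x \<in> space M. \<bar>Y x\<bar> > e})"
    by simp
  also have "\<dots> \<le> expectation (\<lambda>x. 2 * (1 - ?b x))"
  proof (rule integral_mono)
    show "integrable M (\<lambda>x. 2 * (1 - ?b x))" using ib by auto
    fix x
    show "indicator {x \<in> space M. \<bar>Y x\<bar> > e} x \<le> 2 * (1 - ?b x)"
    proof (cases "\<bar>Y x\<bar> > e")
      case True
      then have "2 \<le> \<bar>2 / e * Y x\<bar>" using e by (simp add: abs_mult field_simps)
      then have "2\<^sup>2 \<le> (2 / e * Y x)\<^sup>2" using abs_le_square_iff[of 2 "2 / e * Y x"] by simp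
      then have "1 + 1 \<le> exp ((2 / e * Y x)\<^sup>2 / 2)"
        by (intro order_trans[OF _ exp_ge_add_one_self_aux]) auto
      then have "?b x \<le> 1 / 2" by (simp add: exp_minus field_simps)
      then show ?thesis by (simp add: indicator_def)
    qed (simp add: indicator_def)
  qed (auto intro!: integrable_real_indicator simp: less_top[symmetric])
  also have "\<dots> = 2 * (1 - stable_smoothing \<alpha> v (2 / e))"
    using ib expectation_gaussian_bump[OF Y char, of "2 / e"] by (simp add: prob_space)
  also have "\<dots> \<le> 2 * (2 * v * (2 / e) powr \<alpha>)"
    using e by (intro mult_left_mono stable_smoothing_ge \<alpha> v) auto
  finally show ?thesis by simp
qed

text \<open>With k = 1/e the bump is at least exp(-1/2) \<ge> 1/2 on [-e, e].\<close>

lemma (in prob_space) stable_small_ball_le: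
  assumes Y [measurable]: "Y \<in> borel_measurable M"
    and char: "\<And>u. char (distr M borel Y) u = complex_of_real (exp (- (v * \<bar>u\<bar> powr \<alpha>)))"
    and e: "e > 0"
  shows "prob {x \<in> space M. \<bar>Y x\<bar> \<le> e} \<le> 2 * stable_smoothing \<alpha> v (1 / e)"
proof -
  let ?b = "\<lambda>x. exp (- ((1 / e * Y x)\<^sup>2 / 2))"
  have ib: "integrable M ?b" by (intro integrable_const_bound[where B=1]) auto
  have half: "exp (- (1 / 2) :: real) \<ge> 1 / 2" using exp_ge_add_one_self[of "- (1 / 2) :: real"] by simp
  have "prob {x \<in> space M. \<bar>Y x\<bar> \<le> e} = expectation (indicator {x \<in> space M. \<bar>Y x\<bar> \<le> e})"
    by simp
  also have "\<dots> \<le> expectation (\<lambda>x. 2 * ?b x)"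
  proof (rule integral_mono)
    show "integrable M (\<lambda>x. 2 * ?b x)" using ib by auto
    fix x
    show "indicator {x \<in> space M. \<bar>Y x\<bar> \<le> e} x \<le> 2 * ?b x"
    proof (cases "\<bar>Y x\<bar> \<le> e")
      case True
      then have "\<bar>1 / e * Y x\<bar> \<le> 1" using e by (simp add: abs_mult field_simps)
      then have "(1 / e * Y x)\<^sup>2 \<le> 1\<^sup>2" using abs_le_square_iff[of "1 / e * Y x" 1] by simp
      then have "exp (- (1 / 2)) \<le> ?b x" by simp
      then have "1 \<le> 2 * ?b x" using half by linarith
      then show ?thesis by (simp add: indicator_def)
    qed (simp add: indicator_def)
  qed (auto intro!: integrable_real_indicator simp: less_top[symmetric])
  also have "\<dots> = 2 * stable_smoothing \<alpha> v (1 / e)"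
    using ib expectation_gaussian_bump[OF Y char, of "1 / e"] by simp
  finally show ?thesis .
qed

lemma stable_smoothing_antimono:
  assumes "0 \<le> v" "v \<le> v'" shows "stable_smoothing \<alpha> v' k \<le> stable_smoothing \<alpha> v k"
  unfolding stable_smoothing_def using assms
  by (intro integral_mono stable_smoothing_integrable) (auto intro: mult_right_mono)

lemma filterlim_powr_at_top:
  assumes "(\<alpha>::real) > 0" shows "filterlim (\<lambda>x. x powr \<alpha>) at_top at_top"
proof -
  have "filterlim (\<lambda>x::real. exp (\<alpha> * ln x)) at_top at_top"
    using assms by (intro filterlim_compose[OF exp_at_top] filterlim_tendsto_pos_mult_at_top[OF tendsto_const] ln_at_top)
  then show ?thesis
    by (rule filterlim_cong[OF refl refl, THEN iffD1, rotated])
      (auto simp: powr_def intro!: eventually_mono[OF eventually_gt_at_top[of 0]])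
qed

text \<open>Together with the small ball estimate this excludes an atom at zero when the scale is
  positive.\<close>

lemma stable_smoothing_tendsto_0:
  assumes v: "v > 0" and \<alpha>: "\<alpha> > 0"
  shows "(\<lambda>i. stable_smoothing \<alpha> v (real (Suc i))) \<longlonglongrightarrow> 0"
proof -
  have "(\<lambda>i. LINT z|std_normal. exp (- (v * \<bar>real (Suc i) * z\<bar> powr \<alpha>))) \<longlonglongrightarrow> (LINT z|std_normal. 0)"
  proof (rule integral_dominated_convergence[where w="\<lambda>_. 1"])
    have "AE z in lborel. z \<noteq> (0::real)" by (rule AE_lborel_singleton)
    then have "AE z in std_normal. z \<noteq> 0" by (subst AE_density) auto
    then show "AE z in std_normal. (\<lambda>i. exp (- (v * \<bar>real (Suc i) * z\<bar> powr \<alpha>))) \<longlonglongrightarrow> 0"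
    proof eventually_elim
      case (elim z)
      have "filterlim (\<lambda>i. real (Suc i) * \<bar>z\<bar>) at_top sequentially"
        using elim by (intro filterlim_at_top_mult_tendsto_pos[OF tendsto_const]
            filterlim_compose[OF filterlim_real_sequentially filterlim_Suc]) auto
      then have "filterlim (\<lambda>i. (real (Suc i) * \<bar>z\<bar>) powr \<alpha>) at_top sequentially"
        by (rule filterlim_compose[OF filterlim_powr_at_top[OF \<alpha>]])
      then have "filterlim (\<lambda>i. v * \<bar>real (Suc i) * z\<bar> powr \<alpha>) at_top sequentially"
        using v by (intro filterlim_tendsto_pos_mult_at_top[OF tendsto_const]) (auto simp: abs_mult)
      then show ?case
        by (intro filterlim_compose[OF exp_at_bot]) (simp add: filterlim_uminus_at_bot)
    qed
  qed (use v in auto)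
  then show ?thesis unfolding stable_smoothing_def by simp
qed

subsection \<open>Stable integrals\<close>


lemma (in prob_space) indep_vars_reindex_inj:
  assumes "indep_vars (\<lambda>_. N) X I" and "inj_on g K" "g ` K \<subseteq> I"
  shows "indep_vars (\<lambda>_. N) (\<lambda>k. X (g k)) K"
proof -
  \<comment> \<open>Reindexing is a grouping of the family into blocks with one member each,
    disjoint because \<open>g\<close> is injective.\<close>
  have "indep_vars (\<lambda>k. PiM {g k} (\<lambda>_. N)) (\<lambda>k x. restrict (\<lambda>i. X i x) {g k}) K"
    using assms by (intro indep_vars_restrict[OF assms(1)]) (auto simp: disjoint_family_on_def inj_on_def)
  then have "indep_vars (\<lambda>_. N) (\<lambda>k x. (restrict (\<lambda>i. X i x) {g k}) (g k)) K"
    by (rule indep_vars_compose2) auto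
  then show ?thesis by simp
qed

text \<open>For \<alpha> < 1 Minkowski's inequality fails; bounding the sum by twice the larger term
  gives a quasi-triangle inequality for all positive exponents.\<close>

lemma abs_add_powr_le:
  assumes "0 < \<alpha>" shows "\<bar>x + y::real\<bar> powr \<alpha> \<le> 2 powr \<alpha> * (\<bar>x\<bar> powr \<alpha> + \<bar>y\<bar> powr \<alpha>)"
proof -
  have "\<bar>x + y\<bar> powr \<alpha> \<le> (2 * max \<bar>x\<bar> \<bar>y\<bar>) powr \<alpha>" using assms by (intro powr_mono2) auto
  also have "\<dots> = 2 powr \<alpha> * max \<bar>x\<bar> \<bar>y\<bar> powr \<alpha>" by (simp add: powr_mult)
  also have "\<dots> \<le> 2 powr \<alpha> * (\<bar>x\<bar> powr \<alpha> + \<bar>y\<bar> powr \<alpha>)"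
    by (intro mult_left_mono) (auto simp: max_def)
  finally show ?thesis .
qed

context sas_random_measure
begin

text \<open>The axioms on the random measure speak about sequences, so a finite family is numbered
  and continued by empty sets.\<close>

lemma enumerate_family:
  fixes A :: "'k \<Rightarrow> real set"
  assumes "finite K" "\<And>k. k \<in> K \<Longrightarrow> A k \<in> sets borel" "\<And>k. k \<in> K \<Longrightarrow> bounded (A k)" "disjoint_family_on A K"
  obtains h :: "nat \<Rightarrow> 'k" and A' :: "nat \<Rightarrow> real set"
  where "bij_betw h {..<card K} K" "\<And>i. i < card K \<Longrightarrow> A' i = A (h i)" "\<And>i. i \<ge> card K \<Longrightarrow> A' i = {}"
    "\<And>i. A' i \<in> sets borel" "\<And>i. bounded (A' i)" "disjoint_family A'"
proof -
  obtain h where h: "bij_betw h {..<card K} K"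
    using ex_bij_betw_nat_finite[OF assms(1)] by (auto simp: atLeast0LessThan)
  define A' where "A' i = (if i < card K then A (h i) else {})" for i
  have hK: "h i \<in> K" if "i < card K" for i using h that by (auto simp: bij_betw_def)
  have "disjoint_family A'"
    using assms(4) h hK unfolding disjoint_family_on_def A'_def bij_betw_def inj_on_def by (auto, blast)
  then show ?thesis
    using that[OF h, of A'] assms hK by (auto simp: A'_def)
qed

lemma indep_finite:
  fixes A :: "'k \<Rightarrow> real set"
  assumes "finite K" "\<And>k. k \<in> K \<Longrightarrow> A k \<in> sets borel" "\<And>k. k \<in> K \<Longrightarrow> bounded (A k)" "disjoint_family_on A K"
  shows "indep_vars (\<lambda>_. borel) (\<lambda>k. \<Lambda> (A k)) K"
proof -
  obtain h A' where h: "bij_betw h {..<card K} K" and A': "\<And>i. i < card K \<Longrightarrow> A' i = A (h i)"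
      "\<And>i. A' i \<in> sets borel" "\<And>i. bounded (A' i)" "disjoint_family A'"
    using enumerate_family[OF assms] by metis
  define g where "g = inv_into {..<card K} h"
  have g: "bij_betw g K {..<card K}" unfolding g_def by (rule bij_betw_inv_into[OF h])
  have Ag: "A' (g k) = A k" if "k \<in> K" for k
  proof -
    have "g k < card K" using g that by (auto simp: bij_betw_def)
    moreover have "h (g k) = k" using h that by (simp add: g_def bij_betw_inv_into_right)
    ultimately show ?thesis using A'(1) by simp
  qed
  have "indep_vars (\<lambda>_. borel) (\<lambda>i. \<Lambda> (A' i)) UNIV" by (rule indep_values[OF A'(2-4)])
  then have "indep_vars (\<lambda>_. borel) (\<lambda>k. \<Lambda> (A' (g k))) K"
    by (rule indep_vars_reindex_inj) (use g in \<open>auto simp: bij_betw_def\<close>)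
  then show ?thesis by (rule indep_vars_cong[THEN iffD1, rotated -1]) (auto simp: Ag)
qed

text \<open>Countable additivity for a sequence of empty sets makes a constant series converge, and
  its terms must tend to zero.\<close>

lemma AE_empty: "AE x in M. \<Lambda> {} x = 0"
proof -
  have "AE x in M. (\<lambda>i::nat. \<Lambda> {} x) sums \<Lambda> (\<Union>i::nat. {}) x"
    by (rule countably_additive) (auto simp: disjoint_family_on_def)
  then show ?thesis
  proof eventually_elim
    case (elim x)
    then have "(\<lambda>i::nat. \<Lambda> {} x) \<longlonglongrightarrow> 0" by (intro summable_LIMSEQ_zero sums_summable)
    then show ?case by (simp add: LIMSEQ_const_iff)
  qed
qed

lemma AE_finitely_additive:
  fixes A :: "'k \<Rightarrow> real set"
  assumes "finite K" "\<And>k. k \<in> K \<Longrightarrow> A k \<in> sets borel" "\<And>k. k \<in> K \<Longrightarrow> bounded (A k)" "disjoint_family_on A K"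
  shows "AE x in M. \<Lambda> (\<Union>k\<in>K. A k) x = (\<Sum>k\<in>K. \<Lambda> (A k) x)"
proof -
  obtain h A' where h: "bij_betw h {..<card K} K" and A': "\<And>i. i < card K \<Longrightarrow> A' i = A (h i)"
      "\<And>i. i \<ge> card K \<Longrightarrow> A' i = {}" "\<And>i. A' i \<in> sets borel" "\<And>i. bounded (A' i)" "disjoint_family A'"
    using enumerate_family[OF assms] by metis
  have U: "(\<Union>i. A' i) = (\<Union>k\<in>K. A k)"
  proof -
    have "(\<Union>i. A' i) = (\<Union>i\<in>{..<card K}. A (h i))"
    proof (rule set_eqI)
      fix s
      have "(\<exists>i. s \<in> A' i) \<longleftrightarrow> (\<exists>i<card K. s \<in> A (h i))"
        by (metis A'(1) A'(2) empty_iff not_less)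
      then show "s \<in> (\<Union>i. A' i) \<longleftrightarrow> s \<in> (\<Union>i\<in>{..<card K}. A (h i))" by auto
    qed
    also have "\<dots> = (\<Union>k\<in>h ` {..<card K}. A k)" by simp
    also have "h ` {..<card K} = K" using h by (simp add: bij_betw_def)
    finally show ?thesis .
  qed
  have "bounded (\<Union>i. A' i)" unfolding U using assms by (intro bounded_UN) auto
  then have "AE x in M. (\<lambda>i. \<Lambda> (A' i) x) sums \<Lambda> (\<Union>i. A' i) x"
    by (rule countably_additive[OF A'(3) _ A'(5)])
  then show ?thesis using AE_empty
  proof eventually_elim
    case (elim x)
    have "(\<lambda>i. \<Lambda> (A' i) x) sums (\<Sum>i<card K. \<Lambda> (A' i) x)"
      using A'(2) elim(2) by (intro sums_finite) (auto simp: not_less)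
    then have "\<Lambda> (\<Union>i. A' i) x = (\<Sum>i<card K. \<Lambda> (A' i) x)"
      using elim(1) by (metis sums_unique2)
    also have "\<dots> = (\<Sum>i<card K. \<Lambda> (A (h i)) x)" using A'(1) by simp
    also have "\<dots> = (\<Sum>k\<in>K. \<Lambda> (A k) x)" by (rule sum.reindex_bij_betw[OF h])
    finally show ?case by (simp add: U)
  qed
qed

lemma char_simple_disjoint:
  fixes A :: "'k \<Rightarrow> real set"
  assumes "finite K" "\<And>k. k \<in> K \<Longrightarrow> A k \<in> sets borel" "\<And>k. k \<in> K \<Longrightarrow> bounded (A k)" "disjoint_family_on A K"
  shows "char (distr M borel (\<lambda>x. \<Sum>k\<in>K. c k * \<Lambda> (A k) x)) v
    = complex_of_real (exp (- ((\<Sum>k\<in>K. \<bar>c k\<bar> powr \<alpha> * measure lborel (A k)) * \<bar>v\<bar> powr \<alpha>)))"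
proof -
  have rv: "k \<in> K \<Longrightarrow> random_variable borel (\<Lambda> (A k))" for k
    using random_variable_values assms by auto
  have "indep_vars (\<lambda>_. borel) (\<lambda>k x. c k * \<Lambda> (A k) x) K"
    by (rule indep_vars_compose2[OF indep_finite[OF assms]]) auto
  then have "char (distr M borel (\<lambda>x. \<Sum>k\<in>K. c k * \<Lambda> (A k) x)) v
     = (\<Prod>k\<in>K. char (distr M borel (\<lambda>x. c k * \<Lambda> (A k) x)) v)"
    by (rule char_distr_sum)
  also have "\<dots> = (\<Prod>k\<in>K. complex_of_real (exp (- (\<bar>c k\<bar> powr \<alpha> * measure lborel (A k) * \<bar>v\<bar> powr \<alpha>))))"
  proof (rule prod.cong[OF refl])
    fix k assume k: "k \<in> K"
    have "char (distr M borel (\<lambda>x. c k * \<Lambda> (A k) x)) v = char (distr M borel (\<Lambda> (A k))) (v * c k)"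
      unfolding char_def using rv[OF k] by (simp add: integral_distr mult_ac)
    also have "\<dots> = complex_of_real (exp (- (measure lborel (A k) * \<bar>v * c k\<bar> powr \<alpha>)))"
      using char_values assms k by auto
    finally show "char (distr M borel (\<lambda>x. c k * \<Lambda> (A k) x)) v = complex_of_real (exp (- (\<bar>c k\<bar> powr \<alpha> * measure lborel (A k) * \<bar>v\<bar> powr \<alpha>)))"
      by (simp add: abs_mult powr_mult mult_ac)
  qed
  also have "\<dots> = complex_of_real (exp (\<Sum>k\<in>K. - (\<bar>c k\<bar> powr \<alpha> * measure lborel (A k) * \<bar>v\<bar> powr \<alpha>)))"
    by (simp add: exp_sum assms(1))
  finally show ?thesis by (simp add: sum_negf sum_distrib_right)
qed

text \<open>Overlapping sets are decomposed into the atoms of the algebra they generate.\<close>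

lemma char_simple:
  fixes A :: "'k \<Rightarrow> real set"
  assumes fin: "finite K" and A: "\<And>k. k \<in> K \<Longrightarrow> A k \<in> sets borel" "\<And>k. k \<in> K \<Longrightarrow> bounded (A k)"
  shows "char (distr M borel (\<lambda>x. \<Sum>k\<in>K. c k * \<Lambda> (A k) x)) v
    = complex_of_real (exp (- ((LINT s|lborel. \<bar>\<Sum>k\<in>K. c k * indicator (A k) s\<bar> powr \<alpha>) * \<bar>v\<bar> powr \<alpha>)))"
    and "integrable lborel (\<lambda>s. \<bar>\<Sum>k\<in>K. c k * indicator (A k) s\<bar> powr \<alpha>)"
proof -
  define P where "P = Pow K - {{}}"
  \<comment> \<open>The points that lie in exactly those \<open>A k\<close> with k in
    \<open>S\<close>; the empty \<open>S\<close> is left out because its atom would be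
    unbounded.\<close>
  define atom where "atom S = (\<Inter>k\<in>S. A k) - (\<Union>k\<in>K - S. A k)" for S
  have finP: "finite P" using fin by (simp add: P_def)
  have atom_iff: "s \<in> atom S \<longleftrightarrow> {k \<in> K. s \<in> A k} = S" if "S \<in> P" for s S
    using that by (auto simp: atom_def P_def)
  have meas: "atom S \<in> sets borel" if "S \<in> P" for S
  proof -
    have "finite S" "S \<noteq> {}" "S \<subseteq> K" using that fin by (auto simp: P_def intro: finite_subset)
    then show ?thesis unfolding atom_def using A(1) fin by (intro sets.Diff sets.finite_INT sets.finite_UN) auto
  qed
  have bdd: "bounded (atom S)" if "S \<in> P" for S
  proof -
    have "S \<noteq> {}" "S \<subseteq> K" using that by (auto simp: P_def)
    then obtain k where k: "k \<in> S" "k \<in> K" by blast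
    show ?thesis by (rule bounded_subset[OF A(2)[OF k(2)]]) (use k in \<open>auto simp: atom_def\<close>)
  qed
  have disj: "disjoint_family_on atom P"
    by (auto simp: disjoint_family_on_def atom_iff)
  have union: "A k = (\<Union>S\<in>{S \<in> P. k \<in> S}. atom S)" if k: "k \<in> K" for k
  proof (rule set_eqI)
    fix s
    show "s \<in> A k \<longleftrightarrow> s \<in> (\<Union>S\<in>{S \<in> P. k \<in> S}. atom S)"
      using k by (auto simp: atom_iff intro!: bexI[of _ "{k \<in> K. s \<in> A k}"]) (auto simp: P_def)
  qed
  let ?d = "\<lambda>S. \<Sum>k\<in>S. c k"
  have swap: "(\<Sum>k\<in>K. c k * (\<Sum>S\<in>{S \<in> P. k \<in> S}. g S)) = (\<Sum>S\<in>P. ?d S * g S)" for g :: "'k set \<Rightarrow> real"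
  proof -
    have "(\<Sum>k\<in>K. c k * (\<Sum>S\<in>{S \<in> P. k \<in> S}. g S)) = (\<Sum>k\<in>K. \<Sum>S\<in>P. if k \<in> S then c k * g S else 0)"
      by (intro sum.cong refl) (auto simp: sum_distrib_left sum.inter_filter[OF finP] intro!: sum.cong)
    also have "\<dots> = (\<Sum>S\<in>P. \<Sum>k\<in>K. if k \<in> S then c k * g S else 0)" by (rule sum.swap)
    also have "\<dots> = (\<Sum>S\<in>P. \<Sum>k\<in>S. c k * g S)"
    proof (rule sum.cong[OF refl])
      fix S assume "S \<in> P"
      then have "S \<subseteq> K" by (simp add: P_def)
      then show "(\<Sum>k\<in>K. if k \<in> S then c k * g S else 0) = (\<Sum>k\<in>S. c k * g S)"
        using fin by (intro sum.mono_neutral_cong_right) auto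
    qed
    finally show ?thesis by (simp add: sum_distrib_right)
  qed
  have "AE x in M. \<forall>k\<in>K. \<Lambda> (A k) x = (\<Sum>S\<in>{S \<in> P. k \<in> S}. \<Lambda> (atom S) x)"
  proof (rule AE_finite_allI[OF fin])
    fix k assume k: "k \<in> K"
    have "AE x in M. \<Lambda> (\<Union>S\<in>{S \<in> P. k \<in> S}. atom S) x = (\<Sum>S\<in>{S \<in> P. k \<in> S}. \<Lambda> (atom S) x)"
      using finP meas bdd disj by (intro AE_finitely_additive) (auto intro: disjoint_family_on_mono)
    then show "AE x in M. \<Lambda> (A k) x = (\<Sum>S\<in>{S \<in> P. k \<in> S}. \<Lambda> (atom S) x)"
      using union[OF k] by simp
  qed
  then have AE: "AE x in M. (\<Sum>k\<in>K. c k * \<Lambda> (A k) x) = (\<Sum>S\<in>P. ?d S * \<Lambda> (atom S) x)"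
    by eventually_elim (simp add: swap[symmetric])
  have ind: "(\<Sum>k\<in>K. c k * indicator (A k) s) = (\<Sum>S\<in>P. ?d S * indicator (atom S) s)" for s
  proof -
    have "(indicator (A k) s :: real) = (\<Sum>S\<in>{S \<in> P. k \<in> S}. indicator (atom S) s)" if k: "k \<in> K" for k
    proof -
      have "(\<Sum>S\<in>{S \<in> P. k \<in> S}. indicator (atom S) s :: real) = indicator (\<Union>S\<in>{S \<in> P. k \<in> S}. atom S) s"
        using finP disj by (intro indicator_UN_disjoint[symmetric]) (auto intro: disjoint_family_on_mono)
      then show ?thesis using union[OF k] by simp
    qed
    then show ?thesis by (simp add: swap[symmetric])
  qed
  \<comment> \<open>A point lies in at most one atom, so the power may be applied term by
    term.\<close>
  have pow: "\<bar>\<Sum>k\<in>K. c k * indicator (A k) s\<bar> powr \<alpha> = (\<Sum>S\<in>P. \<bar>?d S\<bar> powr \<alpha> * indicator (atom S) s)" for s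
  proof (cases "\<exists>S\<in>P. s \<in> atom S")
    case True
    then obtain S where S: "S \<in> P" "s \<in> atom S" by auto
    have one: "(indicator (atom S') s :: real) = (if S' = S then 1 else 0)" if "S' \<in> P" for S'
      using S that by (auto simp: atom_iff indicator_def)
    have "(\<Sum>S'\<in>P. g S' * indicator (atom S') s) = g S" for g :: "'k set \<Rightarrow> real"
    proof -
      have "(\<Sum>S'\<in>P. g S' * indicator (atom S') s) = (\<Sum>S'\<in>P. if S' = S then g S else 0)"
        by (intro sum.cong refl) (simp add: one)
      then show ?thesis using finP S by simp
    qed
    then show ?thesis unfolding ind by simp
  next
    case False
    then show ?thesis unfolding ind by (simp add: indicator_def)
  qed
  have fin_em: "emeasure lborel (atom S) < \<infinity>" if "S \<in> P" for S
    using emeasure_bounded_finite[OF bdd[OF that]] by (simp add: less_top)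
  have int: "integrable lborel (\<lambda>s. \<bar>?d S\<bar> powr \<alpha> * indicator (atom S) s)" if "S \<in> P" for S
    using meas[OF that] fin_em[OF that] by (intro integrable_mult_right integrable_real_indicator) auto
  show "integrable lborel (\<lambda>s. \<bar>\<Sum>k\<in>K. c k * indicator (A k) s\<bar> powr \<alpha>)"
    unfolding pow by (intro Bochner_Integration.integrable_sum int)
  have "(LINT s|lborel. \<bar>\<Sum>k\<in>K. c k * indicator (A k) s\<bar> powr \<alpha>) = (\<Sum>S\<in>P. \<bar>?d S\<bar> powr \<alpha> * measure lborel (atom S))"
    unfolding pow using int meas by (subst Bochner_Integration.integral_sum) auto
  moreover have "distr M borel (\<lambda>x. \<Sum>k\<in>K. c k * \<Lambda> (A k) x) = distr M borel (\<lambda>x. \<Sum>S\<in>P. ?d S * \<Lambda> (atom S) x)"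
    using AE by (intro distr_cong_AE) (auto intro!: borel_measurable_sum borel_measurable_times random_variable_values A meas bdd)
  ultimately show "char (distr M borel (\<lambda>x. \<Sum>k\<in>K. c k * \<Lambda> (A k) x)) v
    = complex_of_real (exp (- ((LINT s|lborel. \<bar>\<Sum>k\<in>K. c k * indicator (A k) s\<bar> powr \<alpha>) * \<bar>v\<bar> powr \<alpha>)))"
    using char_simple_disjoint[OF finP meas bdd disj, where c="?d" and v=v] by simp
qed

end

section \<open>Limits of elementary integrals\<close>

lemma tendsto_zero_in_prob_real:
  assumes "tendsto_zero_in_prob M (\<lambda>n x. ereal (Y n x))" and "\<epsilon> > 0"
  shows "(\<lambda>n. measure M {x \<in> space M. \<bar>Y n x\<bar> > \<epsilon>}) \<longlonglongrightarrow> 0"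
  using assms by (auto simp: tendsto_zero_in_prob_def)

context sas_random_measure
begin

text \<open>The definition of the integral provides just some approximating sequence. A given
  elementary integral \<open>J\<close> is compared with its members \<open>I i\<close>: the
  difference is again elementary, with scale controlled by the distance of the integrands through
  the quasi-triangle inequality, so \<open>stable_tail_le\<close> applies; the remaining difference
  \<open>I i - Y\<close> vanishes in the limit.\<close>

lemma stable_integral_approx:
  fixes A :: "'k \<Rightarrow> real set"
  assumes \<alpha>: "0 < \<alpha>" "\<alpha> < 2" and Y: "is_stable_integral M \<alpha> \<Lambda> h Y" and h [measurable]: "h \<in> borel_measurable borel"
    and fin: "finite K" and A: "\<And>k. k \<in> K \<Longrightarrow> A k \<in> sets borel" "\<And>k. k \<in> K \<Longrightarrow> bounded (A k)"
    and d: "(\<integral>\<^sup>+s. ennreal (\<bar>(\<Sum>k\<in>K. c k * indicator (A k) s) - h s\<bar> powr \<alpha>) \<partial>lborel) \<le> ennreal d" "d \<ge> 0"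
    and e: "e > 0"
  shows "prob {x \<in> space M. \<bar>(\<Sum>k\<in>K. c k * \<Lambda> (A k) x) - Y x\<bar> > e} \<le> 4 * (4 / e) powr \<alpha> * 2 powr \<alpha> * d"
proof -
  obtain N :: "nat \<Rightarrow> nat" and c' B where
    B: "\<And>i j. j < N i \<Longrightarrow> B i j \<in> sets borel" "\<And>i j. j < N i \<Longrightarrow> bounded (B i j)" and
    conv: "(\<lambda>i. \<integral>\<^sup>+s. ennreal (\<bar>(\<Sum>j<N i. c' i j * indicator (B i j) s) - h s\<bar> powr \<alpha>) \<partial>lebesgue) \<longlonglongrightarrow> 0" and
    prob0: "tendsto_zero_in_prob M (\<lambda>i x. ereal ((\<Sum>j<N i. c' i j * \<Lambda> (B i j) x) - Y x))"
    using Y unfolding is_stable_integral_def by blast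
  have Ym [measurable]: "Y \<in> borel_measurable M" using Y by (simp add: is_stable_integral_def)
  define w where "w i = (\<integral>\<^sup>+s. ennreal (\<bar>(\<Sum>j<N i. c' i j * indicator (B i j) s) - h s\<bar> powr \<alpha>) \<partial>lborel)" for i
  have w: "w \<longlonglongrightarrow> 0" using conv unfolding nn_integral_completion w_def[abs_def] .
  define J where "J x = (\<Sum>k\<in>K. c k * \<Lambda> (A k) x)" for x
  define I where "I i x = (\<Sum>j<N i. c' i j * \<Lambda> (B i j) x)" for i x
  define p where "p i = prob {x \<in> space M. \<bar>I i x - Y x\<bar> > e / 2}" for i
  have p: "p \<longlonglongrightarrow> 0" using tendsto_zero_in_prob_real[OF prob0, of "e / 2"] e unfolding p_def[abs_def] I_def by simp
  have Jm [measurable]: "J \<in> borel_measurable M"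
    unfolding J_def by (intro borel_measurable_sum borel_measurable_times random_variable_values A) auto
  have Im [measurable]: "I i \<in> borel_measurable M" for i
    unfolding I_def by (intro borel_measurable_sum borel_measurable_times random_variable_values B) auto
  let ?C = "4 * (4 / e) powr \<alpha>"
  have main: "prob {x \<in> space M. \<bar>J x - Y x\<bar> > e} \<le> ?C * (2 powr \<alpha> * (d + enn2real (w i))) + p i" if wi: "w i < \<top>" for i
  proof -
    \<comment> \<open>The tagged union of the two families, with negated coefficients on the left,
      displays J - I i as one elementary integral over possibly overlapping sets.\<close>
    define coef where "coef z = (case z of Inl j \<Rightarrow> - c' i j | Inr k \<Rightarrow> c k)" for z
    define S where "S z = (case z of Inl j \<Rightarrow> B i j | Inr k \<Rightarrow> A k)" for z
    let ?Z = "{..<N i} <+> K"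
    have S: "\<And>z. z \<in> ?Z \<Longrightarrow> S z \<in> sets borel" "\<And>z. z \<in> ?Z \<Longrightarrow> bounded (S z)" "finite ?Z"
      using A B fin by (auto simp: S_def)
    have D: "(\<Sum>z\<in>?Z. coef z * \<Lambda> (S z) x) = J x - I i x" for x
      unfolding J_def I_def by (subst sum.Plus) (auto simp: fin coef_def S_def sum_negf)
    have \<phi>: "(\<Sum>z\<in>?Z. coef z * indicator (S z) s) = (\<Sum>k\<in>K. c k * indicator (A k) s) - (\<Sum>j<N i. c' i j * indicator (B i j) s)" for s
      by (subst sum.Plus) (auto simp: fin coef_def S_def sum_negf)
    define V where "V = (LINT s|lborel. \<bar>\<Sum>z\<in>?Z. coef z * indicator (S z) s\<bar> powr \<alpha>)"
    have V0: "V \<ge> 0" by (simp add: V_def)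
    have mA: "(\<lambda>s. \<Sum>k\<in>K. c k * indicator (A k) s) \<in> borel_measurable borel"
      by (intro borel_measurable_sum borel_measurable_times borel_measurable_indicator) (auto simp: A)
    have mB: "(\<lambda>s. \<Sum>j<N i. c' i j * indicator (B i j) s) \<in> borel_measurable borel"
      by (intro borel_measurable_sum borel_measurable_times borel_measurable_indicator) (auto simp: B)
    have "ennreal V = (\<integral>\<^sup>+s. ennreal (\<bar>\<Sum>z\<in>?Z. coef z * indicator (S z) s\<bar> powr \<alpha>) \<partial>lborel)"
      unfolding V_def by (intro nn_integral_eq_integral[symmetric] char_simple(2) S) auto
    also have "\<dots> \<le> (\<integral>\<^sup>+s. ennreal (2 powr \<alpha>) * (ennreal (\<bar>(\<Sum>k\<in>K. c k * indicator (A k) s) - h s\<bar> powr \<alpha>)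
        + ennreal (\<bar>(\<Sum>j<N i. c' i j * indicator (B i j) s) - h s\<bar> powr \<alpha>)) \<partial>lborel)"
    proof (rule nn_integral_mono)
      fix s
      have "\<bar>\<Sum>z\<in>?Z. coef z * indicator (S z) s\<bar> powr \<alpha>
        \<le> 2 powr \<alpha> * (\<bar>(\<Sum>k\<in>K. c k * indicator (A k) s) - h s\<bar> powr \<alpha> + \<bar>- ((\<Sum>j<N i. c' i j * indicator (B i j) s) - h s)\<bar> powr \<alpha>)"
        unfolding \<phi> by (rule order_trans[OF _ abs_add_powr_le[OF \<alpha>(1)]]) simp
      then show "ennreal (\<bar>\<Sum>z\<in>?Z. coef z * indicator (S z) s\<bar> powr \<alpha>) \<le> ennreal (2 powr \<alpha>) * (ennreal (\<bar>(\<Sum>k\<in>K. c k * indicator (A k) s) - h s\<bar> powr \<alpha>)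
        + ennreal (\<bar>(\<Sum>j<N i. c' i j * indicator (B i j) s) - h s\<bar> powr \<alpha>))"
        by (simp add: ennreal_mult[symmetric] ennreal_plus[symmetric] del: ennreal_plus abs_minus_cancel) (simp add: abs_minus_commute)
    qed
    also have "\<dots> = ennreal (2 powr \<alpha>) * ((\<integral>\<^sup>+s. ennreal (\<bar>(\<Sum>k\<in>K. c k * indicator (A k) s) - h s\<bar> powr \<alpha>) \<partial>lborel) + w i)"
      unfolding w_def using mA mB by (subst nn_integral_cmult, measurable, subst nn_integral_add, measurable) 
    also have "\<dots> \<le> ennreal (2 powr \<alpha>) * (ennreal d + ennreal (enn2real (w i)))"
      using wi d by (intro mult_left_mono add_mono) auto
    also have "\<dots> = ennreal (2 powr \<alpha> * (d + enn2real (w i)))"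
      using d by (simp add: ennreal_mult)
    finally have V: "V \<le> 2 powr \<alpha> * (d + enn2real (w i))"
      using d by (simp add: ennreal_le_iff)
    have tail: "prob {x \<in> space M. \<bar>J x - I i x\<bar> > e / 2} \<le> 4 * V * (2 / (e / 2)) powr \<alpha>"
      unfolding D[symmetric] V_def
      by (intro stable_tail_le \<alpha> char_simple(1) S) (auto simp: D e)
    have "prob {x \<in> space M. \<bar>J x - Y x\<bar> > e} \<le> prob ({x \<in> space M. \<bar>J x - I i x\<bar> > e / 2} \<union> {x \<in> space M. \<bar>I i x - Y x\<bar> > e / 2})"
    proof (intro finite_measure_mono subsetI)
      fix x assume "x \<in> {x \<in> space M. \<bar>J x - Y x\<bar> > e}"
      moreover have "\<bar>J x - Y x\<bar> \<le> \<bar>J x - I i x\<bar> + \<bar>I i x - Y x\<bar>" by linarith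
      ultimately show "x \<in> {x \<in> space M. \<bar>J x - I i x\<bar> > e / 2} \<union> {x \<in> space M. \<bar>I i x - Y x\<bar> > e / 2}"
        by auto
    qed auto
    also have "\<dots> \<le> prob {x \<in> space M. \<bar>J x - I i x\<bar> > e / 2} + p i"
      unfolding p_def by (intro measure_Un_le) auto
    also have "\<dots> \<le> 4 * V * (2 / (e / 2)) powr \<alpha> + p i" using tail by simp
    also have "4 * V * (2 / (e / 2)) powr \<alpha> = ?C * V" by simp
    also have "\<dots> \<le> ?C * (2 powr \<alpha> * (d + enn2real (w i)))"
      using V by (intro mult_left_mono) auto
    finally show ?thesis by simp
  qed
  \<comment> \<open>The distance of the first integrands may be infinite; convergence to zero makes
    it finite eventually.\<close>
  have ev: "\<forall>\<^sub>F i in sequentially. prob {x \<in> space M. \<bar>J x - Y x\<bar> > e} \<le> ?C * (2 powr \<alpha> * (d + enn2real (w i))) + p i"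
    using order_tendstoD(2)[OF w, of \<top>] by (auto elim!: eventually_mono intro: main)
  have "(\<lambda>i. ?C * (2 powr \<alpha> * (d + enn2real (w i))) + p i) \<longlonglongrightarrow> ?C * (2 powr \<alpha> * (d + enn2real 0)) + 0"
  proof -
    have "(\<lambda>i. enn2real (w i)) \<longlonglongrightarrow> 0" using tendsto_enn2real[of w 0] w by simp
    from tendsto_add[OF tendsto_mult_left[OF tendsto_mult_left[OF tendsto_add[OF tendsto_const this]]] p]
    show ?thesis by simp
  qed
  then have "prob {x \<in> space M. \<bar>J x - Y x\<bar> > e} \<le> ?C * (2 powr \<alpha> * (d + enn2real 0)) + 0"
    by (rule tendsto_lowerbound[OF _ ev]) simp
  then show ?thesis by (simp add: J_def mult_ac)
qed

text \<open>The scales of the approximating elementary integrals eventually stay above a positive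
  constant, so their small ball bounds are uniform and survive the limit in probability.\<close>

lemma stable_integral_nonzero:
  assumes \<alpha>: "0 < \<alpha>" "\<alpha> < 2" and Y: "is_stable_integral M \<alpha> \<Lambda> h Y" and h [measurable]: "h \<in> borel_measurable borel"
    and int: "integrable lborel (\<lambda>s. \<bar>h s\<bar> powr \<alpha>)" and pos: "(LINT s|lborel. \<bar>h s\<bar> powr \<alpha>) > 0"
  shows "AE x in M. Y x \<noteq> 0"
proof -
  obtain N :: "nat \<Rightarrow> nat" and c' B where
    B: "\<And>i j. j < N i \<Longrightarrow> B i j \<in> sets borel" "\<And>i j. j < N i \<Longrightarrow> bounded (B i j)" and
    conv: "(\<lambda>i. \<integral>\<^sup>+s. ennreal (\<bar>(\<Sum>j<N i. c' i j * indicator (B i j) s) - h s\<bar> powr \<alpha>) \<partial>lebesgue) \<longlonglongrightarrow> 0" and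
    prob0: "tendsto_zero_in_prob M (\<lambda>i x. ereal ((\<Sum>j<N i. c' i j * \<Lambda> (B i j) x) - Y x))"
    using Y unfolding is_stable_integral_def by blast
  have Ym [measurable]: "Y \<in> borel_measurable M" using Y by (simp add: is_stable_integral_def)
  define w where "w i = (\<integral>\<^sup>+s. ennreal (\<bar>(\<Sum>j<N i. c' i j * indicator (B i j) s) - h s\<bar> powr \<alpha>) \<partial>lborel)" for i
  have w: "w \<longlonglongrightarrow> 0" using conv unfolding nn_integral_completion w_def[abs_def] .
  define I where "I i x = (\<Sum>j<N i. c' i j * \<Lambda> (B i j) x)" for i x
  define V where "V i = (LINT s|lborel. \<bar>\<Sum>j<N i. c' i j * indicator (B i j) s\<bar> powr \<alpha>)" for i
  define v where "v = (LINT s|lborel. \<bar>h s\<bar> powr \<alpha>)"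
  \<comment> \<open>The quasi-triangle inequality reads v \<le> 2^\<alpha> (V + w); once w is below
    half of v / 2^\<alpha>, V is at least the other half.\<close>
  define v0 where "v0 = v / 2 powr \<alpha> / 2"
  have v0: "v0 > 0" using pos by (simp add: v0_def v_def)
  have Im [measurable]: "I i \<in> borel_measurable M" for i
    unfolding I_def by (intro borel_measurable_sum borel_measurable_times random_variable_values B) auto
  have V_ge: "V i \<ge> v0" if wi: "w i < ennreal v0" for i
  proof -
    have mB [measurable]: "(\<lambda>s. \<Sum>j<N i. c' i j * indicator (B i j) s) \<in> borel_measurable borel"
      by (intro borel_measurable_sum borel_measurable_times borel_measurable_indicator) (auto simp: B)
    have "ennreal v = (\<integral>\<^sup>+s. ennreal (\<bar>h s\<bar> powr \<alpha>) \<partial>lborel)"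
      unfolding v_def by (intro nn_integral_eq_integral[symmetric] int) auto
    also have "\<dots> \<le> (\<integral>\<^sup>+s. ennreal (2 powr \<alpha>) * (ennreal (\<bar>\<Sum>j<N i. c' i j * indicator (B i j) s\<bar> powr \<alpha>)
        + ennreal (\<bar>(\<Sum>j<N i. c' i j * indicator (B i j) s) - h s\<bar> powr \<alpha>)) \<partial>lborel)"
    proof (rule nn_integral_mono)
      fix s
      let ?\<phi> = "\<Sum>j<N i. c' i j * indicator (B i j) s"
      have "\<bar>?\<phi> + - (?\<phi> - h s)\<bar> powr \<alpha> \<le> 2 powr \<alpha> * (\<bar>?\<phi>\<bar> powr \<alpha> + \<bar>- (?\<phi> - h s)\<bar> powr \<alpha>)"
        by (rule abs_add_powr_le[OF \<alpha>(1)])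
      then have "\<bar>h s\<bar> powr \<alpha> \<le> 2 powr \<alpha> * (\<bar>?\<phi>\<bar> powr \<alpha> + \<bar>?\<phi> - h s\<bar> powr \<alpha>)" by (simp add: abs_minus_commute)
      then show "ennreal (\<bar>h s\<bar> powr \<alpha>) \<le> ennreal (2 powr \<alpha>) * (ennreal (\<bar>?\<phi>\<bar> powr \<alpha>) + ennreal (\<bar>?\<phi> - h s\<bar> powr \<alpha>))"
        by (simp add: ennreal_mult[symmetric] ennreal_plus[symmetric] del: ennreal_plus)
    qed
    also have "\<dots> = ennreal (2 powr \<alpha>) * ((\<integral>\<^sup>+s. ennreal (\<bar>\<Sum>j<N i. c' i j * indicator (B i j) s\<bar> powr \<alpha>) \<partial>lborel) + w i)"
      unfolding w_def by (subst nn_integral_cmult, measurable, subst nn_integral_add, measurable)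
    also have "(\<integral>\<^sup>+s. ennreal (\<bar>\<Sum>j<N i. c' i j * indicator (B i j) s\<bar> powr \<alpha>) \<partial>lborel) = ennreal (V i)"
      unfolding V_def by (intro nn_integral_eq_integral char_simple(2)) (auto simp: B)
    also have "ennreal (2 powr \<alpha>) * (ennreal (V i) + w i) \<le> ennreal (2 powr \<alpha>) * (ennreal (V i) + ennreal v0)"
      using wi by (intro mult_left_mono add_left_mono) auto
    also have "\<dots> = ennreal (2 powr \<alpha> * (V i + v0))"
      using v0 by (simp add: ennreal_mult V_def)
    finally have "v \<le> 2 powr \<alpha> * (V i + v0)" using v0 by (simp add: ennreal_le_iff V_def)
    then have "v / 2 powr \<alpha> \<le> V i + v0" by (simp add: divide_le_eq mult.commute)
    then show ?thesis by (simp add: v0_def)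
  qed
  have small: "prob {x \<in> space M. Y x = 0} \<le> 2 * stable_smoothing \<alpha> v0 k" if k: "k > 0" for k
  proof -
    define p where "p i = prob {x \<in> space M. \<bar>I i x - Y x\<bar> > 1 / k}" for i
    have p: "p \<longlonglongrightarrow> 0" using tendsto_zero_in_prob_real[OF prob0, of "1 / k"] k unfolding p_def[abs_def] I_def by simp
    have "\<forall>\<^sub>F i in sequentially. prob {x \<in> space M. Y x = 0} \<le> 2 * stable_smoothing \<alpha> v0 k + p i"
      using order_tendstoD(2)[OF w, of "ennreal v0"] v0
    proof (auto elim!: eventually_mono)
      fix i assume wi: "w i < ennreal v0"
      have "prob {x \<in> space M. Y x = 0} \<le> prob ({x \<in> space M. \<bar>I i x\<bar> \<le> 1 / k} \<union> {x \<in> space M. \<bar>I i x - Y x\<bar> > 1 / k})"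
        by (intro finite_measure_mono) auto
      also have "\<dots> \<le> prob {x \<in> space M. \<bar>I i x\<bar> \<le> 1 / k} + p i"
        unfolding p_def by (intro measure_Un_le) auto
      also have "prob {x \<in> space M. \<bar>I i x\<bar> \<le> 1 / k} \<le> 2 * stable_smoothing \<alpha> (V i) (1 / (1 / k))"
      proof (rule stable_small_ball_le[OF Im])
        show "char (distr M borel (I i)) u = complex_of_real (exp (- (V i * \<bar>u\<bar> powr \<alpha>)))" for u
          unfolding I_def[abs_def] V_def by (rule char_simple(1)) (auto simp: B)
      qed (use k in simp)
      also have "stable_smoothing \<alpha> (V i) (1 / (1 / k)) \<le> stable_smoothing \<alpha> v0 k"
        using stable_smoothing_antimono[of v0 "V i" \<alpha> k] V_ge[OF wi] v0 by simp
      finally show "prob {x \<in> space M. Y x = 0} \<le> 2 * stable_smoothing \<alpha> v0 k + p i" by simp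
    qed
    moreover have "(\<lambda>i. 2 * stable_smoothing \<alpha> v0 k + p i) \<longlonglongrightarrow> 2 * stable_smoothing \<alpha> v0 k + 0"
      by (intro tendsto_intros p)
    ultimately show ?thesis using tendsto_lowerbound[of _ "2 * stable_smoothing \<alpha> v0 k + 0"] by fastforce
  qed
  have "(\<lambda>i. 2 * stable_smoothing \<alpha> v0 (real (Suc i))) \<longlonglongrightarrow> 2 * 0"
    by (intro tendsto_intros stable_smoothing_tendsto_0 v0 \<alpha>)
  then have "prob {x \<in> space M. Y x = 0} \<le> 2 * 0"
    by (rule tendsto_lowerbound) (auto intro!: always_eventually small)
  then have "prob {x \<in> space M. Y x = 0} = 0" by (simp add: measure_le_0_iff)
  then show ?thesis by (intro AE_I[where N="{x \<in> space M. Y x = 0}"]) (auto simp: emeasure_eq_measure)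
qed

end

subsection \<open>Discretization of the stable moving average\<close>


locale stable_grid = sampling_grid f L F \<Delta> \<kappa> q n + noise: sas_random_measure M \<alpha> \<Lambda>
  for f L F \<Delta> \<kappa> q n and M :: "'a measure" and \<alpha> \<Lambda> +
  assumes \<alpha>: "0 < \<alpha>" "\<alpha> < 2"
begin

definition cell :: "int \<times> nat \<Rightarrow> real set" where "cell k = {s k <.. s k + \<Delta> / real q}"

lemma cell_props: "cell k \<in> sets borel" "bounded (cell k)" "measure lborel (cell k) = \<Delta> / real q"
  using \<Delta>_pos by (auto simp: cell_def intro: bounded_subset[OF bounded_closed_interval[of "s k" "s k + \<Delta> / real q"]])

lemma \<delta>_pos: "\<Delta> / real q > 0" using \<Delta>_pos q_pos by simp

lemma s_index: "s k = of_int (fst k * int q + int (snd k)) * (\<Delta> / real q)"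
  using q_pos by (simp add: s_def field_simps)

text \<open>Cells are open on the left and closed on the right, so they are numbered along the line
  by the ceiling minus 1.\<close>

lemma cell_iff: "x \<in> cell k \<longleftrightarrow> \<lceil>x / (\<Delta> / real q)\<rceil> - 1 = fst k * int q + int (snd k)"
proof -
  let ?j = "fst k * int q + int (snd k)"
  have "x \<in> cell k \<longleftrightarrow> of_int ?j * (\<Delta> / real q) < x \<and> x \<le> (of_int ?j + 1) * (\<Delta> / real q)"
    unfolding cell_def s_index greaterThanAtMost_iff distrib_right mult_1_left ..
  also have "\<dots> \<longleftrightarrow> of_int ?j < x / (\<Delta> / real q) \<and> x / (\<Delta> / real q) \<le> of_int ?j + 1"
    using \<delta>_pos by (simp only: pos_less_divide_eq pos_divide_le_eq)
  also have "\<dots> \<longleftrightarrow> \<lceil>x / (\<Delta> / real q)\<rceil> - 1 = ?j"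
    using ceiling_eq_iff[of "x / (\<Delta> / real q)" "?j + 1"] by auto
  finally show ?thesis .
qed

lemma index_inj: "k \<in> K \<Longrightarrow> k' \<in> K \<Longrightarrow> fst k * int q + int (snd k) = fst k' * int q + int (snd k') \<Longrightarrow> k = k'"
proof -
  assume k: "k \<in> K" "k' \<in> K" and eq: "fst k * int q + int (snd k) = fst k' * int q + int (snd k')"
  have r: "snd k < q" "snd k' < q" using k by (auto simp: K_def)
  have "(fst k * int q + int (snd k)) div int q = fst k" "(fst k' * int q + int (snd k')) div int q = fst k'"
    using r by auto
  then have "fst k = fst k'" using eq by simp
  then show "k = k'" using eq by (simp add: prod_eq_iff)
qed

lemma disjoint_cells: "disjoint_family_on cell K"
  unfolding disjoint_family_on_def using index_inj by (auto simp: cell_iff)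

text \<open>Every noise time that can influence an observation lies in the grid; this determines the
  range from -l to n + l of the first component.\<close>

lemma cover:
  assumes "\<bar>real j * \<Delta> - x\<bar> \<le> L" "1 \<le> j" "j \<le> n"
  shows "\<exists>k\<in>K. x \<in> cell k"
proof -
  define y where "y = \<lceil>x / (\<Delta> / real q)\<rceil> - 1"
  define k where "k = (y div int q, nat (y mod int q))"
  have q0: "int q > 0" using q_pos by simp
  have y: "y = fst k * int q + int (snd k)" using q0 by (simp add: k_def)
  then have x: "x \<in> cell k" unfolding cell_iff by (simp add: y_def)
  have r: "snd k < q" using q0 by (simp add: k_def nat_less_iff)
  have sx: "s k < x" "x \<le> s k + \<Delta> / real q" using x by (auto simp: cell_def)
  have sk: "of_int (fst k) * \<Delta> \<le> s k"
    using mult_nonneg_nonneg[of "real (snd k)" "\<Delta> / real q"] \<delta>_pos unfolding s_def by linarith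
  have sk2: "s k + \<Delta> / real q \<le> of_int (fst k) * \<Delta> + \<Delta>"
  proof -
    have "(real (snd k) + 1) * (\<Delta> / real q) \<le> real q * (\<Delta> / real q)"
      using r \<delta>_pos by (intro mult_right_mono) auto
    then show ?thesis using q_pos by (simp add: s_def distrib_right add_divide_distrib)
  qed
  have jn: "\<Delta> \<le> real j * \<Delta>" "real j * \<Delta> \<le> real n * \<Delta>" using assms \<Delta>_pos by auto
  have "of_int (fst k) * \<Delta> < real n * \<Delta> + L" using sk sx assms jn by linarith
  also have "\<dots> \<le> (real n + real l) * \<Delta>" using l_ge \<Delta>_pos by (simp add: distrib_right)
  finally have 1: "fst k \<le> int n + int l" using \<Delta>_pos by (simp add: mult_less_cancel_right_disj)
  have "(- real l) * \<Delta> \<le> of_int (fst k) * \<Delta>" using l_ge sk2 sx assms(1) jn \<Delta>_pos by (simp only: mult_minus_left)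
  then have "- real l \<le> of_int (fst k)" using \<Delta>_pos by (rule mult_right_le_imp_le)
  then have 2: "- int l \<le> fst k" by linarith
  have "k \<in> K" using 1 2 r by (auto simp: K_def mem_Times_iff)
  then show ?thesis using x by blast
qed

definition \<mu> :: "real measure" where "\<mu> = distr M borel (\<Lambda> (cell (0, 0)))"

lemma noise_law: "distr M borel (\<Lambda> (cell k)) = \<mu>"
  unfolding \<mu>_def
proof (rule Levy_uniqueness)
  have rd: "real_distribution (distr M borel (\<Lambda> (cell j)))" for j
    using cell_props noise.random_variable_values by (intro noise.real_distribution_distr) auto
  show "real_distribution (distr M borel (\<Lambda> (cell k)))" "real_distribution (distr M borel (\<Lambda> (cell (0, 0))))"
    by (rule rd)+
  show "char (distr M borel (\<Lambda> (cell k))) = char (distr M borel (\<Lambda> (cell (0, 0))))"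
    using noise.char_values cell_props by (intro ext) simp
qed

lemma noise_symmetric: "distr \<mu> borel uminus = \<mu>"
proof -
  have rv: "\<Lambda> (cell (0, 0)) \<in> borel_measurable M"
    using cell_props noise.random_variable_values by auto
  have eq: "distr \<mu> borel uminus = distr M borel (\<lambda>x. - \<Lambda> (cell (0, 0)) x)"
    unfolding \<mu>_def using rv by (subst distr_distr) (auto simp: o_def)
  have "distr M borel (\<lambda>x. - \<Lambda> (cell (0, 0)) x) = distr M borel (\<Lambda> (cell (0, 0)))"
  proof (rule Levy_uniqueness)
    show "real_distribution (distr M borel (\<lambda>x. - \<Lambda> (cell (0, 0)) x))"
      using rv by (intro noise.real_distribution_distr) auto
    show "real_distribution (distr M borel (\<Lambda> (cell (0, 0))))"
      by (rule noise.real_distribution_distr[OF rv])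
    show "char (distr M borel (\<lambda>x. - \<Lambda> (cell (0, 0)) x)) = char (distr M borel (\<Lambda> (cell (0, 0))))"
    proof
      fix u
      have "char (distr M borel (\<lambda>x. - \<Lambda> (cell (0, 0)) x)) u = char (distr M borel (\<Lambda> (cell (0, 0)))) (- u)"
        unfolding char_def using rv by (simp add: integral_distr)
      then show "char (distr M borel (\<lambda>x. - \<Lambda> (cell (0, 0)) x)) u = char (distr M borel (\<Lambda> (cell (0, 0)))) u"
        using noise.char_values[OF cell_props(1,2)] by simp
    qed
  qed
  then show ?thesis unfolding eq by (simp add: \<mu>_def)
qed

text \<open>Small ball bounds with radii 1/(i + 1) tending to zero.\<close>

lemma noise_nonzero: "AE x in M. \<Lambda> (cell k) x \<noteq> 0"
proof -
  have rv: "\<Lambda> (cell k) \<in> borel_measurable M" using cell_props noise.random_variable_values by auto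
  have ch: "char (distr M borel (\<Lambda> (cell k))) u = complex_of_real (exp (- (\<Delta> / real q * \<bar>u\<bar> powr \<alpha>)))" for u
    using noise.char_values cell_props by simp
  have "noise.prob {x \<in> space M. \<Lambda> (cell k) x = 0} \<le> 2 * stable_smoothing \<alpha> (\<Delta> / real q) (real (Suc i))" for i
  proof -
    have "noise.prob {x \<in> space M. \<Lambda> (cell k) x = 0} \<le> noise.prob {x \<in> space M. \<bar>\<Lambda> (cell k) x\<bar> \<le> 1 / real (Suc i)}"
      using rv by (intro noise.finite_measure_mono) auto
    also have "\<dots> \<le> 2 * stable_smoothing \<alpha> (\<Delta> / real q) (1 / (1 / real (Suc i)))"
      by (rule noise.stable_small_ball_le[OF rv ch]) simp
    finally show ?thesis by simp
  qed
  note small = this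
  have "(\<lambda>i. 2 * stable_smoothing \<alpha> (\<Delta> / real q) (real (Suc i))) \<longlonglongrightarrow> 2 * 0"
    by (intro tendsto_intros stable_smoothing_tendsto_0 \<delta>_pos \<alpha>)
  then have "noise.prob {x \<in> space M. \<Lambda> (cell k) x = 0} \<le> 2 * 0"
    by (rule tendsto_lowerbound) (auto intro!: always_eventually small simp del: of_nat_Suc)
  then have "noise.prob {x \<in> space M. \<Lambda> (cell k) x = 0} = 0" by (simp add: measure_le_0_iff)
  then show ?thesis
    using rv by (intro AE_I[where N="{x \<in> space M. \<Lambda> (cell k) x = 0}"]) (auto simp: noise.emeasure_eq_measure)
qed

lemma K_nonempty: "K \<noteq> {}"
  using q_pos by (auto simp: K_def)

lemma noisy_grid_cells: "noisy_grid f L F \<Delta> \<kappa> q n M (\<lambda>k. \<Lambda> (cell k)) \<mu>"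
proof (intro noisy_grid.intro iid_symmetric_family.intro iid_symmetric_family_axioms.intro)
  show "sampling_grid f L F \<Delta> \<kappa> q n" by unfold_locales
  show "noise.indep_vars (\<lambda>_. borel) (\<lambda>k. \<Lambda> (cell k)) K"
    by (rule noise.indep_finite[OF finite_K cell_props(1,2) disjoint_cells])
qed (use finite_K K_nonempty noise_law noise_symmetric noise_nonzero noise.prob_space_axioms in auto)

text \<open>The step function is within \<open>d\<close> of the shifted kernel on the cells, and
  both vanish elsewhere. The total length of the cells, (n + 2 l + 1) \<Delta>, is free of
  \<open>q\<close>, so a small \<open>d\<close> makes the bound small.\<close>

lemma path_close:
  assumes X: "moving_average M \<alpha> \<Lambda> f X" and j: "1 \<le> j" "j \<le> n" and e: "e > 0"
    and d: "d \<ge> 0" "\<And>s t. \<bar>s - t\<bar> \<le> \<Delta> / real q \<Longrightarrow> \<bar>f s - f t\<bar> \<le> d"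
  shows "noise.prob {x \<in> space M. \<bar>(\<Sum>k\<in>K. f (real j * \<Delta> - s k) * \<Lambda> (cell k) x) - X (real j * \<Delta>) x\<bar> > e}
    \<le> 4 * (4 / e) powr \<alpha> * 2 powr \<alpha> * (d powr \<alpha> * ((real n + 2 * real l + 1) * \<Delta>))"
proof (rule noise.stable_integral_approx[OF \<alpha> _ _ finite_K cell_props(1,2) _ _ e])
  let ?t = "real j * \<Delta>"
  let ?\<phi> = "\<lambda>x. \<Sum>k\<in>K. f (?t - s k) * indicator (cell k) x"
  show "is_stable_integral M \<alpha> \<Lambda> (\<lambda>s. f (?t - s)) (X ?t)" using X by (simp add: moving_average_def)
  show "(\<lambda>s. f (?t - s)) \<in> borel_measurable borel" by measurable
  have le: "\<bar>?\<phi> x - f (?t - x)\<bar> powr \<alpha> \<le> (\<Sum>k\<in>K. d powr \<alpha> * indicator (cell k) x)" for x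
  proof (cases "\<exists>k\<in>K. x \<in> cell k")
    case True
    then obtain k where k: "k \<in> K" "x \<in> cell k" by auto
    have ind: "(indicator (cell k') x :: real) = (if k' = k then 1 else 0)" if "k' \<in> K" for k'
      using disjoint_cells k that by (auto simp: disjoint_family_on_def indicator_def)
    have sum: "(\<Sum>k\<in>K. g k * indicator (cell k) x) = g k" for g :: "int \<times> nat \<Rightarrow> real"
    proof -
      have "(\<Sum>k'\<in>K. g k' * indicator (cell k') x) = (\<Sum>k'\<in>K. if k' = k then g k else 0)"
        by (intro sum.cong refl) (simp add: ind)
      then show ?thesis using k finite_K by simp
    qed
    have "\<bar>f (?t - s k) - f (?t - x)\<bar> \<le> d"
      using k by (intro d(2)) (auto simp: cell_def)
    then show ?thesis unfolding sum using \<alpha> by (intro powr_mono2) auto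
  next
    case False
    then have "\<not> \<bar>?t - x\<bar> \<le> L" using cover[of j x] j by auto
    then have "f (?t - x) = 0" by (intro support) auto
    moreover have "?\<phi> x = 0" using False by (intro sum.neutral) (auto simp: indicator_def)
    ultimately show ?thesis by (simp add: sum_nonneg)
  qed
  have "(\<integral>\<^sup>+x. ennreal (\<bar>?\<phi> x - f (?t - x)\<bar> powr \<alpha>) \<partial>lborel) \<le> (\<integral>\<^sup>+x. ennreal (\<Sum>k\<in>K. d powr \<alpha> * indicator (cell k) x) \<partial>lborel)"
    by (intro nn_integral_mono ennreal_leI le)
  also have "\<dots> = ennreal (LINT x|lborel. (\<Sum>k\<in>K. d powr \<alpha> * indicator (cell k) x))"
  proof (intro nn_integral_eq_integral Bochner_Integration.integrable_sum integrable_mult_right integrable_real_indicator)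
    show "emeasure lborel (cell k) < \<infinity>" for k
      using emeasure_bounded_finite[OF cell_props(2)] by (simp add: less_top)
  qed (auto simp: cell_props sum_nonneg)
  also have "(LINT x|lborel. (\<Sum>k\<in>K. d powr \<alpha> * indicator (cell k) x)) = (\<Sum>k\<in>K. d powr \<alpha> * (\<Delta> / real q))"
  proof (subst Bochner_Integration.integral_sum)
    show "integrable lborel (\<lambda>x. d powr \<alpha> * indicator (cell k) x)" for k
      using emeasure_bounded_finite[OF cell_props(2)] by (intro integrable_mult_right integrable_real_indicator) (auto simp: cell_props less_top)
  qed (simp add: cell_props)
  also have "\<dots> = d powr \<alpha> * ((real n + 2 * real l + 1) * \<Delta>)"
  proof -
    have "real (card K) = (real n + 2 * real l + 1) * real q" by (simp add: card_K algebra_simps)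
    then show ?thesis using q_pos by simp
  qed
  finally show "(\<integral>\<^sup>+x. ennreal (\<bar>?\<phi> x - f (?t - x)\<bar> powr \<alpha>) \<partial>lborel) \<le> ennreal (d powr \<alpha> * ((real n + 2 * real l + 1) * \<Delta>))" .
  show "0 \<le> d powr \<alpha> * ((real n + 2 * real l + 1) * \<Delta>)" using \<Delta>_pos by simp
qed

end

subsection \<open>Passage to the limit in the mesh of the noise\<close>


lemma periodogram_nonneg: "0 \<le> periodogram n \<Delta> x \<xi>"
  by (simp add: periodogram_def sum_nonneg)

text \<open>Cauchy-Schwarz; a path vanishing at all observation times has periodogram 0 by the
  convention on division. The bound dominates the limit in the mesh of the noise.\<close>

lemma periodogram_le: "periodogram n \<Delta> x \<xi> \<le> real n"
proof -
  let ?S = "\<Sum>j=1..n. (x (real j * \<Delta>))\<^sup>2"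
  have "cmod (\<Sum>j=1..n. complex_of_real (x (real j * \<Delta>)) * exp (\<i> * of_real (real j * \<Delta>) * of_real \<xi>)) \<le> (\<Sum>j=1..n. \<bar>x (real j * \<Delta>)\<bar>)"
    by (rule sum_norm_le) (simp add: norm_mult)
  then have "(cmod (\<Sum>j=1..n. complex_of_real (x (real j * \<Delta>)) * exp (\<i> * of_real (real j * \<Delta>) * of_real \<xi>)))\<^sup>2 \<le> (\<Sum>j=1..n. \<bar>x (real j * \<Delta>)\<bar>)\<^sup>2"
    by (intro power_mono) auto
  also have "\<dots> \<le> ?S * real n"
    using sum_squared_le_sum_of_squares[of "\<lambda>j. \<bar>x (real j * \<Delta>)\<bar>" "{1..n}"] by simp
  finally have *: "(cmod (\<Sum>j=1..n. complex_of_real (x (real j * \<Delta>)) * exp (\<i> * of_real (real j * \<Delta>) * of_real \<xi>)))\<^sup>2 \<le> ?S * real n" .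
  have "?S \<ge> 0" by (simp add: sum_nonneg)
  then consider "?S = 0" | "?S > 0" by linarith
  then show ?thesis
    using * by cases (simp_all add: periodogram_def pos_divide_le_eq mult.commute)
qed

lemma smoothed_periodogram_bounds:
  assumes "\<And>k. \<bar>k\<bar> \<le> int m \<Longrightarrow> 0 \<le> w k" "(\<Sum>k\<in>{- int m..int m}. w k) = 1"
  shows "0 \<le> smoothed_periodogram n \<Delta> m w x \<xi>" "smoothed_periodogram n \<Delta> m w x \<xi> \<le> real n"
proof -
  show "0 \<le> smoothed_periodogram n \<Delta> m w x \<xi>"
    unfolding smoothed_periodogram_def using assms(1) by (intro sum_nonneg mult_nonneg_nonneg periodogram_nonneg) auto
  have "smoothed_periodogram n \<Delta> m w x \<xi> \<le> (\<Sum>k\<in>{- int m..int m}. w k * real n)"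
    unfolding smoothed_periodogram_def using assms(1) by (intro sum_mono mult_left_mono periodogram_le) auto
  then show "smoothed_periodogram n \<Delta> m w x \<xi> \<le> real n" by (simp add: sum_distrib_right[symmetric] assms(2))
qed

lemma measurable_smoothed_periodogram:
  assumes [measurable]: "\<And>t. Z t \<in> borel_measurable M"
  shows "(\<lambda>(y, \<xi>). smoothed_periodogram n \<Delta> m w (\<lambda>t. Z t y) \<xi>) \<in> borel_measurable (M \<Otimes>\<^sub>M lborel)"
  unfolding smoothed_periodogram_def periodogram_def by measurable

lemma continuous_smoothed_periodogram: "continuous_on A (smoothed_periodogram n \<Delta> m w x)"
proof -
  have "continuous_on A (\<lambda>\<xi>. \<Sum>k\<in>{- int m..int m}. w k *
      ((cmod (\<Sum>j=1..n. complex_of_real (x (real j * \<Delta>)) * exp (\<i> * of_real (real j * \<Delta>) * of_real (\<xi> + of_int k / (real n * \<Delta>)))))\<^sup>2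
      * (1 / (\<Sum>j=1..n. (x (real j * \<Delta>))\<^sup>2))))"
    unfolding divide_inverse by (intro continuous_intros)
  then show ?thesis unfolding smoothed_periodogram_def periodogram_def by simp
qed

lemma tendsto_smoothed_periodogram:
  assumes "\<And>j. j \<in> {1..n} \<Longrightarrow> (\<lambda>i. x i (real j * \<Delta>)) \<longlonglongrightarrow> z (real j * \<Delta>)"
    and "(\<Sum>j=1..n. (z (real j * \<Delta>))\<^sup>2) \<noteq> 0"
  shows "(\<lambda>i. smoothed_periodogram n \<Delta> m w (x i) \<xi>) \<longlonglongrightarrow> smoothed_periodogram n \<Delta> m w z \<xi>"
  unfolding smoothed_periodogram_def periodogram_def
  by (intro tendsto_intros assms)

lemma integral_continuous_pos:
  fixes g :: "real \<Rightarrow> real"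
  assumes cont: "continuous_on UNIV g" and int: "integrable lborel g"
    and nonneg: "\<And>s. 0 \<le> g s" and g0: "g s0 > 0"
  shows "(LINT s|lborel. g s) > 0"
proof -
  have "isCont g s0" using cont by (simp add: continuous_on_eq_continuous_at)
  then obtain d where d: "d > 0" "\<And>s. dist s s0 < d \<Longrightarrow> dist (g s) (g s0) < g s0 / 2"
    unfolding continuous_at_eps_delta using g0 half_gt_zero by blast
  have "0 < g s0 / 2 * d" using g0 d by simp
  also have "\<dots> = (LINT s|lborel. g s0 / 2 * indicator {s0 - d / 2..s0 + d / 2} s)" using d by simp
  also have "\<dots> \<le> (LINT s|lborel. g s)"
  proof (rule integral_mono[OF _ int])
    show "integrable lborel (\<lambda>s. g s0 / 2 * indicator {s0 - d / 2..s0 + d / 2} s)"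
      by (intro integrable_mult_right integrable_real_indicator) (auto simp: emeasure_lborel_Icc_eq)
    fix s
    have "g s0 / 2 \<le> g s" if "s \<in> {s0 - d / 2..s0 + d / 2}"
    proof -
      have "dist s s0 < d" using that d(1) by (auto simp: dist_real_def abs_less_iff)
      from d(2)[OF this] have "\<bar>g s - g s0\<bar> < g s0 / 2" by (simp add: dist_real_def)
      then show ?thesis by linarith
    qed
    then show "g s0 / 2 * indicator {s0 - d / 2..s0 + d / 2} s \<le> g s"
      using nonneg by (auto simp: indicator_def)
  qed
  finally show ?thesis .
qed

section \<open>The loss of (i) as a functional of the sample path\<close>

definition spectral_loss :: "nat \<Rightarrow> real \<Rightarrow> nat \<Rightarrow> (int \<Rightarrow> real) \<Rightarrow> real \<Rightarrow> (real \<Rightarrow> real) \<Rightarrow> (real \<Rightarrow> real) \<Rightarrow> real" where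
  "spectral_loss n \<Delta> m w a G x = a * (LINT \<xi>:{-a..a}|lborel. (\<Delta> * smoothed_periodogram n \<Delta> m w x \<xi> - G \<xi>)\<^sup>2)"

lemma measurable_spectral_loss:
  assumes Z: "\<And>t. Z t \<in> borel_measurable M" and [measurable]: "G \<in> borel_measurable borel"
  shows "(\<lambda>y. spectral_loss n \<Delta> m w a G (\<lambda>t. Z t y)) \<in> borel_measurable M"
proof -
  note [measurable] = measurable_smoothed_periodogram[OF Z]
  show ?thesis unfolding spectral_loss_def set_lebesgue_integral_def by measurable
qed

lemma spectral_loss_nonneg: "a \<ge> 0 \<Longrightarrow> 0 \<le> spectral_loss n \<Delta> m w a G x"
  unfolding spectral_loss_def by (intro mult_nonneg_nonneg set_integral_nonneg) auto

lemma tendsto_spectral_loss: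
  assumes w: "\<And>k. \<bar>k\<bar> \<le> int m \<Longrightarrow> 0 \<le> w k" "(\<Sum>k\<in>{- int m..int m}. w k) = 1" and \<Delta>: "\<Delta> \<ge> 0"
    and G: "continuous_on UNIV G" "\<And>\<xi>. \<bar>G \<xi>\<bar> \<le> b"
    and x: "\<And>j. j \<in> {1..n} \<Longrightarrow> (\<lambda>i. x i (real j * \<Delta>)) \<longlonglongrightarrow> z (real j * \<Delta>)"
    and z: "(\<Sum>j=1..n. (z (real j * \<Delta>))\<^sup>2) \<noteq> 0"
  shows "(\<lambda>i. spectral_loss n \<Delta> m w a G (x i)) \<longlonglongrightarrow> spectral_loss n \<Delta> m w a G z"
proof -
  let ?h = "\<lambda>y \<xi>. indicator {-a..a} \<xi> *\<^sub>R (\<Delta> * smoothed_periodogram n \<Delta> m w y \<xi> - G \<xi>)\<^sup>2"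
  let ?b = "(\<Delta> * real n + b)\<^sup>2"
  have [measurable]: "smoothed_periodogram n \<Delta> m w y \<in> borel_measurable borel" for y
    by (rule borel_measurable_continuous_onI[OF continuous_smoothed_periodogram])
  have [measurable]: "G \<in> borel_measurable borel" by (rule borel_measurable_continuous_onI[OF G(1)])
  have "(\<lambda>i. LINT \<xi>|lborel. ?h (x i) \<xi>) \<longlonglongrightarrow> (LINT \<xi>|lborel. ?h z \<xi>)"
  proof (rule integral_dominated_convergence[where w="\<lambda>\<xi>. ?b * indicator {-a..a} \<xi>"])
    show "integrable lborel (\<lambda>\<xi>. ?b * indicator {-a..a} \<xi>)"
      by (intro integrable_mult_right integrable_real_indicator) (auto simp: emeasure_lborel_Icc_eq)
    show "AE \<xi> in lborel. (\<lambda>i. ?h (x i) \<xi>) \<longlonglongrightarrow> ?h z \<xi>"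
      by (intro AE_I2 tendsto_intros tendsto_smoothed_periodogram x z)
    show "AE \<xi> in lborel. norm (?h (x i) \<xi>) \<le> ?b * indicator {-a..a} \<xi>" for i
    proof (rule AE_I2)
      fix \<xi>
      let ?s = "smoothed_periodogram n \<Delta> m w (x i) \<xi>"
      have "0 \<le> \<Delta> * ?s" "\<Delta> * ?s \<le> \<Delta> * real n"
        using smoothed_periodogram_bounds[of m w n \<Delta> "x i" \<xi>] w \<Delta> by (auto intro: mult_left_mono)
      then have "\<bar>\<Delta> * ?s - G \<xi>\<bar> \<le> \<bar>\<Delta> * real n + b\<bar>" using G(2)[of \<xi>] by linarith
      then have "(\<Delta> * ?s - G \<xi>)\<^sup>2 \<le> ?b" by (simp add: abs_le_square_iff)
      then show "norm (?h (x i) \<xi>) \<le> ?b * indicator {-a..a} \<xi>" by (simp add: indicator_def)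
    qed
  qed measurable
  then show ?thesis unfolding spectral_loss_def set_lebesgue_integral_def by (intro tendsto_intros)
qed

lemma (in prob_space) expectation_truncated_le:
  assumes [measurable]: "Z \<in> borel_measurable M" and "e > 0"
  shows "expectation (\<lambda>x. min 1 \<bar>Z x\<bar>) \<le> e + prob {x \<in> space M. \<bar>Z x\<bar> > e}"
proof -
  have "expectation (\<lambda>x. min 1 \<bar>Z x\<bar>) \<le> expectation (\<lambda>x. e + indicator {x \<in> space M. \<bar>Z x\<bar> > e} x)"
    using assms(2) by (intro integral_mono integrable_const_bound[where B=1 and f="\<lambda>x. min 1 \<bar>Z x\<bar>"] Bochner_Integration.integrable_add integrable_real_indicator)
      (auto simp: indicator_def less_top[symmetric])
  also have "\<dots> = e + prob {x \<in> space M. \<bar>Z x\<bar> > e}"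
    by (subst Bochner_Integration.integral_add) (auto intro!: integrable_real_indicator simp: less_top[symmetric] prob_space)
  finally show ?thesis .
qed

context compact_kernel
begin

text \<open>Each value is stable with scale the integral of |f|^\<alpha>, which is positive. Hence
  the true sample avoids the zero path, where the periodogram is not continuous.\<close>

lemma moving_average_nonzero:
  assumes sas: "sas_random_measure M \<alpha> \<Lambda>" and \<alpha>: "0 < \<alpha>" "\<alpha> < 2" and X: "moving_average M \<alpha> \<Lambda> f X" and ne: "f t0 \<noteq> 0"
  shows "AE y in M. X t y \<noteq> 0"
proof -
  interpret sas_random_measure M \<alpha> \<Lambda> by (rule sas)
  have cont: "continuous_on UNIV (\<lambda>s. \<bar>f (t - s)\<bar> powr \<alpha>)"
    using \<alpha> by (intro continuous_on_powr' continuous_intros continuous_on_compose2[OF continuous]) auto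
  have int: "integrable lborel (\<lambda>s. \<bar>f (t - s)\<bar> powr \<alpha>)"
  proof (rule Bochner_Integration.integrable_bound)
    show "integrable lborel (\<lambda>s. F powr \<alpha> * indicator {t - L..t + L} s)"
      by (intro integrable_mult_right integrable_real_indicator) (auto simp: emeasure_lborel_Icc_eq)
    show "AE s in lborel. norm (\<bar>f (t - s)\<bar> powr \<alpha>) \<le> norm (F powr \<alpha> * indicator {t - L..t + L} s)"
    proof (rule AE_I2)
      fix s
      show "norm (\<bar>f (t - s)\<bar> powr \<alpha>) \<le> norm (F powr \<alpha> * indicator {t - L..t + L} s)"
        using support[of "t - s"] bounded[of "t - s"] \<alpha> F_nonneg
        by (cases "\<bar>t - s\<bar> > L") (auto simp: indicator_def abs_le_iff intro!: powr_mono2)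
    qed
  qed measurable
  have "(LINT s|lborel. \<bar>f (t - s)\<bar> powr \<alpha>) > 0"
    using ne by (intro integral_continuous_pos[OF cont int, of "t - t0"]) auto
  then show ?thesis
    using X int by (intro stable_integral_nonzero[OF \<alpha>, of "\<lambda>s. f (t - s)"]) (auto simp: moving_average_def)
qed

end

lemma (in prob_space) tendsto_truncated_expectation:
  fixes Z :: "nat \<Rightarrow> 'a \<Rightarrow> real"
  assumes meas [measurable]: "\<And>i. Z i \<in> borel_measurable M"
    and conv: "\<And>e. e > 0 \<Longrightarrow> (\<lambda>i. prob {x \<in> space M. \<bar>Z i x\<bar> > e}) \<longlonglongrightarrow> 0"
  shows "(\<lambda>i. expectation (\<lambda>x. min 1 \<bar>Z i x\<bar>)) \<longlonglongrightarrow> 0"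
proof (rule LIMSEQ_I)
  fix r :: real assume r: "r > 0"
  have "\<forall>\<^sub>F i in sequentially. prob {x \<in> space M. \<bar>Z i x\<bar> > r / 2} < r / 2"
    using order_tendstoD(2)[OF conv[of "r / 2"], of "r / 2"] r by simp
  then obtain N where N: "\<And>i. i \<ge> N \<Longrightarrow> prob {x \<in> space M. \<bar>Z i x\<bar> > r / 2} < r / 2"
    by (auto simp: eventually_sequentially)
  show "\<exists>N. \<forall>i\<ge>N. norm (expectation (\<lambda>x. min 1 \<bar>Z i x\<bar>) - 0) < r"
  proof (intro exI[of _ N] allI impI)
    fix i assume "i \<ge> N"
    have "expectation (\<lambda>x. min 1 \<bar>Z i x\<bar>) \<le> r / 2 + prob {x \<in> space M. \<bar>Z i x\<bar> > r / 2}"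
      using r by (intro expectation_truncated_le) auto
    moreover have "0 \<le> expectation (\<lambda>x. min 1 \<bar>Z i x\<bar>)" by (intro Bochner_Integration.integral_nonneg) auto
    ultimately show "norm (expectation (\<lambda>x. min 1 \<bar>Z i x\<bar>) - 0) < r" using N[OF \<open>i \<ge> N\<close>] by simp
  qed
qed

context compact_kernel
begin

text \<open>\<open>risk_le\<close> bounds the truncated loss of the discretized paths uniformly in
  \<open>i\<close>. The sample involves finitely many times, so along a subsequence the discretized
  samples converge almost surely, and bounded convergence hands the bound to the true moving
  average.\<close>

lemma spectral_loss_expectation_le:
  fixes n m :: nat and \<Delta> \<kappa> a wm :: real and w :: "int \<Rightarrow> real"
  assumes sas: "sas_random_measure M \<alpha> \<Lambda>" and \<alpha>: "0 < \<alpha>" "\<alpha> < 2" and X: "moving_average M \<alpha> \<Lambda> f X"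
    and ne: "f t0 \<noteq> 0" and energy: "energy > 0"
    and n: "n > 0" and \<Delta>: "0 < \<Delta>" "\<Delta> \<le> 1" and \<kappa>: "\<And>s t. \<bar>s - t\<bar> < \<Delta> \<Longrightarrow> \<bar>f s - f t\<bar> \<le> \<kappa>"
    and w: "\<And>k. \<bar>k\<bar> \<le> int m \<Longrightarrow> 0 \<le> w k" "\<And>k. \<bar>k\<bar> \<le> int m \<Longrightarrow> w k \<le> wm" "(\<Sum>k\<in>{- int m..int m}. w k) = 1"
    and m: "2 * m \<le> n" and T: "real n * \<Delta> \<ge> 1" and a: "a \<ge> 0"
  shows "prob_space.expectation M (\<lambda>y. min 1 (spectral_loss n \<Delta> m w a (\<lambda>\<xi>. (cmod (fourier f \<xi>))\<^sup>2 / energy) (\<lambda>t. X t y)))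
    \<le> C_risk * (1 + a\<^sup>2) * ((\<kappa> + a * \<Delta> + sqrt (second_moment_weight m w) / (real n * \<Delta>))\<^sup>2 + wm + 1 / (real n * \<Delta>))"
proof -
  interpret sas: sas_random_measure M \<alpha> \<Lambda> by (rule sas)
  let ?G = "\<lambda>\<xi>. (cmod (fourier f \<xi>))\<^sup>2 / energy"
  let ?R = "C_risk * (1 + a\<^sup>2) * ((\<kappa> + a * \<Delta> + sqrt (second_moment_weight m w) / (real n * \<Delta>))\<^sup>2 + wm + 1 / (real n * \<Delta>))"
  have grid: "sampling_grid f L F \<Delta> \<kappa> (Suc i) n" for i
    using \<Delta> n \<kappa> by unfold_locales auto
  have sgrid: "stable_grid f L F \<Delta> \<kappa> (Suc i) n M \<alpha> \<Lambda>" for i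
    by (intro stable_grid.intro grid sas stable_grid_axioms.intro \<alpha>)
  define c where "c i k = stable_grid.cell \<Delta> (Suc i) k" for i k
  define Z where "Z i y t = (\<Sum>k\<in>sampling_grid.K L \<Delta> (Suc i) n. f (t - sampling_grid.s \<Delta> (Suc i) k) * \<Lambda> (c i k) y)" for i y t
  have Xm [measurable]: "X t \<in> borel_measurable M" for t
    using X by (simp add: moving_average_def is_stable_integral_def)
  have Zm [measurable]: "(\<lambda>y. Z i y t) \<in> borel_measurable M" for i t
    unfolding Z_def c_def
    by (intro borel_measurable_sum borel_measurable_times borel_measurable_const sas.random_variable_values
        stable_grid.cell_props[OF sgrid])
  have G: "continuous_on UNIV ?G" "\<bar>?G \<xi>\<bar> \<le> B\<^sup>2 / energy" "?G \<in> borel_measurable borel" for \<xi>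
  proof -
    show "continuous_on UNIV ?G" using energy by (intro continuous_intros continuous_fourier) auto
    then show "?G \<in> borel_measurable borel" by (rule borel_measurable_continuous_onI)
    show "\<bar>?G \<xi>\<bar> \<le> B\<^sup>2 / energy"
      using energy cmod_fourier_le_B[of \<xi>] by (auto intro!: divide_right_mono power_mono)
  qed
  have bound: "sas.expectation (\<lambda>y. min 1 (spectral_loss n \<Delta> m w a ?G (Z i y))) \<le> ?R" for i
  proof -
    interpret sg: stable_grid f L F \<Delta> \<kappa> "Suc i" n M \<alpha> \<Lambda> by (rule sgrid)
    interpret sm: smoothed_grid f L F \<Delta> \<kappa> "Suc i" n M "\<lambda>k. \<Lambda> (sg.cell k)" sg.\<mu> w m wm a
      by (intro smoothed_grid.intro smoothed_grid_axioms.intro sg.noisy_grid_cells w m T a)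
    have "Z i y = sm.path y" for y
      unfolding Z_def c_def sm.path_def ..
    then show ?thesis using sm.risk_le[OF energy] unfolding spectral_loss_def sm.rate_def by simp
  qed
  have conv: "(\<lambda>i. sas.prob {y \<in> space M. \<bar>Z i y (real j * \<Delta>) - X (real j * \<Delta>) y\<bar> > e}) \<longlonglongrightarrow> 0"
    if j: "j \<in> {1..n}" and e: "e > 0" for j e
  proof (rule LIMSEQ_I)
    fix r :: real assume r: "r > 0"
    define C where "C = 4 * (4 / e) powr \<alpha> * 2 powr \<alpha> * ((real n + 2 * real (sampling_grid.l L \<Delta>) + 1) * \<Delta>)"
    have C: "C > 0" unfolding C_def using e \<Delta> by (intro mult_pos_pos) auto
    \<comment> \<open>Chosen so that the bound C d^\<alpha> of \<open>path_close\<close> equals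
      r/2.\<close>
    define d where "d = (r / (2 * C)) powr (1 / \<alpha>)"
    have d: "d > 0" "d powr \<alpha> = r / (2 * C)" using r C \<alpha> by (auto simp: d_def powr_powr)
    obtain \<eta> where \<eta>: "\<eta> > 0" "\<And>s t. \<bar>s - t\<bar> < \<eta> \<Longrightarrow> \<bar>f s - f t\<bar> < d"
      using uniformly_continuous d(1) unfolding uniformly_continuous_on_def dist_real_def by blast
    have "(\<lambda>i. \<Delta> * (1 / real (Suc i))) \<longlonglongrightarrow> \<Delta> * 0" by (intro tendsto_intros LIMSEQ_Suc[OF lim_1_over_n])
    then have "\<forall>\<^sub>F i in sequentially. \<Delta> * (1 / real (Suc i)) < \<eta>" using \<eta>(1) by (intro order_tendstoD(2)) auto
    then obtain N where N: "\<And>i. i \<ge> N \<Longrightarrow> \<Delta> / real (Suc i) < \<eta>" by (auto simp: eventually_sequentially)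
    show "\<exists>N. \<forall>i\<ge>N. norm (sas.prob {y \<in> space M. \<bar>Z i y (real j * \<Delta>) - X (real j * \<Delta>) y\<bar> > e} - 0) < r"
    proof (intro exI[of _ N] allI impI)
      fix i assume i: "i \<ge> N"
      interpret sg: stable_grid f L F \<Delta> \<kappa> "Suc i" n M \<alpha> \<Lambda> by (rule sgrid)
      have "sas.prob {y \<in> space M. \<bar>Z i y (real j * \<Delta>) - X (real j * \<Delta>) y\<bar> > e}
        \<le> 4 * (4 / e) powr \<alpha> * 2 powr \<alpha> * (d powr \<alpha> * ((real n + 2 * real sg.l + 1) * \<Delta>))"
        unfolding Z_def c_def
      proof (rule sg.path_close[OF X])
        fix s t assume "\<bar>s - t\<bar> \<le> \<Delta> / real (Suc i)"
        then show "\<bar>f s - f t\<bar> \<le> d" using N[OF i] \<eta>(2)[of s t] by linarith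
      qed (use j e d in auto)
      also have "\<dots> = C * d powr \<alpha>" by (simp add: C_def mult_ac)
      also have "\<dots> < r" using r C by (simp add: d(2))
      finally show "norm (sas.prob {y \<in> space M. \<bar>Z i y (real j * \<Delta>) - X (real j * \<Delta>) y\<bar> > e} - 0) < r" by simp
    qed
  qed
  \<comment> \<open>Truncated deviations converge in mean, and adding them over all observation
    times lets one almost sure subsequence serve every time at once.\<close>
  define U where "U i y = (\<Sum>j=1..n. min 1 \<bar>Z i y (real j * \<Delta>) - X (real j * \<Delta>) y\<bar>)" for i y
  have Uint: "integrable M (\<lambda>y. min 1 \<bar>Z i y (real j * \<Delta>) - X (real j * \<Delta>) y\<bar>)" for i j
    by (intro sas.integrable_const_bound[where B=1]) auto
  have "(\<lambda>i. \<Sum>j=1..n. sas.expectation (\<lambda>y. min 1 \<bar>Z i y (real j * \<Delta>) - X (real j * \<Delta>) y\<bar>)) \<longlonglongrightarrow> (\<Sum>j=1..n. 0)"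
    by (intro tendsto_sum sas.tendsto_truncated_expectation conv) auto
  then have U0: "(\<lambda>i. sas.expectation (\<lambda>y. norm (U i y))) \<longlonglongrightarrow> 0"
    using Uint by (simp add: U_def sum_nonneg Bochner_Integration.integral_sum)
  obtain r where r: "strict_mono r" "AE y in M. (\<lambda>i. U (r i) y) \<longlonglongrightarrow> 0"
  proof -
    have "integrable M (U i)" for i
      unfolding U_def[abs_def] by (intro Bochner_Integration.integrable_sum Uint)
    from tendsto_L1_AE_subseq[OF this U0] show ?thesis using that by blast
  qed
  have X1: "AE y in M. X \<Delta> y \<noteq> 0"
    by (rule moving_average_nonzero[OF sas \<alpha> X ne])
  have AE: "AE y in M. (\<lambda>i. min 1 (spectral_loss n \<Delta> m w a ?G (Z (r i) y))) \<longlonglongrightarrow> min 1 (spectral_loss n \<Delta> m w a ?G (\<lambda>t. X t y))"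
    using r(2) X1
  proof eventually_elim
    case (elim y)
    have z: "(\<lambda>i. Z (r i) y (real j * \<Delta>)) \<longlonglongrightarrow> X (real j * \<Delta>) y" if j: "j \<in> {1..n}" for j
    proof -
      have le: "min 1 \<bar>Z (r i) y (real j * \<Delta>) - X (real j * \<Delta>) y\<bar> \<le> U (r i) y" for i
        unfolding U_def using j by (intro member_le_sum[where f="\<lambda>j. min 1 \<bar>Z (r i) y (real j * \<Delta>) - X (real j * \<Delta>) y\<bar>"]) auto
      have "(\<lambda>i. Z (r i) y (real j * \<Delta>) - X (real j * \<Delta>) y) \<longlonglongrightarrow> 0"
      proof (rule Lim_null_comparison)
        show "\<forall>\<^sub>F i in sequentially. norm (Z (r i) y (real j * \<Delta>) - X (real j * \<Delta>) y) \<le> U (r i) y"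
        proof -
          have "\<forall>\<^sub>F i in sequentially. U (r i) y < 1"
            using order_tendstoD(2)[OF elim(1), of 1] by simp
          then show ?thesis
          proof (rule eventually_mono)
            fix i assume "U (r i) y < 1"
            then show "norm (Z (r i) y (real j * \<Delta>) - X (real j * \<Delta>) y) \<le> U (r i) y"
              using le[of i] by (auto simp: min_def split: if_splits)
          qed
        qed
      qed (rule elim(1))
      then show ?thesis by (rule LIM_zero_cancel)
    qed
    have "(X (real 1 * \<Delta>) y)\<^sup>2 \<le> (\<Sum>j=1..n. (X (real j * \<Delta>) y)\<^sup>2)"
      using n by (intro member_le_sum[where f="\<lambda>j. (X (real j * \<Delta>) y)\<^sup>2"]) auto
    moreover have "(X (real 1 * \<Delta>) y)\<^sup>2 > 0" using elim(2) by simp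
    ultimately have nz: "(\<Sum>j=1..n. (X (real j * \<Delta>) y)\<^sup>2) \<noteq> 0" by linarith
    have "(\<lambda>i. spectral_loss n \<Delta> m w a ?G (Z (r i) y)) \<longlonglongrightarrow> spectral_loss n \<Delta> m w a ?G (\<lambda>t. X t y)"
      using \<Delta> by (intro tendsto_spectral_loss[OF w(1) w(3) _ G(1) G(2) z nz]) auto
    then show ?case by (intro tendsto_intros)
  qed
  have "(\<lambda>i. sas.expectation (\<lambda>y. min 1 (spectral_loss n \<Delta> m w a ?G (Z (r i) y)))) \<longlonglongrightarrow>
    sas.expectation (\<lambda>y. min 1 (spectral_loss n \<Delta> m w a ?G (\<lambda>t. X t y)))"
  proof (rule integral_dominated_convergence[where w="\<lambda>_. 1"])
    have "(\<lambda>y. spectral_loss n \<Delta> m w a ?G (\<lambda>t. (\<lambda>t y. Z i y t) t y)) \<in> borel_measurable M" for i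
      by (rule measurable_spectral_loss) (auto intro: G(3))
    then show "(\<lambda>y. min 1 (spectral_loss n \<Delta> m w a ?G (Z (r i) y))) \<in> borel_measurable M" for i by simp
    have "(\<lambda>y. spectral_loss n \<Delta> m w a ?G (\<lambda>t. X t y)) \<in> borel_measurable M"
      by (rule measurable_spectral_loss) (auto intro: G(3))
    then show "(\<lambda>y. min 1 (spectral_loss n \<Delta> m w a ?G (\<lambda>t. X t y))) \<in> borel_measurable M" by simp
    show "AE y in M. norm (min 1 (spectral_loss n \<Delta> m w a ?G (Z (r i) y))) \<le> 1" for i
      using spectral_loss_nonneg[OF a, of n \<Delta> m w ?G] by (intro AE_I2) (simp add: min_def)
  qed (use AE in auto)
  then show ?thesis by (rule LIMSEQ_le_const2) (use bound in auto)
qed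

end

subsection \<open>Plancherel's identity\<close>


text \<open>Plancherel's identity by Gaussian summation: damping \<open>\<bar>fourier u\<bar>\<^sup>2\<close> with a wide Gaussian amounts
  to correlating \<open>u\<close> with its translates over a narrow one.\<close>

lemma std_normal_integral:
  fixes g :: "real \<Rightarrow> 'b::{banach, second_countable_topology}"
  assumes [measurable]: "g \<in> borel_measurable borel"
  shows "(LINT z|std_normal. g z) = (LINT z|lborel. std_normal_density z *\<^sub>R g z)"
  by (rule integral_density) auto

text \<open>Covers both the continuous kernel and a spectrum that jumps at the cut-off
  frequencies.\<close>

locale bounded_compact_function =
  fixes u :: "real \<Rightarrow> real" and A c :: real
  assumes measurable_u [measurable]: "u \<in> borel_measurable borel"
    and bound: "\<And>x. \<bar>u x\<bar> \<le> c * indicator {-A..A} x" and c_nonneg: "c \<ge> 0"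
begin

lemma integrable_dom: "integrable lborel (\<lambda>x. c * indicator {-A..A} x :: real)"
  by (intro integrable_mult_right integrable_real_indicator) (auto simp: emeasure_lborel_Icc_eq)

lemma u_le: "\<bar>u x\<bar> \<le> c"
  using bound[of x] c_nonneg by (cases "x \<in> {-A..A}") auto

lemma integrable_u: "integrable lborel u"
  by (rule Bochner_Integration.integrable_bound[OF integrable_dom])
    (auto intro!: AE_I2 intro: order_trans[OF bound abs_ge_self])

lemma integrable_u_iexp: "integrable lborel (\<lambda>x. complex_of_real (u x) * iexp (t * x))"
  by (rule Bochner_Integration.integrable_bound[OF integrable_u]) (auto simp: norm_mult)

lemma cmod_fourier_le: "cmod (fourier u t) \<le> (LINT x|lborel. \<bar>u x\<bar>)"
  unfolding fourier_eq_lborel[OF measurable_u]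
  by (rule order_trans[OF integral_norm_bound]) (simp add: norm_mult)

lemma integrable_pair: "integrable (lborel \<Otimes>\<^sub>M lborel) (\<lambda>(x, y). u x * u y)"
proof -
  have "integrable (lborel \<Otimes>\<^sub>M lborel) (\<lambda>(x, y). u x *\<^sub>R u y)"
    by (rule lborel_pair.Fubini_integrable) (use integrable_u in \<open>auto intro!: integrable_mult_left simp: abs_mult\<close>)
  then show ?thesis by simp
qed

lemma cmod_fourier_sq:
  "complex_of_real ((cmod (fourier u t))\<^sup>2) = (CLINT p|(lborel \<Otimes>\<^sub>M lborel). complex_of_real (u (fst p) * u (snd p)) * iexp (t * (snd p - fst p)))"
proof -
  have int: "integrable (lborel \<Otimes>\<^sub>M lborel) (\<lambda>p. complex_of_real (u (fst p) * u (snd p)) * iexp (t * (snd p - fst p)))"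
    by (rule Bochner_Integration.integrable_bound[OF integrable_pair]) (auto simp: norm_mult case_prod_beta)
  have cn: "cnj (fourier u t) = (LINT y|lborel. complex_of_real (u y) * iexp (t * y))"
  proof -
    have "cnj (fourier u t) = (LINT x|lborel. cnj (complex_of_real (u x) * iexp (- (t * x))))"
      unfolding fourier_eq_lborel[OF measurable_u] by (rule Bochner_Integration.integral_cnj[symmetric])
    then show ?thesis by (simp add: exp_cnj)
  qed
  have "(CLINT p|(lborel \<Otimes>\<^sub>M lborel). complex_of_real (u (fst p) * u (snd p)) * iexp (t * (snd p - fst p)))
      = (CLINT x|lborel. CLINT y|lborel. complex_of_real (u x * u y) * iexp (t * (y - x)))"
    using lborel_pair.integral_fst'[OF int] by simp
  also have "\<dots> = (CLINT x|lborel. CLINT y|lborel. (complex_of_real (u x) * iexp (- (t * x))) * (complex_of_real (u y) * iexp (t * y)))"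
    by (intro Bochner_Integration.integral_cong refl) (simp add: exp_add[symmetric] exp_diff algebra_simps exp_minus divide_inverse)
  also have "\<dots> = fourier u t * cnj (fourier u t)"
    unfolding cn by (simp add: fourier_eq_lborel[OF measurable_u])
  finally show ?thesis by (simp only: complex_norm_square)
qed

text \<open>After the substitution z = \<sigma> t the damping is a standard normal weight. Fubini's
  theorem produces its characteristic function, again a Gaussian, in the variable (y - x)/\<sigma>;
  the substitution y = x + \<sigma> z turns that into an average over translates. Each of the two
  densities contributes a factor sqrt(2 pi).\<close>

lemma damped_plancherel:
  assumes \<sigma>: "\<sigma> > 0"
  shows "integrable lborel (\<lambda>t. (cmod (fourier u t))\<^sup>2 * exp (- ((\<sigma> * t)\<^sup>2 / 2)))"
    and "(LINT t|lborel. (cmod (fourier u t))\<^sup>2 * exp (- ((\<sigma> * t)\<^sup>2 / 2)))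
      = 2 * pi * (LINT x|lborel. LINT z|std_normal. u x * u (x + \<sigma> * z))"
proof -
  note [measurable] = borel_measurable_fourier[OF measurable_u]
  interpret PP: pair_sigma_finite "lborel \<Otimes>\<^sub>M lborel :: (real \<times> real) measure" std_normal
    by (intro pair_sigma_finite.intro sigma_finite_pair_measure lborel.sigma_finite_measure_axioms std_normal.sigma_finite_measure_axioms)
  let ?h = "\<lambda>t. (cmod (fourier u t))\<^sup>2 * exp (- ((\<sigma> * t)\<^sup>2 / 2))"
  let ?F = "\<lambda>z. (cmod (fourier u (z / \<sigma>)))\<^sup>2"
  define b where "b = (LINT x|lborel. \<bar>u x\<bar>)"
  have Fb: "?F z \<le> b\<^sup>2" for z unfolding b_def by (intro power_mono cmod_fourier_le) auto
  have iF: "integrable std_normal ?F"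
    using Fb by (intro std_normal.integrable_const_bound[where B="b\<^sup>2"]) auto
  have iF2: "integrable lborel (\<lambda>z. std_normal_density z *\<^sub>R ?F z)"
    using iF by (subst (asm) integrable_density) auto
  have dens: "std_normal_density z *\<^sub>R ?F z = (1 / sqrt (2 * pi)) * ?h (0 + 1 / \<sigma> * z)" for z
    using \<sigma> by (simp add: std_normal_density_def mult_ac)
  have ih: "integrable lborel (\<lambda>z. ?h (0 + 1 / \<sigma> * z))"
  proof -
    have "integrable lborel (\<lambda>z. sqrt (2 * pi) * (std_normal_density z *\<^sub>R ?F z))"
      by (rule integrable_mult_right[OF iF2])
    then show ?thesis unfolding dens by simp
  qed
  then show "integrable lborel ?h"
    using lborel_integrable_real_affine_iff[of "1 / \<sigma>" ?h 0] \<sigma> by simp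
  have "(LINT t|lborel. ?h t) = \<bar>1 / \<sigma>\<bar> *\<^sub>R (LINT z|lborel. ?h (0 + 1 / \<sigma> * z))"
    using \<sigma> by (intro lborel_integral_real_affine) auto
  also have "(LINT z|lborel. ?h (0 + 1 / \<sigma> * z)) = sqrt (2 * pi) * (LINT z|lborel. std_normal_density z *\<^sub>R ?F z)"
    unfolding dens by simp
  also have "(LINT z|lborel. std_normal_density z *\<^sub>R ?F z) = (LINT z|std_normal. ?F z)"
    by (rule std_normal_integral[symmetric]) measurable
  finally have lhs: "(LINT t|lborel. ?h t) = sqrt (2 * pi) / \<sigma> * (LINT z|std_normal. ?F z)"
    using \<sigma> by simp
  let ?U = "\<lambda>p. u (fst p) * u (snd p)"
  have iU: "integrable (lborel \<Otimes>\<^sub>M lborel) ?U" using integrable_pair by (simp add: case_prod_beta')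
  have int: "integrable ((lborel \<Otimes>\<^sub>M lborel) \<Otimes>\<^sub>M std_normal) (\<lambda>(p, z). complex_of_real (?U p) * iexp (z / \<sigma> * (snd p - fst p)))"
  proof (rule PP.Fubini_integrable)
    show "AE p in lborel \<Otimes>\<^sub>M lborel. integrable std_normal (\<lambda>z. case (p, z) of (p, z) \<Rightarrow> complex_of_real (?U p) * iexp (z / \<sigma> * (snd p - fst p)))"
    proof (rule AE_I2)
      fix p :: "real \<times> real"
      show "integrable std_normal (\<lambda>z. case (p, z) of (p, z) \<Rightarrow> complex_of_real (?U p) * iexp (z / \<sigma> * (snd p - fst p)))"
        by (intro std_normal.integrable_const_bound[where B="\<bar>?U p\<bar>"]) (auto simp: norm_mult abs_mult)
    qed
  qed (use integrable_norm[OF iU] std_normal.prob_space in \<open>auto simp: norm_mult abs_mult case_prod_beta\<close>)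
  have "complex_of_real (LINT z|std_normal. ?F z) = (CLINT z|std_normal. CLINT p|(lborel \<Otimes>\<^sub>M lborel). complex_of_real (?U p) * iexp (z / \<sigma> * (snd p - fst p)))"
    by (simp only: integral_complex_of_real[symmetric] cmod_fourier_sq)
  also have "\<dots> = (CLINT p|(lborel \<Otimes>\<^sub>M lborel). CLINT z|std_normal. complex_of_real (?U p) * iexp (z / \<sigma> * (snd p - fst p)))"
    using PP.Fubini_integral[OF int] by simp
  also have "\<dots> = (CLINT p|(lborel \<Otimes>\<^sub>M lborel). complex_of_real (?U p) * char std_normal ((snd p - fst p) / \<sigma>))"
    by (simp add: char_def mult_ac)
  also have "\<dots> = complex_of_real (LINT p|(lborel \<Otimes>\<^sub>M lborel). ?U p * exp (- (((snd p - fst p) / \<sigma>)\<^sup>2 / 2)))"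
    unfolding char_std_normal_distribution by (simp flip: integral_complex_of_real)
  finally have mid: "(LINT z|std_normal. ?F z) = (LINT p|(lborel \<Otimes>\<^sub>M lborel). ?U p * exp (- (((snd p - fst p) / \<sigma>)\<^sup>2 / 2)))"
    by (simp only: of_real_eq_iff)
  have iG: "integrable (lborel \<Otimes>\<^sub>M lborel) (\<lambda>p. ?U p * exp (- (((snd p - fst p) / \<sigma>)\<^sup>2 / 2)))"
    by (rule Bochner_Integration.integrable_bound[OF iU]) (auto simp: abs_mult intro!: mult_left_le AE_I2)
  have "(LINT p|(lborel \<Otimes>\<^sub>M lborel). ?U p * exp (- (((snd p - fst p) / \<sigma>)\<^sup>2 / 2)))
    = (LINT x|lborel. LINT y|lborel. u x * u y * exp (- (((y - x) / \<sigma>)\<^sup>2 / 2)))"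
    using lborel_pair.integral_fst'[OF iG] by simp
  also have "\<dots> = (LINT x|lborel. \<sigma> * sqrt (2 * pi) * (LINT z|std_normal. u x * u (x + \<sigma> * z)))"
  proof (intro Bochner_Integration.integral_cong refl)
    fix x
    have "(LINT y|lborel. u x * u y * exp (- (((y - x) / \<sigma>)\<^sup>2 / 2)))
      = \<bar>\<sigma>\<bar> *\<^sub>R (LINT z|lborel. u x * u (x + \<sigma> * z) * exp (- (((x + \<sigma> * z - x) / \<sigma>)\<^sup>2 / 2)))"
      using \<sigma> by (intro lborel_integral_real_affine) auto
    also have "(LINT z|lborel. u x * u (x + \<sigma> * z) * exp (- (((x + \<sigma> * z - x) / \<sigma>)\<^sup>2 / 2)))
      = (LINT z|lborel. sqrt (2 * pi) * (std_normal_density z *\<^sub>R (u x * u (x + \<sigma> * z))))"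
      using \<sigma> by (intro Bochner_Integration.integral_cong refl) (simp add: std_normal_density_def)
    also have "\<dots> = sqrt (2 * pi) * (LINT z|std_normal. u x * u (x + \<sigma> * z))"
      by (subst std_normal_integral) simp_all
    finally show "(LINT y|lborel. u x * u y * exp (- (((y - x) / \<sigma>)\<^sup>2 / 2))) = \<sigma> * sqrt (2 * pi) * (LINT z|std_normal. u x * u (x + \<sigma> * z))"
      using \<sigma> by simp
  qed
  also have "\<dots> = \<sigma> * sqrt (2 * pi) * (LINT x|lborel. LINT z|std_normal. u x * u (x + \<sigma> * z))" by simp
  finally show "(LINT t|lborel. ?h t) = 2 * pi * (LINT x|lborel. LINT z|std_normal. u x * u (x + \<sigma> * z))"
    unfolding lhs mid using \<sigma> by simp
qed

text \<open>As \<sigma> decreases to 0, the spectral side increases, so monotone convergence gives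
  integrability along with the value. The other side converges by domination, at every point of
  continuity of \<open>u\<close>.\<close>

lemma plancherel:
  assumes cont: "AE x in lborel. isCont u x"
  shows "integrable lborel (\<lambda>t. (cmod (fourier u t))\<^sup>2)"
    and "(LINT t|lborel. (cmod (fourier u t))\<^sup>2) = 2 * pi * (LINT x|lborel. (u x)\<^sup>2)"
proof -
  note [measurable] = borel_measurable_fourier[OF measurable_u]
  let ?s = "\<lambda>i::nat. 1 / real (Suc i)"
  have inner: "(\<lambda>i. LINT z|std_normal. u x * u (x + ?s i * z)) \<longlonglongrightarrow> (LINT z|std_normal. u x * u x)" if x: "isCont u x" for x
  proof (rule integral_dominated_convergence[where w="\<lambda>_. c * c"])
    show "AE z in std_normal. (\<lambda>i. u x * u (x + ?s i * z)) \<longlonglongrightarrow> u x * u x"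
    proof (rule AE_I2)
      fix z
      have "(\<lambda>i. x + ?s i * z) \<longlonglongrightarrow> x + 0 * z"
        by (intro tendsto_intros LIMSEQ_Suc[OF lim_1_over_n])
      then have "(\<lambda>i. u (x + ?s i * z)) \<longlonglongrightarrow> u x" by (intro isCont_tendsto_compose[OF x]) simp
      then show "(\<lambda>i. u x * u (x + ?s i * z)) \<longlonglongrightarrow> u x * u x" by (intro tendsto_intros)
    qed
  qed (use u_le c_nonneg in \<open>auto simp: abs_mult intro!: mult_mono\<close>)
  have lim: "(\<lambda>i. LINT x|lborel. LINT z|std_normal. u x * u (x + ?s i * z)) \<longlonglongrightarrow> (LINT x|lborel. (u x)\<^sup>2)"
  proof (rule integral_dominated_convergence[where w="\<lambda>x. c * (c * indicator {-A..A} x)"])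
    show "AE x in lborel. (\<lambda>i. LINT z|std_normal. u x * u (x + ?s i * z)) \<longlonglongrightarrow> (u x)\<^sup>2"
      using cont
    proof eventually_elim
      case (elim x)
      have "(LINT z|std_normal. u x * u x) = (u x)\<^sup>2" using std_normal.prob_space by (simp add: power2_eq_square)
      then show ?case using inner[OF elim] by simp
    qed
    show "integrable lborel (\<lambda>x. c * (c * indicator {-A..A} x))" by (rule integrable_mult_right[OF integrable_dom])
    show "AE x in lborel. norm (LINT z|std_normal. u x * u (x + ?s i * z)) \<le> c * (c * indicator {-A..A} x)" for i
    proof (rule AE_I2)
      fix x
      have "norm (LINT z|std_normal. u x * u (x + ?s i * z)) \<le> (LINT z|std_normal. c * (c * indicator {-A..A} x))"
      proof (rule Bochner_Integration.integral_norm_bound_integral)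
        have le: "norm (u x * u (x + ?s i * z)) \<le> c * (c * indicator {-A..A} x)" for z
          using mult_mono[OF bound[of x] u_le[of "x + ?s i * z"]] c_nonneg by (simp add: abs_mult mult_ac)
        show "norm (u x * u (x + ?s i * z)) \<le> c * (c * indicator {-A..A} x)" for z by (rule le)
        show "integrable std_normal (\<lambda>z. u x * u (x + ?s i * z))"
          by (intro std_normal.integrable_const_bound[where B="c * (c * indicator {-A..A} x)"] AE_I2 le) measurable
      qed auto
      also have "\<dots> = c * (c * indicator {-A..A} x)" using std_normal.prob_space by simp
      finally show "norm (LINT z|std_normal. u x * u (x + ?s i * z)) \<le> c * (c * indicator {-A..A} x)" .
    qed
  qed measurable
  let ?h = "\<lambda>i t. (cmod (fourier u t))\<^sup>2 * exp (- ((?s i * t)\<^sup>2 / 2))"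
  have "has_bochner_integral lborel (\<lambda>t. (cmod (fourier u t))\<^sup>2) (2 * pi * (LINT x|lborel. (u x)\<^sup>2))"
  proof (rule has_bochner_integral_monotone_convergence[where f="?h"])
    show "integrable lborel (?h i)" for i by (rule damped_plancherel(1)) simp
    show "AE t in lborel. mono (\<lambda>i. ?h i t)"
    proof (intro AE_I2 monoI mult_left_mono)
      fix t and i j :: nat assume "i \<le> j"
      then have "?s j \<le> ?s i" by (intro divide_left_mono) auto
      then have "(?s j * t)\<^sup>2 \<le> (?s i * t)\<^sup>2"
        unfolding power_mult_distrib by (intro mult_right_mono power_mono) auto
      then show "exp (- ((?s i * t)\<^sup>2 / 2)) \<le> exp (- ((?s j * t)\<^sup>2 / 2))" by simp
    qed simp
    show "AE t in lborel. (\<lambda>i. ?h i t) \<longlonglongrightarrow> (cmod (fourier u t))\<^sup>2"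
    proof (rule AE_I2)
      fix t
      have "(\<lambda>i. ?h i t) \<longlonglongrightarrow> (cmod (fourier u t))\<^sup>2 * exp (- ((0 * t)\<^sup>2 / 2))"
        by (intro tendsto_intros LIMSEQ_Suc[OF lim_1_over_n]) auto
      then show "(\<lambda>i. ?h i t) \<longlonglongrightarrow> (cmod (fourier u t))\<^sup>2" by simp
    qed
    have "(\<lambda>i. 2 * pi * (LINT x|lborel. LINT z|std_normal. u x * u (x + ?s i * z))) \<longlonglongrightarrow> 2 * pi * (LINT x|lborel. (u x)\<^sup>2)"
      by (intro tendsto_intros lim)
    then show "(\<lambda>i. LINT t|lborel. ?h i t) \<longlonglongrightarrow> 2 * pi * (LINT x|lborel. (u x)\<^sup>2)"
      by (subst damped_plancherel(2)) auto
  qed measurable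
  then show "integrable lborel (\<lambda>t. (cmod (fourier u t))\<^sup>2)"
    and "(LINT t|lborel. (cmod (fourier u t))\<^sup>2) = 2 * pi * (LINT x|lborel. (u x)\<^sup>2)"
    by (auto simp: has_bochner_integral_iff)
qed

end

subsection \<open>Positive semidefinite kernels\<close>


context sampling_grid
begin

text \<open>Testing semidefiniteness on equidistant points with the weights exp(i \<xi> j \<Delta>)
  gives a Toeplitz sum of N^2 terms, equal to N times \<open>b\<close> up to a boundary error
  bounded in N. Dividing by N exhibits \<open>b\<close> as a limit of nonnegative numbers, so
  Bochner's theorem is not invoked.\<close>

lemma b_nonneg:
  assumes psd: "positive_semidefinite f"
  shows "b (0, 0) \<xi> \<in> \<real>\<^sub>\<ge>\<^sub>0"
proof -
  define h where "h d = complex_of_real (f (of_int d * \<Delta>)) * iexp (\<xi> * (of_int d * \<Delta>))" for d :: int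
  have b: "b (0, 0) \<xi> = (\<Sum>d\<in>{- int l..int l}. h d)" by (simp add: b_def h_def \<rho>_def)
  have K0: "(0, 0) \<in> K" using q_pos by (simp add: K_def)
  have h0: "h d = 0" if "\<bar>d\<bar> > int l" for d
    using f_window[OF K0 that] by (simp add: h_def \<rho>_def)
  have hF: "norm (h d) \<le> F" for d by (simp add: h_def norm_mult bounded)
  define R where "R N j = (\<Sum>i=1..N. h (int i - int j))" for N j
  define S where "S N = (\<Sum>j=1..N. R N j)" for N
  \<comment> \<open>At most 2 l columns are incomplete, and each deviates from \<open>b\<close> by
    at most twice the bound (2 l + 1) F.\<close>
  define D where "D = 4 * real l * ((2 * real l + 1) * F)"
  have S_nonneg: "S N \<in> \<real>\<^sub>\<ge>\<^sub>0" for N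
  proof -
    let ?t = "\<lambda>i. real (Suc i) * \<Delta>" and ?z = "\<lambda>i. iexp (\<xi> * (real (Suc i) * \<Delta>))"
    have "(\<Sum>i<N. \<Sum>j<N. complex_of_real (f (?t i - ?t j)) * ?z i * cnj (?z j)) \<in> \<real>\<^sub>\<ge>\<^sub>0"
      by (rule psd[unfolded positive_semidefinite_def, THEN spec, of N, THEN spec, of ?t, THEN spec, of ?z])
    also have "(\<Sum>i<N. \<Sum>j<N. complex_of_real (f (?t i - ?t j)) * ?z i * cnj (?z j)) = (\<Sum>i<N. \<Sum>j<N. h (int (Suc i) - int (Suc j)))"
    proof (intro sum.cong refl)
      fix i j
      have 1: "?t i - ?t j = of_int (int (Suc i) - int (Suc j)) * \<Delta>" by (simp add: algebra_simps)
      have "?z i * cnj (?z j) = iexp (\<xi> * (real (Suc i) * \<Delta>)) * iexp (- (\<xi> * (real (Suc j) * \<Delta>)))"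
        by (simp add: exp_cnj)
      also have "\<dots> = iexp (\<xi> * (of_int (int (Suc i) - int (Suc j)) * \<Delta>))"
        by (simp only: exp_add[symmetric]) (simp add: algebra_simps)
      finally have 2: "?z i * cnj (?z j) = iexp (\<xi> * (of_int (int (Suc i) - int (Suc j)) * \<Delta>))" .
      show "complex_of_real (f (?t i - ?t j)) * ?z i * cnj (?z j) = h (int (Suc i) - int (Suc j))"
        by (simp only: h_def 1 2 mult.assoc)
    qed
    also have "\<dots> = (\<Sum>j<N. \<Sum>i<N. h (int (Suc i) - int (Suc j)))" by (rule sum.swap)
    also have "\<dots> = S N" unfolding S_def R_def One_nat_def sum.atLeast1_atMost_eq ..
    finally show ?thesis .
  qed
  have close: "cmod (S N - of_nat N * b (0, 0) \<xi>) \<le> D" for N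
  proof -
    define V where "V = (2 * real l + 1) * F"
    have V: "cmod (R N j) \<le> V" "cmod (b (0, 0) \<xi>) \<le> V" for j
    proof -
      show "cmod (R N j) \<le> V" unfolding R_def V_def by (rule norm_sum_window_le[OF h0 hF])
      have "cmod (b (0, 0) \<xi>) \<le> (\<Sum>d\<in>{- int l..int l}. F)" unfolding b by (intro sum_norm_le hF)
      then show "cmod (b (0, 0) \<xi>) \<le> V" by (simp add: V_def)
    qed
    let ?J = "{1..N} - {l + 1..N - l}"
    have "S N - of_nat N * b (0, 0) \<xi> = (\<Sum>j=1..N. R N j - b (0, 0) \<xi>)" by (simp add: S_def sum_subtractf)
    also have "\<dots> = (\<Sum>j\<in>?J. R N j - b (0, 0) \<xi>)"
    proof (rule sum.mono_neutral_right)
      show "\<forall>j\<in>{1..N} - ?J. R N j - b (0, 0) \<xi> = 0"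
      proof
        fix j assume "j \<in> {1..N} - ?J"
        then have "int l + 1 \<le> int j" "int j \<le> int N - int l" by auto
        then show "R N j - b (0, 0) \<xi> = 0" unfolding R_def b using sum_window[OF h0] by simp
      qed
    qed auto
    also have "cmod \<dots> \<le> (\<Sum>j\<in>?J. 2 * V)"
    proof (rule sum_norm_le)
      fix j
      show "cmod (R N j - b (0, 0) \<xi>) \<le> 2 * V" using V norm_triangle_ineq4[of "R N j" "b (0, 0) \<xi>"] by (smt (verit))
    qed
    also have "\<dots> = real (card ?J) * (2 * V)" by simp
    also have "\<dots> \<le> real (2 * l) * (2 * V)"
    proof (intro mult_right_mono of_nat_mono)
      have "?J \<subseteq> {1..l} \<union> {N - l<..N}" by auto
      then have "card ?J \<le> card ({1..l} \<union> {N - l<..N})" by (intro card_mono) auto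
      also have "\<dots> \<le> card {1..l} + card {N - l<..N}" by (rule card_Un_le)
      also have "\<dots> \<le> 2 * l" by simp
      finally show "card ?J \<le> 2 * l" .
    qed (use F_nonneg in \<open>auto simp: V_def\<close>)
    finally show ?thesis by (simp add: D_def V_def algebra_simps)
  qed
  have "(\<lambda>N. S (Suc N) / of_nat (Suc N)) \<longlonglongrightarrow> b (0, 0) \<xi>"
  proof (rule Lim_null_comparison[THEN LIM_zero_cancel])
    show "\<forall>\<^sub>F N in sequentially. norm (S (Suc N) / of_nat (Suc N) - b (0, 0) \<xi>) \<le> D * (1 / real (Suc N))"
    proof (intro always_eventually allI)
      fix N
      have "S (Suc N) / of_nat (Suc N) - b (0, 0) \<xi> = (S (Suc N) - of_nat (Suc N) * b (0, 0) \<xi>) / of_nat (Suc N)"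
        by (simp add: diff_divide_distrib del: of_nat_Suc)
      then have "norm (S (Suc N) / of_nat (Suc N) - b (0, 0) \<xi>) = cmod (S (Suc N) - of_nat (Suc N) * b (0, 0) \<xi>) / real (Suc N)"
        by (simp add: norm_divide del: of_nat_Suc)
      also have "\<dots> \<le> D / real (Suc N)" by (intro divide_right_mono close) auto
      finally show "norm (S (Suc N) / of_nat (Suc N) - b (0, 0) \<xi>) \<le> D * (1 / real (Suc N))" by simp
    qed
    show "(\<lambda>N. D * (1 / real (Suc N))) \<longlonglongrightarrow> 0"
      by (intro tendsto_mult_right_zero LIMSEQ_Suc[OF lim_1_over_n])
  qed
  then show ?thesis
  proof (rule closed_sequentially[OF closed_nonneg_Reals_complex, rotated])
    show "S (Suc N) / of_nat (Suc N) \<in> \<real>\<^sub>\<ge>\<^sub>0" for N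
      using nonneg_Reals_divide_I[OF S_nonneg[of "Suc N"], of "of_nat (Suc N)"] by (simp del: of_nat_Suc)
  qed
qed

end

context compact_kernel
begin

text \<open>The Riemann sums with zero offset are nonnegative by \<open>b_nonneg\<close>; they
  converge to the conjugate of the transform, and the nonnegative reals are closed.\<close>

lemma fourier_nonneg:
  assumes psd: "positive_semidefinite f"
  shows "fourier f \<xi> = of_real (cmod (fourier f \<xi>))"
proof -
  have "cnj (fourier f \<xi>) \<in> closure \<real>\<^sub>\<ge>\<^sub>0"
  proof (unfold closure_approachable, intro allI impI)
    fix e :: real assume e: "e > 0"
    \<comment> \<open>The oscillations of the kernel and of the phase are each made at most
      \<open>\<kappa>\<close>, so the error is at most 2 \<open>width\<close>
      \<open>\<kappa>\<close> = e/2.\<close>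
    define \<kappa> where "\<kappa> = e / (4 * width)"
    have \<kappa>: "\<kappa> > 0" using e width_pos by (simp add: \<kappa>_def)
    obtain d where d: "d > 0" "\<And>s t. \<bar>s - t\<bar> < d \<Longrightarrow> \<bar>f s - f t\<bar> < \<kappa>"
      using uniformly_continuous \<kappa> unfolding uniformly_continuous_on_def dist_real_def by blast
    define \<Delta> where "\<Delta> = min (min d 1) (\<kappa> / (F * \<bar>\<xi>\<bar> + 1))"
    have p1: "F * \<bar>\<xi>\<bar> + 1 > 0" using F_nonneg by (simp add: add_nonneg_pos)
    have \<Delta>: "\<Delta> > 0" "\<Delta> \<le> 1" "\<Delta> \<le> d" "\<Delta> \<le> \<kappa> / (F * \<bar>\<xi>\<bar> + 1)"
      using d \<kappa> p1 by (auto simp: \<Delta>_def)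
    have "\<Delta> * (F * \<bar>\<xi>\<bar> + 1) \<le> \<kappa>" using \<Delta>(4) p1 by (simp add: pos_le_divide_eq)
    then have small: "F * \<bar>\<xi>\<bar> * \<Delta> \<le> \<kappa>" using \<Delta>(1) by (simp add: algebra_simps)
    interpret sampling_grid f L F \<Delta> \<kappa> 1 1
      using \<Delta> d(2) by unfold_locales (auto intro!: less_imp_le)
    have K0: "(0, 0) \<in> K" unfolding K_def by simp
    have "cmod (of_real \<Delta> * b (0, 0) \<xi> - cnj (fourier f \<xi>)) \<le> width * (\<kappa> + F * \<bar>\<xi>\<bar> * \<Delta>)"
    proof -
      have "\<rho> (0, 0) = 0" unfolding \<rho>_def by simp
      then show ?thesis using b_approx[OF K0, of \<xi>] by (simp del: One_nat_def)
    qed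
    also have "\<dots> \<le> width * (\<kappa> + \<kappa>)" using small width_pos by (intro mult_left_mono) auto
    also have "\<dots> < e" using e width_pos by (simp add: \<kappa>_def)
    finally have "dist (of_real \<Delta> * b (0, 0) \<xi>) (cnj (fourier f \<xi>)) < e" by (simp add: dist_norm)
    moreover have "of_real \<Delta> * b (0, 0) \<xi> \<in> \<real>\<^sub>\<ge>\<^sub>0"
      using \<Delta>(1) by (intro nonneg_Reals_mult_I b_nonneg psd) auto
    ultimately show "\<exists>y\<in>\<real>\<^sub>\<ge>\<^sub>0. dist y (cnj (fourier f \<xi>)) < e" by blast
  qed
  then have "cnj (fourier f \<xi>) \<in> \<real>\<^sub>\<ge>\<^sub>0" using closed_nonneg_Reals_complex by (simp add: closure_closed)
  then obtain r where r: "cnj (fourier f \<xi>) = of_real r" "r \<ge> 0" by (auto elim: nonneg_Reals_cases)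
  then have "fourier f \<xi> = of_real r" by (metis complex_cnj_cnj complex_cnj_complex_of_real)
  then show ?thesis using r(2) by simp
qed

end

section \<open>The distance between a kernel and the inverse transform of a truncated
  spectrum\<close>

context compact_kernel
begin

lemma AE_isCont_cutoff:
  fixes v :: "real \<Rightarrow> real" and a :: real
  assumes v: "continuous_on UNIV v"
  shows "AE x in lborel. isCont (\<lambda>x. indicator {-a..a} x * v x :: real) x"
proof -
  have "AE x in lborel. x \<noteq> a \<and> x \<noteq> - a" by (auto intro!: AE_conjI AE_lborel_singleton)
  then show ?thesis
  proof eventually_elim
    case (elim x)
    have cv: "isCont v x" using v by (simp add: continuous_on_eq_continuous_at)
    consider "x \<in> {-a<..<a}" | "x \<in> - {-a..a}"
    proof -
      have "x \<in> {-a<..<a}" if "x \<in> {-a..a}" using elim that by auto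
      then show ?thesis using that by blast
    qed
    then show ?case
    proof cases
      case 1
      have "\<forall>\<^sub>F y in nhds x. v y = indicator {-a..a} y * v y"
        using 1 by (intro eventually_nhds_in_open[of "{-a<..<a}", THEN eventually_mono]) auto
      then show ?thesis using isCont_cong[of v "\<lambda>x. indicator {-a..a} x * v x" x] cv by simp
    next
      case 2
      have "\<forall>\<^sub>F y in nhds x. 0 = indicator {-a..a} y * v y"
        using 2 by (intro eventually_nhds_in_open[of "- {-a..a}", THEN eventually_mono]) auto
      then show ?thesis using isCont_cong[of "\<lambda>_. 0" "\<lambda>x. indicator {-a..a} x * v x" x] by simp
    qed
  qed
qed

lemma bounded_compact_function_self: "bounded_compact_function f L F"
  using bounded support F_nonneg by unfold_locales (auto simp: indicator_def not_le)

lemma cutoff_locale: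
  assumes v: "continuous_on UNIV (v :: real \<Rightarrow> real)"
  obtains c where "bounded_compact_function (\<lambda>x. indicator {-a..a} x * v x) a c"
proof -
  have [measurable]: "v \<in> borel_measurable borel" by (rule borel_measurable_continuous_onI[OF v])
  have "bounded (v ` {-a..a})"
    using v by (intro compact_imp_bounded compact_continuous_image continuous_on_subset[OF v]) auto
  then obtain c where "\<forall>y\<in>v ` {-a..a}. norm y \<le> c" unfolding bounded_iff by blast
  then have c: "\<And>x. x \<in> {-a..a} \<Longrightarrow> \<bar>v x\<bar> \<le> c" by simp
  have "bounded_compact_function (\<lambda>x. indicator {-a..a} x * v x) a (max c 0)"
  proof
    fix x show "\<bar>indicator {-a..a} x * v x\<bar> \<le> max c 0 * indicator {-a..a} x"
      using c[of x] by (auto simp: indicator_def)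
  qed auto
  then show ?thesis by (rule that)
qed

text \<open>Plancherel is available for real functions only, while the inverse transform
  \<open>E\<close> of a spectrum that need not be even is complex. So |E - f|^2 is expanded: the
  squares are handled by Plancherel, the mixed term by Fubini, and semidefiniteness identifies the
  transform of \<open>f\<close> with its modulus.\<close>

lemma L2_norm_inverse_fourier_cutoff:
  fixes v :: "real \<Rightarrow> real" and a :: real
  assumes psd: "positive_semidefinite f" and v: "continuous_on UNIV v"
  defines "V \<equiv> \<lambda>x. indicator {-a..a} x * v x"
  shows "L2_norm (\<lambda>t. complex_of_real (1 / (2 * pi)) * (LINT \<xi>:{-a..a}|lebesgue. complex_of_real (v \<xi>) * exp (\<i> * of_real t * of_real \<xi>)) - complex_of_real (f t))
    = ereal (sqrt ((LINT x|lborel. (V x - cmod (fourier f x))\<^sup>2) / (2 * pi)))"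
    and "integrable lborel (\<lambda>x. (V x - cmod (fourier f x))\<^sup>2)" and "integrable lborel (\<lambda>x. (cmod (fourier f x))\<^sup>2)"
proof -
  obtain c where c: "bounded_compact_function V a c"
    using cutoff_locale[OF v] unfolding V_def by blast
  interpret V: bounded_compact_function V a c by (rule c)
  interpret f: bounded_compact_function f L F by (rule bounded_compact_function_self)
  note [measurable] = borel_measurable_fourier[OF V.measurable_u] borel_measurable_fourier[OF measurable_f]
  have contV: "AE x in lborel. isCont V x" unfolding V_def by (rule AE_isCont_cutoff[OF v])
  have contf: "AE x in lborel. isCont f x" using continuous by (simp add: continuous_on_eq_continuous_at)
  note PV = V.plancherel[OF contV] and Pf = f.plancherel[OF contf]
  define \<phi> where "\<phi> x = cmod (fourier f x)" for x
  have [measurable]: "\<phi> \<in> borel_measurable borel" unfolding \<phi>_def by measurable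
  have \<phi>: "fourier f x = of_real (\<phi> x)" for x unfolding \<phi>_def by (rule fourier_nonneg[OF psd])
  have i\<phi>: "integrable lborel (\<lambda>x. (\<phi> x)\<^sup>2)" using Pf(1) by (simp add: \<phi>_def)
  then show "integrable lborel (\<lambda>x. (cmod (fourier f x))\<^sup>2)" by (simp add: \<phi>_def)
  define E where "E t = complex_of_real (1 / (2 * pi)) * (LINT \<xi>:{-a..a}|lebesgue. complex_of_real (v \<xi>) * exp (\<i> * of_real t * of_real \<xi>))" for t
  have E: "E t = complex_of_real (1 / (2 * pi)) * fourier V (- t)" for t
  proof -
    have "(LINT \<xi>:{-a..a}|lebesgue. complex_of_real (v \<xi>) * exp (\<i> * of_real t * of_real \<xi>)) = fourier V (- t)"
      unfolding set_lebesgue_integral_def fourier_def V_def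
      by (intro Bochner_Integration.integral_cong refl) (simp add: scaleR_conv_of_real)
    then show ?thesis by (simp add: E_def)
  qed
  have Em [measurable]: "E \<in> borel_measurable borel" unfolding E[abs_def] by measurable
  have E2: "(cmod (E t))\<^sup>2 = 1 / (4 * pi\<^sup>2) * (cmod (fourier V (0 + - 1 * t)))\<^sup>2" for t
  proof -
    have "cmod (complex_of_real (1 / (2 * pi))) = 1 / (2 * pi)" by (simp only: norm_of_real) simp
    then show ?thesis unfolding E norm_mult by (simp add: power_mult_distrib power_divide)
  qed
  have iE: "integrable lborel (\<lambda>t. (cmod (E t))\<^sup>2)"
    unfolding E2 using PV(1) lborel_integrable_real_affine_iff[of "- 1" "\<lambda>t. (cmod (fourier V t))\<^sup>2" 0] by (intro integrable_mult_right) simp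
  have intE: "(LINT t|lborel. (cmod (E t))\<^sup>2) = (LINT x|lborel. (V x)\<^sup>2) / (2 * pi)"
  proof -
    have "(LINT t|lborel. (cmod (fourier V t))\<^sup>2) = \<bar>- 1\<bar> *\<^sub>R (LINT t|lborel. (cmod (fourier V (0 + - 1 * t)))\<^sup>2)"
      by (rule lborel_integral_real_affine) simp
    then have "(LINT t|lborel. (cmod (fourier V (0 + - 1 * t)))\<^sup>2) = 2 * pi * (LINT x|lborel. (V x)\<^sup>2)"
      using PV(2) by simp
    then show ?thesis unfolding E2 by (simp add: power2_eq_square)
  qed
  have Eb: "cmod (E t) \<le> 1 / (2 * pi) * (LINT x|lborel. \<bar>V x\<bar>)" for t
  proof -
    have "cmod (complex_of_real (1 / (2 * pi))) = 1 / (2 * pi)" by (simp only: norm_of_real) simp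
    then show ?thesis unfolding E norm_mult using V.cmod_fourier_le by (simp add: divide_right_mono)
  qed
  have iEf: "integrable lborel (\<lambda>t. E t * of_real (f t))"
  proof -
    define e where "e = 1 / (2 * pi) * (LINT x|lborel. \<bar>V x\<bar>)"
    show ?thesis
    proof (rule Bochner_Integration.integrable_bound[OF integrable_mult_right[OF integrable_f, of e]])
      show "AE t in lborel. norm (E t * of_real (f t)) \<le> norm (e * f t)"
      proof (rule AE_I2)
        fix t
        have "cmod (E t) * \<bar>f t\<bar> \<le> \<bar>e\<bar> * \<bar>f t\<bar>"
          using Eb[of t, folded e_def] by (intro mult_right_mono) auto
        then show "norm (E t * of_real (f t)) \<le> norm (e * f t)" by (simp add: norm_mult abs_mult)
      qed
    qed measurable
  qed
  \<comment> \<open>Fubini moves the transform from \<open>V\<close> to \<open>f\<close>; the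
    reflection of the frequency disappears because the transform of \<open>f\<close> is
    real.\<close>
  have intEf: "(LINT t|lborel. Re (E t) * f t) = (LINT x|lborel. V x * \<phi> x) / (2 * pi)"
  proof -
    have int: "integrable (lborel \<Otimes>\<^sub>M lborel) (\<lambda>(t, x). complex_of_real (f t) * (complex_of_real (V x) * iexp (t * x)))"
    proof (rule lborel_pair.Fubini_integrable)
      show "AE t in lborel. integrable lborel (\<lambda>x. case (t, x) of (t, x) \<Rightarrow> complex_of_real (f t) * (complex_of_real (V x) * iexp (t * x)))"
        using V.integrable_u_iexp by (intro AE_I2) (simp add: integrable_mult_right)
      have "integrable lborel (\<lambda>t. \<bar>f t\<bar> * (LINT x|lborel. \<bar>V x\<bar>))"
        using integrable_f by (intro integrable_mult_left integrable_abs)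
      then show "integrable lborel (\<lambda>t. LINT x|lborel. norm (case (t, x) of (t, x) \<Rightarrow> complex_of_real (f t) * (complex_of_real (V x) * iexp (t * x))))"
        by (simp add: norm_mult)
    qed (use measurable_f V.measurable_u in measurable)
    have "(CLINT t|lborel. complex_of_real (f t) * fourier V (- t)) = (CLINT t|lborel. CLINT x|lborel. complex_of_real (f t) * (complex_of_real (V x) * iexp (t * x)))"
      by (simp add: fourier_eq_lborel[OF V.measurable_u])
    also have "\<dots> = (CLINT x|lborel. CLINT t|lborel. complex_of_real (f t) * (complex_of_real (V x) * iexp (t * x)))"
      using lborel_pair.Fubini_integral[OF int] by simp
    also have "\<dots> = (CLINT x|lborel. complex_of_real (V x) * (CLINT t|lborel. complex_of_real (f t) * iexp (- (- x * t))))"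
      by (subst integral_mult_right_zero[symmetric]) (simp add: mult_ac)
    also have "\<dots> = (CLINT x|lborel. complex_of_real (V x) * fourier f (- x))"
      by (simp only: fourier_lborel)
    also have "\<dots> = (CLINT x|lborel. complex_of_real (V x * \<phi> x))"
      unfolding fourier_uminus by (simp add: \<phi>)
    also have "\<dots> = complex_of_real (LINT x|lborel. V x * \<phi> x)" by (rule integral_complex_of_real)
    finally have "(CLINT t|lborel. complex_of_real (f t) * fourier V (- t)) = complex_of_real (LINT x|lborel. V x * \<phi> x)" .
    then have "(CLINT t|lborel. E t * of_real (f t)) = complex_of_real ((LINT x|lborel. V x * \<phi> x) / (2 * pi))"
      unfolding E by (simp add: mult_ac)
    then have "Re (CLINT t|lborel. E t * of_real (f t)) = (LINT x|lborel. V x * \<phi> x) / (2 * pi)" by simp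
    moreover have "Re (CLINT t|lborel. E t * of_real (f t)) = (LINT t|lborel. Re (E t * of_real (f t)))"
      by (rule integral_Re[OF iEf, symmetric])
    ultimately show ?thesis by simp
  qed
  have iRe: "integrable lborel (\<lambda>t. Re (E t) * f t)" using integrable_Re[OF iEf] by simp
  have sq: "(norm (E t - complex_of_real (f t)))\<^sup>2 = (cmod (E t))\<^sup>2 - 2 * (Re (E t) * f t) + (f t)\<^sup>2" for t
    unfolding cmod_power2 by (simp add: power2_eq_square algebra_simps)
  have int: "integrable lborel (\<lambda>t. (norm (E t - complex_of_real (f t)))\<^sup>2)"
    unfolding sq using iE iRe integrable_f_sq by auto
  have V2: "integrable lborel (\<lambda>x. (V x)\<^sup>2)"
  proof (rule Bochner_Integration.integrable_bound[OF integrable_mult_right[OF V.integrable_u, of c]])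
    show "AE x in lborel. norm ((V x)\<^sup>2) \<le> norm (c * V x)"
    proof (rule AE_I2)
      fix x
      have "\<bar>V x\<bar> * \<bar>V x\<bar> \<le> \<bar>c\<bar> * \<bar>V x\<bar>"
        using V.u_le[of x] by (intro mult_right_mono) auto
      then show "norm ((V x)\<^sup>2) \<le> norm (c * V x)" by (simp add: power2_eq_square abs_mult)
    qed
  qed measurable
  have \<phi>b: "\<phi> x \<le> 2 * L * F" for x unfolding \<phi>_def by (rule cmod_fourier_le)
  have V\<phi>: "integrable lborel (\<lambda>x. V x * \<phi> x)"
  proof (rule Bochner_Integration.integrable_bound[OF integrable_mult_right[OF V.integrable_u, of "2 * L * F"]])
    show "AE x in lborel. norm (V x * \<phi> x) \<le> norm (2 * L * F * V x)"
    proof (rule AE_I2)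
      fix x
      have "\<bar>V x\<bar> * \<bar>\<phi> x\<bar> \<le> \<bar>V x\<bar> * \<bar>2 * L * F\<bar>"
        using \<phi>b[of x] by (intro mult_left_mono) (auto simp: \<phi>_def)
      then show "norm (V x * \<phi> x) \<le> norm (2 * L * F * V x)" by (simp add: abs_mult mult_ac)
    qed
  qed measurable
  have sq2: "(V x - \<phi> x)\<^sup>2 = (V x)\<^sup>2 - 2 * (V x * \<phi> x) + (\<phi> x)\<^sup>2" for x by (simp add: power2_eq_square algebra_simps)
  have "integrable lborel (\<lambda>x. (V x - \<phi> x)\<^sup>2)" unfolding sq2 using V2 V\<phi> i\<phi> by auto
  then show "integrable lborel (\<lambda>x. (V x - cmod (fourier f x))\<^sup>2)" by (simp add: \<phi>_def)
  have "(LINT t|lborel. (norm (E t - complex_of_real (f t)))\<^sup>2) = (LINT x|lborel. (V x)\<^sup>2) / (2 * pi) - 2 * ((LINT x|lborel. V x * \<phi> x) / (2 * pi)) + (LINT x|lborel. (\<phi> x)\<^sup>2) / (2 * pi)"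
  proof -
    have f2: "(LINT t|lborel. (f t)\<^sup>2) = (LINT x|lborel. (\<phi> x)\<^sup>2) / (2 * pi)" using Pf(2) by (simp add: \<phi>_def)
    show ?thesis unfolding sq using iE iRe integrable_f_sq by (simp add: intE intEf f2)
  qed
  also have "\<dots> = (LINT x|lborel. (V x - \<phi> x)\<^sup>2) / (2 * pi)"
    unfolding sq2 using V2 V\<phi> i\<phi> by (simp add: diff_divide_distrib add_divide_distrib)
  finally have val: "(LINT t|lborel. (norm (E t - complex_of_real (f t)))\<^sup>2) = (LINT x|lborel. (V x - \<phi> x)\<^sup>2) / (2 * pi)" .
  have "L2_norm (\<lambda>t. E t - complex_of_real (f t)) = ereal (sqrt (LINT t|lebesgue. (norm (E t - complex_of_real (f t)))\<^sup>2))"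
  proof -
    have "(\<lambda>t. E t - complex_of_real (f t)) \<in> borel_measurable lebesgue" by (intro measurable_completion) measurable
    moreover have "integrable lebesgue (\<lambda>t. (norm (E t - complex_of_real (f t)))\<^sup>2)"
      using int by (subst integrable_completion) auto
    ultimately show ?thesis by (simp add: L2_norm_def)
  qed
  also have "(LINT t|lebesgue. (norm (E t - complex_of_real (f t)))\<^sup>2) = (LINT t|lborel. (norm (E t - complex_of_real (f t)))\<^sup>2)"
    by (rule integral_completion) measurable
  finally show "L2_norm (\<lambda>t. complex_of_real (1 / (2 * pi)) * (LINT \<xi>:{-a..a}|lebesgue. complex_of_real (v \<xi>) * exp (\<i> * of_real t * of_real \<xi>)) - complex_of_real (f t))
    = ereal (sqrt ((LINT x|lborel. (V x - cmod (fourier f x))\<^sup>2) / (2 * pi)))"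
    unfolding val by (simp add: E_def \<phi>_def)
qed

end

subsection \<open>Consistency\<close>


text \<open>Weights bounded by \<open>wm\<close> are spread over at least \<open>1/wm\<close> frequencies. Hence (A2) and (A5) together force
  \<open>a\<^sub>n\<^sup>3 = o(n \<Delta>\<^sub>n)\<close>.\<close>

lemma second_moment_weight_ge:
  assumes w: "\<And>k. \<bar>k\<bar> \<le> int m \<Longrightarrow> 0 \<le> w k" "\<And>k. \<bar>k\<bar> \<le> int m \<Longrightarrow> w k \<le> wm" "(\<Sum>k\<in>{- int m..int m}. w k) = 1"
    and wm: "0 < wm" "wm \<le> 1 / 8"
  shows "1 \<le> 12 * wm * sqrt (second_moment_weight m w)"
proof -
  \<comment> \<open>At most 2 R + 1 indices lie within distance R, with mass at most 1/4 +
    \<open>wm\<close>, hence at most 3/8. The other 5/8 contribute at least 5/8 R^2 to the second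
    moment, and 5/(8 * 64) exceeds 1/144.\<close>
  define R where "R = 1 / (8 * wm)"
  have R: "R > 0" using wm by (simp add: R_def)
  let ?I = "{- int m..int m}"
  let ?N = "{k \<in> ?I. \<bar>of_int k\<bar> \<le> R}"
  have "?N \<subseteq> {- \<lfloor>R\<rfloor>..\<lfloor>R\<rfloor>}"
  proof
    fix k assume "k \<in> ?N"
    then have "of_int \<bar>k\<bar> \<le> R" by simp
    then have "\<bar>k\<bar> \<le> \<lfloor>R\<rfloor>" by (simp add: le_floor_iff)
    then show "k \<in> {- \<lfloor>R\<rfloor>..\<lfloor>R\<rfloor>}" by auto
  qed
  then have "card ?N \<le> card {- \<lfloor>R\<rfloor>..\<lfloor>R\<rfloor>}" by (intro card_mono) auto
  then have "real (card ?N) \<le> real (card {- \<lfloor>R\<rfloor>..\<lfloor>R\<rfloor>})" by simp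
  also have "\<dots> = 2 * of_int \<lfloor>R\<rfloor> + 1" using R by simp
  also have "\<dots> \<le> 2 * R + 1" by simp
  finally have cN: "real (card ?N) \<le> 2 * R + 1" .
  have "(\<Sum>k\<in>?N. w k) \<le> (\<Sum>k\<in>?N. wm)" by (intro sum_mono w) auto
  also have "\<dots> \<le> (2 * R + 1) * wm" using cN wm by simp
  also have "\<dots> = 1 / 4 + wm" using wm by (simp add: R_def field_simps)
  finally have near: "(\<Sum>k\<in>?N. w k) \<le> 3 / 8" using wm by simp
  have "(\<Sum>k\<in>?I. w k) = (\<Sum>k\<in>?I - ?N. w k) + (\<Sum>k\<in>?N. w k)" by (rule sum.subset_diff) auto
  then have far: "(\<Sum>k\<in>?I - ?N. w k) \<ge> 5 / 8" using near w(3) by simp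
  have "R\<^sup>2 * (5 / 8) \<le> R\<^sup>2 * (\<Sum>k\<in>?I - ?N. w k)" using far by (intro mult_left_mono) auto
  also have "\<dots> = (\<Sum>k\<in>?I - ?N. R\<^sup>2 * w k)" by (simp add: sum_distrib_left)
  also have "\<dots> \<le> (\<Sum>k\<in>?I - ?N. (of_int k)\<^sup>2 * w k)"
  proof (intro sum_mono mult_right_mono)
    fix k assume "k \<in> ?I - ?N"
    then have "R \<le> \<bar>of_int k\<bar>" by auto
    then have "R\<^sup>2 \<le> \<bar>of_int k\<bar>\<^sup>2" using R by (intro power_mono) auto
    then show "R\<^sup>2 \<le> (of_int k)\<^sup>2" by simp
  qed (use w in auto)
  also have "\<dots> \<le> second_moment_weight m w"
    unfolding second_moment_weight_def using w by (intro sum_mono2) auto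
  finally have "R\<^sup>2 * (5 / 8) \<le> second_moment_weight m w" .
  moreover have "(1 / (12 * wm))\<^sup>2 \<le> R\<^sup>2 * (5 / 8)"
    using wm by (simp add: R_def power_divide power_mult_distrib divide_simps)
  ultimately have "(1 / (12 * wm))\<^sup>2 \<le> second_moment_weight m w" by linarith
  then have "1 / (12 * wm) \<le> sqrt (second_moment_weight m w)" by (rule real_le_rsqrt)
  then show ?thesis using wm by (simp add: divide_le_eq mult.commute)
qed

text \<open>Markov's inequality for the truncated variable at level \<open>min 1 e\<close>;
  truncation at 1 leaves convergence to zero in probability unchanged.\<close>

lemma (in prob_space) tendsto_zero_in_probI:
  fixes Y :: "nat \<Rightarrow> 'a \<Rightarrow> real"
  assumes meas [measurable]: "\<And>n. Y n \<in> borel_measurable M"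
    and nonneg: "\<forall>\<^sub>F n in sequentially. \<forall>y. 0 \<le> Y n y"
    and bound: "\<forall>\<^sub>F n in sequentially. expectation (\<lambda>y. min 1 (Y n y)) \<le> r n" and r: "r \<longlonglongrightarrow> 0"
  shows "tendsto_zero_in_prob M (\<lambda>n y. ereal (Y n y))"
  unfolding tendsto_zero_in_prob_def
proof (intro conjI allI impI)
  fix e :: real assume e: "e > 0"
  have "(\<lambda>n. prob {y \<in> space M. \<bar>Y n y\<bar> > e}) \<longlonglongrightarrow> 0"
  proof (rule Lim_null_comparison)
    show "\<forall>\<^sub>F n in sequentially. norm (prob {y \<in> space M. \<bar>Y n y\<bar> > e}) \<le> r n / min 1 e"
      using nonneg bound
    proof eventually_elim
      case (elim n)
      have "prob {y \<in> space M. \<bar>Y n y\<bar> > e} \<le> prob {y \<in> space M. min 1 e \<le> min 1 (Y n y)}"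
        using elim(1) e by (intro finite_measure_mono) (auto simp: abs_of_nonneg min_def)
      also have "\<dots> \<le> expectation (\<lambda>y. min 1 (Y n y)) / min 1 e"
        using e elim(1) by (intro integral_Markov_inequality_measure[where A="space M"] integrable_const_bound[where B=1]) auto
      also have "\<dots> \<le> r n / min 1 e" using e elim(2) by (intro divide_right_mono) auto
      finally show ?case by simp
    qed
    show "(\<lambda>n. r n / min 1 e) \<longlonglongrightarrow> 0" by (intro tendsto_divide_zero r)
  qed
  then show "(\<lambda>n. prob {y \<in> space M. \<bar>ereal (Y n y)\<bar> > ereal e}) \<longlonglongrightarrow> 0" by simp
qed measurable

lemma sq_diff_le_abs_diff_sq: "0 \<le> x \<Longrightarrow> 0 \<le> y \<Longrightarrow> (x - y)\<^sup>2 \<le> \<bar>x\<^sup>2 - y\<^sup>2\<bar>" for x y :: real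
proof -
  assume xy: "0 \<le> x" "0 \<le> y"
  have "(x - y)\<^sup>2 = \<bar>x - y\<bar> * \<bar>x - y\<bar>" by (simp add: power2_eq_square flip: abs_mult)
  also have "\<dots> \<le> \<bar>x - y\<bar> * (x + y)" using xy by (intro mult_left_mono) auto
  also have "\<dots> = \<bar>x\<^sup>2 - y\<^sup>2\<bar>" using xy by (simp add: power2_eq_square abs_mult square_diff_square_factored mult.commute)
  finally show ?thesis .
qed

lemma modulus_of_continuity_real:
  assumes fin: "modulus_of_continuity f \<delta> < \<infinity>" and \<delta>: "\<delta> > 0"
  shows "0 \<le> real_of_ereal (modulus_of_continuity f \<delta>)"
    and "\<bar>s - t\<bar> < \<delta> \<Longrightarrow> \<bar>f s - f t\<bar> \<le> real_of_ereal (modulus_of_continuity f \<delta>)"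
proof -
  have le: "ereal \<bar>f s - f t\<bar> \<le> modulus_of_continuity f \<delta>" if "\<bar>s - t\<bar> < \<delta>" for s t
    unfolding modulus_of_continuity_def by (rule SUP_upper2[of "(s, t)"]) (use that in auto)
  have "0 \<le> modulus_of_continuity f \<delta>" using le[of 0 0] \<delta> by (simp flip: zero_ereal_def)
  then obtain r where r: "modulus_of_continuity f \<delta> = ereal r" "r \<ge> 0"
    using fin by (cases "modulus_of_continuity f \<delta>") auto
  show "0 \<le> real_of_ereal (modulus_of_continuity f \<delta>)" using r by simp
  show "\<bar>f s - f t\<bar> \<le> real_of_ereal (modulus_of_continuity f \<delta>)" if "\<bar>s - t\<bar> < \<delta>"
    using le[OF that] r by simp
qed

section \<open>Normalization of the kernel\<close>

context compact_kernel
begin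

lemma L2_norm_eq: "L2_norm f = ereal (sqrt energy)"
proof -
  have m: "f \<in> borel_measurable lebesgue" by (intro measurable_completion) measurable
  have i: "integrable lebesgue (\<lambda>t. (f t)\<^sup>2)" using integrable_f_sq by (subst integrable_completion) auto
  have "(LINT t|lebesgue. (f t)\<^sup>2) = energy" unfolding energy_def by (intro integral_completion) measurable
  then show ?thesis using m i by (simp add: L2_norm_def)
qed

lemma L2_normalized_eq: "L2_normalized f = (\<lambda>t. f t / sqrt energy)"
  by (simp add: L2_normalized_def L2_norm_eq fun_eq_iff)

lemma energy_pos: assumes "f t0 \<noteq> 0" shows "energy > 0"
  unfolding energy_def
  by (rule integral_continuous_pos[of "\<lambda>t. (f t)\<^sup>2" t0]) (use assms continuous integrable_f_sq in \<open>auto intro!: continuous_intros\<close>)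

lemma fourier_divide: "fourier (\<lambda>t. f t / c) \<xi> = fourier f \<xi> / of_real c"
proof -
  have "fourier (\<lambda>t. f t / c) \<xi> = (LINT t|lebesgue. complex_of_real (f t) * exp (- (\<i> * of_real \<xi> * of_real t)) / of_real c)"
    unfolding fourier_def by (intro Bochner_Integration.integral_cong refl) simp
  then show ?thesis by (simp add: fourier_def)
qed

lemma compact_kernel_divide:
  assumes "c > 0" shows "compact_kernel (\<lambda>t. f t / c) L (F / c)"
proof
  have "uniformly_continuous_on UNIV (\<lambda>t. inverse c *\<^sub>R f t)"
    by (intro uniformly_continuous_on_cmul uniformly_continuous)
  then show "uniformly_continuous_on UNIV (\<lambda>t. f t / c)" by (simp add: divide_inverse mult.commute)
qed (use assms support bounded L_pos in \<open>auto intro!: divide_right_mono\<close>)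

end

lemma positive_semidefinite_divide:
  assumes "positive_semidefinite f" "c > 0"
  shows "positive_semidefinite (\<lambda>t. f t / c)"
  unfolding positive_semidefinite_def
proof (intro allI)
  fix N :: nat and t :: "nat \<Rightarrow> real" and z :: "nat \<Rightarrow> complex"
  have "(\<Sum>i<N. \<Sum>j<N. complex_of_real (f (t i - t j) / c) * z i * cnj (z j))
    = (\<Sum>i<N. \<Sum>j<N. complex_of_real (f (t i - t j)) * z i * cnj (z j)) / of_real c"
    by (simp add: sum_divide_distrib)
  also have "\<dots> \<in> \<real>\<^sub>\<ge>\<^sub>0"
    using assms(2)
    by (intro nonneg_Reals_divide_I
        assms(1)[unfolded positive_semidefinite_def, THEN spec, of N, THEN spec, of t, THEN spec, of z]) auto
  finally show "(\<Sum>i<N. \<Sum>j<N. complex_of_real (f (t i - t j) / c) * z i * cnj (z j)) \<in> \<real>\<^sub>\<ge>\<^sub>0" .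
qed

theorem theorem1:
  fixes M :: "'a measure" and \<Lambda> :: "real set \<Rightarrow> 'a \<Rightarrow> real" and \<alpha> :: real
    and f :: "real \<Rightarrow> real" and X :: "real \<Rightarrow> 'a \<Rightarrow> real"
    and \<Delta> a :: "nat \<Rightarrow> real" and m :: "nat \<Rightarrow> nat" and W :: "nat \<Rightarrow> int \<Rightarrow> real"
  assumes "0 < \<alpha>" and "\<alpha> < 2"
    and "sas_random_measure M \<alpha> \<Lambda>"
    and "f \<in> borel_measurable lebesgue" and "integrable lebesgue (\<lambda>t. \<bar>f t\<bar> powr \<alpha>)"
    and "compact (closure {t. f t \<noteq> 0})" and "\<exists>t. f t \<noteq> 0"
    and "moving_average M \<alpha> \<Lambda> f X"
    and "\<And>n. n \<ge> 1 \<Longrightarrow> \<Delta> n > 0" and "\<Delta> \<longlonglongrightarrow> 0"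
    and "filterlim (\<lambda>n. real n * \<Delta> n) at_top sequentially"
    and "\<And>n. n \<ge> 1 \<Longrightarrow> m n > 0" and "filterlim m at_top sequentially"
    and "(\<lambda>n. real (m n)) \<in> o(\<lambda>n. real n)"
    and "\<And>n. n \<ge> 1 \<Longrightarrow> a n > 0"
    and W1: "\<And>n k. n \<ge> 1 \<Longrightarrow> \<bar>k\<bar> \<le> int (m n) \<Longrightarrow> W n k \<ge> 0"
    and W2: "\<And>n. n \<ge> 1 \<Longrightarrow> (\<Sum>k \<in> {- int (m n)..int (m n)}. W n k) = 1"
    and W3: "(\<lambda>n. max_weight (m n) (W n)) \<longlonglongrightarrow> 0"
    and W4: "(\<lambda>n. second_moment_weight (m n) (W n)) \<in> o(\<lambda>n. (real n * \<Delta> n)\<^sup>2)"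
    and A1: "filterlim a at_top sequentially"
    and A2: "(\<lambda>n. (a n)\<^sup>2 * max_weight (m n) (W n)) \<longlonglongrightarrow> 0"
    and A3: "(\<lambda>n. a n powr (3 / 4)) \<in> o(\<lambda>n. (real n * \<Delta> n) powr (1 / \<alpha>))"
    and A4: "(\<lambda>n. (a n)\<^sup>2 * \<Delta> n) \<longlonglongrightarrow> 0"
    and A5: "(\<lambda>n. (a n)\<^sup>2 * second_moment_weight (m n) (W n)) \<in> o(\<lambda>n. (real n * \<Delta> n)\<^sup>2)"
    and F2: "(\<lambda>n. ereal (a n) * modulus_of_continuity f (\<Delta> n)) \<longlonglongrightarrow> 0"
  shows "tendsto_zero_in_prob M
           (\<lambda>n \<omega>. ereal (a n * (LINT \<xi>:{- a n..a n}|lebesgue.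
              (\<Delta> n * smoothed_periodogram n (\<Delta> n) (m n) (W n) (\<lambda>t. X t \<omega>) \<xi>
                 - (cmod (fourier (L2_normalized f) \<xi>))\<^sup>2)\<^sup>2)))
       \<and> (positive_semidefinite f \<longrightarrow>
           tendsto_zero_in_prob M
             (\<lambda>n \<omega>. L2_norm (\<lambda>t. estimator n (\<Delta> n) (m n) (W n) (a n) (\<lambda>t. X t \<omega>) t
                                 - complex_of_real (L2_normalized f t))))"
proof -
  interpret sas: sas_random_measure M \<alpha> \<Lambda> by fact
  note \<Delta>_pos = assms(9) and \<Delta>0 = assms(10) and T_top = assms(11) and m_small = assms(14) and a_pos = assms(15)
  obtain t0 where t0: "f t0 \<noteq> 0" using assms(7) by blast
  define wm where "wm n = max_weight (m n) (W n)" for n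
  define S where "S n = sqrt (second_moment_weight (m n) (W n))" for n
  define T where "T n = real n * \<Delta> n" for n
  define \<kappa> where "\<kappa> n = real_of_ereal (modulus_of_continuity f (\<Delta> n))" for n

  have ev_n: "\<forall>\<^sub>F n in sequentially. n \<ge> 1" by (rule eventually_ge_at_top)
  have ev_a: "\<forall>\<^sub>F n in sequentially. a n \<ge> 1" using A1 by (auto simp: filterlim_at_top)
  \<comment> \<open>Once a_n \<ge> 1 and the product in (F2) is below 1, the modulus is finite and
    may be treated as a real number.\<close>
  have ev_fin: "\<forall>\<^sub>F n in sequentially. modulus_of_continuity f (\<Delta> n) < \<infinity>"
    using order_tendstoD(2)[OF F2, of 1, simplified] ev_a
    by eventually_elim (auto simp: less_top[symmetric])
  have ev_\<kappa>: "\<forall>\<^sub>F n in sequentially. 0 \<le> \<kappa> n \<and> (\<forall>s t. \<bar>s - t\<bar> < \<Delta> n \<longrightarrow> \<bar>f s - f t\<bar> \<le> \<kappa> n)"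
    using ev_fin ev_n
    by eventually_elim (use modulus_of_continuity_real \<Delta>_pos in \<open>auto simp: \<kappa>_def\<close>)
  have a\<kappa>: "(\<lambda>n. a n * \<kappa> n) \<longlonglongrightarrow> 0"
    using lim_real_of_ereal[of "\<lambda>n. ereal (a n) * modulus_of_continuity f (\<Delta> n)" 0] F2 by (simp add: \<kappa>_def zero_ereal_def)
  have \<kappa>0: "\<kappa> \<longlonglongrightarrow> 0"
  proof (rule Lim_null_comparison[OF _ a\<kappa>])
    show "\<forall>\<^sub>F n in sequentially. norm (\<kappa> n) \<le> a n * \<kappa> n"
      using ev_\<kappa> ev_a by eventually_elim (auto simp: mult_le_cancel_right1)
  qed
  \<comment> \<open>The moduli at the scales \<Delta>_n tend to zero because their products with a_n
    do and a_n is eventually at least 1; this yields uniform continuity.\<close>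
  have uc: "uniformly_continuous_on UNIV f"
    unfolding uniformly_continuous_on_def dist_real_def
  proof (intro allI impI)
    fix e :: real assume "e > 0"
    then have "\<forall>\<^sub>F n in sequentially. \<kappa> n < e" by (rule order_tendstoD(2)[OF \<kappa>0])
    with ev_\<kappa> ev_n have "\<forall>\<^sub>F n in sequentially. \<Delta> n > 0 \<and> (\<forall>s t. \<bar>s - t\<bar> < \<Delta> n \<longrightarrow> \<bar>f s - f t\<bar> < e)"
      by eventually_elim (use \<Delta>_pos in \<open>auto intro: le_less_trans\<close>)
    then obtain n where "\<Delta> n > 0" "\<And>s t. \<bar>s - t\<bar> < \<Delta> n \<Longrightarrow> \<bar>f s - f t\<bar> < e"
      by (auto dest: eventually_happens)
    then show "\<exists>d>0. \<forall>x\<in>UNIV. \<forall>x'\<in>UNIV. \<bar>x' - x\<bar> < d \<longrightarrow> \<bar>f x' - f x\<bar> < e" by blast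
  qed
  have "bounded {t. f t \<noteq> 0}"
    using assms(6) by (meson bounded_subset closure_subset compact_imp_bounded)
  then obtain L where L: "L > 0" "\<And>t. f t \<noteq> 0 \<Longrightarrow> \<bar>t\<bar> \<le> L" by (auto simp: bounded_pos)
  have "bounded (f ` {-L..L})"
    using uniformly_continuous_imp_continuous[OF uc]
    by (intro compact_imp_bounded compact_continuous_image) (auto intro: continuous_on_subset)
  then obtain F0 where F0: "\<forall>y\<in>f ` {-L..L}. norm y \<le> F0" unfolding bounded_iff by blast
  interpret f: compact_kernel f L "max F0 0"
  proof
    show "\<bar>f t\<bar> \<le> max F0 0" for t
      using F0 L(2)[of t] by (cases "f t = 0") (auto simp: abs_le_iff le_max_iff_disj)
    show "f t = 0" if "\<bar>t\<bar> > L" for t using L(2)[of t] that by fastforce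
  qed (use uc L in auto)
  have E_pos: "f.energy > 0" by (rule f.energy_pos[OF t0])

  have wm: "W n k \<le> wm n" if "\<bar>k\<bar> \<le> int (m n)" for n k
    unfolding wm_def max_weight_def using that by (intro Max_ge finite_imageI imageI) auto
  have wm_pos: "wm n > 0" if n: "n \<ge> 1" for n
  proof (rule ccontr)
    assume le: "\<not> wm n > 0"
    have "(\<Sum>k\<in>{- int (m n)..int (m n)}. W n k) \<le> 0"
    proof (rule sum_nonpos)
      fix k assume "k \<in> {- int (m n)..int (m n)}"
      then have "W n k \<le> wm n" by (intro wm) auto
      then show "W n k \<le> 0" using le by linarith
    qed
    then show False using W2[OF n] by simp
  qed
  have S_nonneg: "S n \<ge> 0" if n: "n \<ge> 1" for n
    unfolding S_def second_moment_weight_def using W1[OF n] by (auto intro!: sum_nonneg)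
  have ev_T: "\<forall>\<^sub>F n in sequentially. T n \<ge> 1"
    using T_top by (auto simp: filterlim_at_top T_def)
  have aS: "(\<lambda>n. a n * (S n / T n)) \<longlonglongrightarrow> 0"
  proof -
    have "(\<lambda>n. sqrt ((a n)\<^sup>2 * second_moment_weight (m n) (W n) / (real n * \<Delta> n)\<^sup>2)) \<longlonglongrightarrow> sqrt 0"
      by (intro tendsto_real_sqrt smalloD_tendsto[OF A5])
    moreover have "\<forall>\<^sub>F n in sequentially. sqrt ((a n)\<^sup>2 * second_moment_weight (m n) (W n) / (real n * \<Delta> n)\<^sup>2) = a n * (S n / T n)"
      using ev_a ev_T by eventually_elim (simp add: S_def T_def real_sqrt_mult real_sqrt_divide)
    ultimately have "(\<lambda>n. a n * (S n / T n)) \<longlonglongrightarrow> sqrt 0" by (rule Lim_transform_eventually)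
    then show ?thesis by simp
  qed
  \<comment> \<open>The edge terms require a^2 / T \<longlonglongrightarrow> 0. Multiplying by 1
    \<le> 12 wm S and by a \<ge> 1 bounds this by 12 times the product of the quantity in (A2) and
    the root of the quotient in (A5).\<close>
  have aT: "(\<lambda>n. (a n)\<^sup>2 * (1 / T n)) \<longlonglongrightarrow> 0"
  proof (rule Lim_null_comparison)
    have "(\<lambda>n. 12 * ((a n)\<^sup>2 * wm n) * (a n * (S n / T n))) \<longlonglongrightarrow> 12 * 0 * 0"
      using A2 unfolding wm_def[symmetric] by (intro tendsto_intros aS)
    then show "(\<lambda>n. 12 * ((a n)\<^sup>2 * wm n) * (a n * (S n / T n))) \<longlonglongrightarrow> 0" by simp
    have "\<forall>\<^sub>F n in sequentially. wm n < 1 / 8" using order_tendstoD(2)[OF W3, of "1 / 8"] by (simp add: wm_def)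
    then show "\<forall>\<^sub>F n in sequentially. norm ((a n)\<^sup>2 * (1 / T n)) \<le> 12 * ((a n)\<^sup>2 * wm n) * (a n * (S n / T n))"
      using ev_n ev_a ev_T
    proof eventually_elim
      case (elim n)
      have "1 \<le> 12 * wm n * S n"
        unfolding S_def using W1 W2 wm wm_pos elim by (intro second_moment_weight_ge) auto
      then have "1 * 1 \<le> (12 * wm n * S n) * a n"
        by (rule mult_mono) (use elim wm_pos[of n] S_nonneg[of n] in auto)
      then have "((a n)\<^sup>2 * (1 / T n)) * 1 \<le> ((a n)\<^sup>2 * (1 / T n)) * ((12 * wm n * S n) * a n)"
        using elim by (intro mult_left_mono) auto
      then show ?case using elim by (simp add: mult_ac)
    qed
  qed
  have rate0: "(\<lambda>n. a n * (\<kappa> n + a n * \<Delta> n + S n / T n)) \<longlonglongrightarrow> 0"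
    using tendsto_add[OF tendsto_add[OF a\<kappa> A4] aS] by (simp add: algebra_simps power2_eq_square)
  \<comment> \<open>The bound of \<open>spectral_loss_expectation_le\<close>, with 1 + a^2 replaced
    by 2 a^2 and one factor \<open>a\<close> moved into the squared bias.\<close>
  define r where "r n = f.C_risk * (2 * (a n * (\<kappa> n + a n * \<Delta> n + S n / T n))\<^sup>2 + 2 * ((a n)\<^sup>2 * wm n) + 2 * ((a n)\<^sup>2 * (1 / T n)))" for n
  have r0: "r \<longlonglongrightarrow> 0"
  proof -
    have "r \<longlonglongrightarrow> f.C_risk * (2 * 0\<^sup>2 + 2 * 0 + 2 * 0)"
      unfolding r_def[abs_def] using A2 unfolding wm_def[symmetric] by (intro tendsto_intros rate0 aT)
    then show ?thesis by simp
  qed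
  have C_risk: "f.C_risk \<ge> 0"
    unfolding f.C_risk_def using f.C_ratio_nonneg f.C_spec_nonneg by simp

  let ?G = "\<lambda>\<xi>. (cmod (fourier f \<xi>))\<^sup>2 / f.energy"
  define loss where "loss n y = spectral_loss n (\<Delta> n) (m n) (W n) (a n) ?G (\<lambda>t. X t y)" for n y
  have Xm: "X t \<in> borel_measurable M" for t
    using assms(8) by (simp add: moving_average_def is_stable_integral_def)
  have Gm [measurable]: "?G \<in> borel_measurable borel" by measurable
  have sp_m [measurable]: "smoothed_periodogram n \<delta> j w x \<in> borel_measurable borel" for n \<delta> j w x
    by (rule borel_measurable_continuous_onI[OF continuous_smoothed_periodogram])
  have G_eq: "(cmod (fourier (L2_normalized f) \<xi>))\<^sup>2 = ?G \<xi>" for \<xi>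
    using E_pos by (simp add: f.L2_normalized_eq f.fourier_divide norm_divide power_divide)
  have loss_eq: "a n * (LINT \<xi>:{- a n..a n}|lebesgue.
      (\<Delta> n * smoothed_periodogram n (\<Delta> n) (m n) (W n) (\<lambda>t. X t y) \<xi> - (cmod (fourier (L2_normalized f) \<xi>))\<^sup>2)\<^sup>2) = loss n y" for n y
    unfolding loss_def spectral_loss_def G_eq set_lebesgue_integral_def
    by (intro arg_cong[where f="\<lambda>z. a n * z"] integral_completion) measurable
  have loss_m [measurable]: "loss n \<in> borel_measurable M" for n
    unfolding loss_def[abs_def] by (rule measurable_spectral_loss[OF Xm Gm])
  have loss_nonneg: "0 \<le> loss n y" if "n \<ge> 1" for n y
    unfolding loss_def using a_pos[OF that] by (intro spectral_loss_nonneg) auto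
  have risk: "\<forall>\<^sub>F n in sequentially. sas.expectation (\<lambda>y. min 1 (loss n y)) \<le> r n"
  proof -
    have "\<forall>\<^sub>F n in sequentially. norm (real (m n)) \<le> 1 / 2 * norm (real n)"
      using landau_o.smallD[OF m_small, of "1 / 2"] by simp
    moreover have "\<forall>\<^sub>F n in sequentially. \<Delta> n < 1" by (rule order_tendstoD(2)[OF \<Delta>0]) simp
    ultimately show ?thesis using ev_n ev_a ev_\<kappa> ev_T
    proof eventually_elim
      case (elim n)
      have m_le: "2 * m n \<le> n" using elim(1) by simp
      let ?\<tau> = "\<kappa> n + a n * \<Delta> n + S n / T n"
      have "sas.expectation (\<lambda>y. min 1 (loss n y)) \<le> f.C_risk * (1 + (a n)\<^sup>2) * (?\<tau>\<^sup>2 + wm n + 1 / T n)"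
        unfolding loss_def S_def T_def
        by (rule f.spectral_loss_expectation_le[OF assms(3,1,2,8) t0 E_pos])
          (use elim \<Delta>_pos W1 W2 wm m_le in \<open>auto simp: T_def\<close>)
      also have "\<dots> \<le> f.C_risk * (2 * (a n)\<^sup>2) * (?\<tau>\<^sup>2 + wm n + 1 / T n)"
      proof (intro mult_right_mono mult_left_mono C_risk)
        have "1 \<le> (a n)\<^sup>2" using elim by simp
        then show "1 + (a n)\<^sup>2 \<le> 2 * (a n)\<^sup>2" by linarith
        show "0 \<le> ?\<tau>\<^sup>2 + wm n + 1 / T n" using wm_pos[of n] elim by simp
      qed
      also have "\<dots> = r n"
      proof -
        have "c * (2 * b) * (x + y + z) = c * (2 * (b * x) + 2 * (b * y) + 2 * (b * z))" for b c x y z :: real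
          by (simp add: algebra_simps)
        then show ?thesis unfolding r_def power_mult_distrib .
      qed
      finally show ?case .
    qed
  qed
  have part1: "tendsto_zero_in_prob M (\<lambda>n y. ereal (loss n y))"
  proof (rule sas.tendsto_zero_in_probI[OF loss_m _ risk r0])
    show "\<forall>\<^sub>F n in sequentially. \<forall>y. 0 \<le> loss n y" using ev_n by eventually_elim (simp add: loss_nonneg)
  qed

  have part2: "tendsto_zero_in_prob M
       (\<lambda>n y. L2_norm (\<lambda>t. estimator n (\<Delta> n) (m n) (W n) (a n) (\<lambda>t. X t y) t - complex_of_real (L2_normalized f t)))"
    if psd: "positive_semidefinite f"
  proof -
    define g where "g = L2_normalized f"
    have g_eq: "g = (\<lambda>t. f t / sqrt f.energy)" unfolding g_def by (rule f.L2_normalized_eq)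
    interpret g: compact_kernel g L "max F0 0 / sqrt f.energy"
      unfolding g_eq by (rule f.compact_kernel_divide) (use E_pos in simp)
    have psd_g: "positive_semidefinite g"
      unfolding g_eq by (rule positive_semidefinite_divide[OF psd]) (use E_pos in simp)
    define \<phi> where "\<phi> \<xi> = cmod (fourier g \<xi>)" for \<xi>
    have \<phi>_m [measurable]: "\<phi> \<in> borel_measurable borel" unfolding \<phi>_def[abs_def] by measurable
    have \<phi>_sq: "(\<phi> \<xi>)\<^sup>2 = ?G \<xi>" for \<xi> unfolding \<phi>_def g_def by (rule G_eq)
    define v where "v n y \<xi> = sqrt (\<Delta> n * smoothed_periodogram n (\<Delta> n) (m n) (W n) (\<lambda>t. X t y) \<xi>)" for n y \<xi>
    have v_cont: "continuous_on UNIV (v n y)" for n y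
      unfolding v_def[abs_def] by (intro continuous_intros continuous_smoothed_periodogram)
    define D where "D n y = (LINT x|lborel. (indicator {- a n..a n} x * v n y x - \<phi> x)\<^sup>2)" for n y
    note L2 = g.L2_norm_inverse_fourier_cutoff[OF psd_g v_cont]
    have norm_eq: "L2_norm (\<lambda>t. estimator n (\<Delta> n) (m n) (W n) (a n) (\<lambda>t. X t y) t - complex_of_real (L2_normalized f t))
        = ereal (sqrt (D n y / (2 * pi)))" for n y
      using L2(1)[of "a n" n y] by (simp only: estimator_def v_def D_def \<phi>_def g_def)
    have D_m [measurable]: "D n \<in> borel_measurable M" for n
    proof -
      note [measurable] = measurable_smoothed_periodogram[OF Xm]
      show ?thesis unfolding D_def[abs_def] v_def by measurable
    qed
    have \<phi>2: "integrable lborel (\<lambda>x. (\<phi> x)\<^sup>2)" using L2(3) by (simp add: \<phi>_def)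
    define tail where "tail n = (LINT x|lborel. indicator (- {- a n..a n}) x * (\<phi> x)\<^sup>2)" for n
    have tail0: "tail \<longlonglongrightarrow> 0"
    proof -
      have "(\<lambda>n. LINT x|lborel. indicator (- {- a n..a n}) x * (\<phi> x)\<^sup>2) \<longlonglongrightarrow> (LINT x::real|lborel. 0)"
      proof (rule integral_dominated_convergence[where w="\<lambda>x. (\<phi> x)\<^sup>2"])
        show "integrable lborel (\<lambda>x. (\<phi> x)\<^sup>2)" by (rule \<phi>2)
        show "AE x in lborel. (\<lambda>n. indicator (- {- a n..a n}) x * (\<phi> x)\<^sup>2) \<longlonglongrightarrow> 0"
        proof (rule AE_I2)
          fix x :: real
          have "\<forall>\<^sub>F n in sequentially. \<bar>x\<bar> \<le> a n" using A1 by (auto simp: filterlim_at_top)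
          then have "\<forall>\<^sub>F n in sequentially. indicator (- {- a n..a n}) x * (\<phi> x)\<^sup>2 = 0"
            by eventually_elim (auto simp: indicator_def abs_le_iff)
          then show "(\<lambda>n. indicator (- {- a n..a n}) x * (\<phi> x)\<^sup>2) \<longlonglongrightarrow> 0" by (rule tendsto_eventually)
        qed
        show "AE x in lborel. norm (indicator (- {- a n..a n}) x * (\<phi> x)\<^sup>2) \<le> (\<phi> x)\<^sup>2" for n
          by (intro AE_I2) (auto simp: indicator_def)
      qed measurable
      then show ?thesis by (simp add: tail_def[abs_def])
    qed
    \<comment> \<open>Young's inequality |h| \<le> a h^2/(2 c) + c/(2 a), where the last term
      integrates to c over an interval of length 2 a. This is why (i) carries the factor a_n: it
      lets a bound on squares control the integral of |h|. Outside the cut-off the spectrum of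
      \<open>g\<close> itself remains.\<close>
    have D_le: "D n y \<le> loss n y / (2 * c) + c + tail n" if n: "n \<ge> 1" and c: "c > 0" for n y c
    proof -
      let ?s = "\<lambda>x. \<Delta> n * smoothed_periodogram n (\<Delta> n) (m n) (W n) (\<lambda>t. X t y) x"
      let ?h = "\<lambda>x. ?s x - ?G x"
      have an: "a n > 0" by (rule a_pos[OF n])
      have ptw: "(indicator {- a n..a n} x * v n y x - \<phi> x)\<^sup>2
        \<le> indicator {- a n..a n} x *\<^sub>R (a n / (2 * c) * (?h x)\<^sup>2 + c / (2 * a n)) + indicator (- {- a n..a n}) x * (\<phi> x)\<^sup>2" for x
      proof (cases "x \<in> {- a n..a n}")
        case True
        have s0: "?s x \<ge> 0"
          using smoothed_periodogram_bounds(1)[of "m n" "W n" n "\<Delta> n" "\<lambda>t. X t y" x] W1[OF n] W2[OF n] \<Delta>_pos[OF n] by simp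
        have "(v n y x - \<phi> x)\<^sup>2 \<le> \<bar>(v n y x)\<^sup>2 - (\<phi> x)\<^sup>2\<bar>"
          using s0 by (intro sq_diff_le_abs_diff_sq) (auto simp: v_def \<phi>_def)
        also have "\<dots> = \<bar>?h x\<bar>" using s0 by (simp add: v_def \<phi>_sq)
        also have "\<dots> \<le> a n / (2 * c) * (?h x)\<^sup>2 + c / (2 * a n)"
        proof -
          have "0 \<le> (a n * \<bar>?h x\<bar> - c)\<^sup>2 / (2 * a n * c)" using an c by simp
          also have "\<dots> = a n / (2 * c) * (?h x)\<^sup>2 + c / (2 * a n) - \<bar>?h x\<bar>"
            using an c by (simp add: field_simps power2_eq_square)
          finally show ?thesis by simp
        qed
        finally show ?thesis using True by simp
      next
        case False
        then show ?thesis by simp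
      qed
      have i1: "set_integrable lborel {- a n..a n} (\<lambda>x. a n / (2 * c) * (?h x)\<^sup>2)"
        by (intro borel_integrable_atLeastAtMost' continuous_intros continuous_smoothed_periodogram
            continuous_on_subset[OF f.continuous_fourier]) (use E_pos in auto)
      have i2: "set_integrable lborel {- a n..a n} (\<lambda>x. c / (2 * a n))"
        by (intro borel_integrable_atLeastAtMost' continuous_intros)
      have i3: "integrable lborel (\<lambda>x. indicator (- {- a n..a n}) x * (\<phi> x)\<^sup>2)"
        by (rule Bochner_Integration.integrable_bound[OF \<phi>2]) (auto simp: indicator_def intro!: AE_I2)
      have i12: "integrable lborel (\<lambda>x. indicator {- a n..a n} x *\<^sub>R (a n / (2 * c) * (?h x)\<^sup>2 + c / (2 * a n)))"
        using set_integral_add(1)[OF i1 i2] by (simp add: set_integrable_def)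
      have "D n y \<le> (LINT x|lborel. indicator {- a n..a n} x *\<^sub>R (a n / (2 * c) * (?h x)\<^sup>2 + c / (2 * a n)) + indicator (- {- a n..a n}) x * (\<phi> x)\<^sup>2)"
        unfolding D_def
      proof (rule integral_mono[OF _ _ ptw])
        show "integrable lborel (\<lambda>x. (indicator {- a n..a n} x * v n y x - \<phi> x)\<^sup>2)"
          using L2(2)[of "a n" n y] by (simp add: \<phi>_def)
      qed (intro Bochner_Integration.integrable_add i12 i3)
      also have "\<dots> = (LINT x:{- a n..a n}|lborel. a n / (2 * c) * (?h x)\<^sup>2 + c / (2 * a n)) + tail n"
        unfolding set_lebesgue_integral_def tail_def by (rule Bochner_Integration.integral_add[OF i12 i3])
      also have "(LINT x:{- a n..a n}|lborel. a n / (2 * c) * (?h x)\<^sup>2 + c / (2 * a n))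
          = (LINT x:{- a n..a n}|lborel. a n / (2 * c) * (?h x)\<^sup>2) + (LINT x:{- a n..a n}|lborel. c / (2 * a n))"
        by (rule set_integral_add(2)[OF i1 i2])
      also have "(LINT x:{- a n..a n}|lborel. c / (2 * a n)) = c"
        using an by (simp add: set_lebesgue_integral_def)
      also have "(LINT x:{- a n..a n}|lborel. a n / (2 * c) * (?h x)\<^sup>2) = loss n y / (2 * c)"
        by (simp add: loss_def spectral_loss_def)
      finally show ?thesis .
    qed
    show ?thesis
      unfolding norm_eq tendsto_zero_in_prob_def
    proof (intro conjI allI impI)
      show "(\<lambda>y. ereal (sqrt (D n y / (2 * pi)))) \<in> borel_measurable M" for n by measurable
      fix e :: real assume e: "e > 0"
      \<comment> \<open>With c = e^2, a norm above e means D > 2 pi e^2 \<ge> 4 e^2. Removing c and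
        a tail below e^2 leaves loss / (2 e^2) > 2 e^2, that is loss > 4 e^4.\<close>
      have lim: "(\<lambda>n. sas.prob {y \<in> space M. \<bar>loss n y\<bar> > 4 * e ^ 4}) \<longlonglongrightarrow> 0"
        by (rule tendsto_zero_in_prob_real[OF part1]) (use e in simp)
      have ev_tail: "\<forall>\<^sub>F n in sequentially. tail n < e\<^sup>2" by (rule order_tendstoD(2)[OF tail0]) (use e in simp)
      have "(\<lambda>n. sas.prob {y \<in> space M. sqrt (D n y / (2 * pi)) > e}) \<longlonglongrightarrow> 0"
      proof (rule Lim_null_comparison[OF _ lim])
        show "\<forall>\<^sub>F n in sequentially. norm (sas.prob {y \<in> space M. sqrt (D n y / (2 * pi)) > e}) \<le> sas.prob {y \<in> space M. \<bar>loss n y\<bar> > 4 * e ^ 4}"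
          using ev_tail ev_n
        proof eventually_elim
          case (elim n)
          have "loss n y > 4 * e ^ 4" if "sqrt (D n y / (2 * pi)) > e" for y
          proof -
            have "e\<^sup>2 < D n y / (2 * pi)"
              using that e by (metis less_eq_real_def not_less real_le_lsqrt)
            then have "e\<^sup>2 * (2 * pi) < D n y" by (simp add: pos_less_divide_eq)
            moreover have "e\<^sup>2 * 4 \<le> e\<^sup>2 * (2 * pi)" using pi_gt3 by (intro mult_left_mono) auto
            moreover have "D n y \<le> loss n y / (2 * e\<^sup>2) + e\<^sup>2 + tail n" using e elim by (intro D_le) auto
            ultimately have "2 * e\<^sup>2 < loss n y / (2 * e\<^sup>2)" using elim by linarith
            then have "2 * e\<^sup>2 * (2 * e\<^sup>2) < loss n y" using e by (simp add: pos_less_divide_eq)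
            then show ?thesis by (simp add: power2_eq_square power4_eq_xxxx mult_ac)
          qed
          then have "sas.prob {y \<in> space M. sqrt (D n y / (2 * pi)) > e} \<le> sas.prob {y \<in> space M. \<bar>loss n y\<bar> > 4 * e ^ 4}"
            by (intro sas.finite_measure_mono) (auto intro: order.strict_trans2[OF _ abs_ge_self])
          then show ?case by simp
        qed
      qed
      moreover have "\<bar>sqrt (D n y / (2 * pi))\<bar> = sqrt (D n y / (2 * pi))" for n y
        by (simp add: D_def)
      ultimately show "(\<lambda>n. sas.prob {y \<in> space M. \<bar>ereal (sqrt (D n y / (2 * pi)))\<bar> > ereal e}) \<longlonglongrightarrow> 0"
        by simp
    qed
  qed
  show ?thesis unfolding loss_eq using part1 part2 by blast
qed

end
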